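(* Let $\Gamma$ be a finite group acting on an affine scheme $X$ and on a finite-dimensional Lie algebra $\mathfrak{g}$, and let $\mathfrak{M}=M(X,\mathfrak{g})^\Gamma$. Assume $|\tilde X|<\infty$. Then $[\mathfrak{M},\mathfrak{M}]=\mathfrak{M}^d$ if and only if all irreducible finite-dimensional representations of $\mathfrak{M}$ are evaluation representations.
   Context: $k$ is an algebraically closed field of characteristic zero; all tensor products are over $k$. $X=\operatorname{Spec}A$ is an affine $k$-scheme ($A$ a commutative associative unital $k$-algebra, not assumed finitely generated or reduced). The finite group $\Gamma$ acts on $X$ by scheme automorphisms (over $k$), hence on $A$ by $g\cdot f=f\circ g^{-1}$, and on the finite-dimensional $k$-Lie algebra $\mathfrak{g}$ by Lie algebra automorphisms. $\mathfrak{M}=M(X,\mathfrak{g})^\Gamma$ is the Lie algebra of $\Gamma$-equivariant regular maps $X\to\mathfrak{g}$ with pointwise operations; equivalently $\mathfrak{M}=(\mathfrak{g}\otimes A)^\Gamma$ for the diagonal action, with bracket $[u\otimes f,v\otimes h]=[u,v]\otimes fh$. $X_{\rm rat}$ is the set of $k$-rational points of $X$. For $x\in X_{\rm rat}$ and $\alpha=\sum_i u_i\otimes f_i$, put $\alpha(x)=\sum_i f_i(x)u_i$. Let $\Gamma_x=\{g\in\Gamma:g\cdot x=x\}$ and $\mathfrak{g}^x=\{u\in\mathfrak{g}:g\cdot u=u\ \forall g\in\Gamma_x\}$; one has $\alpha(x)\in\mathfrak{g}^x$ for $\alpha\in\mathfrak{M}$. Define $\tilde X=\{x\in X_{\rm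 rat}:[\mathfrak{g}^x,\mathfrak{g}^x]\neq\mathfrak{g}^x\}$ and $\mathfrak{M}^d=\{\alpha\in\mathfrak{M}:\alpha(x)\in[\mathfrak{g}^x,\mathfrak{g}^x]\ \forall x\in X_{\rm rat}\}$. An evaluation representation of $\mathfrak{M}$ is one (isomorphic to one) of the form $\mathfrak{M}\xrightarrow{\ \mathrm{ev}_{\mathbf x}\ }\bigoplus_{x\in\mathbf{x}}\mathfrak{g}^x\xrightarrow{\ \otimes_{x\in\mathbf x}\rho_x\ }\operatorname{End}_k\big(\bigotimes_{x\in\mathbf{x}}V_x\big)$, where $\mathbf{x}\subseteq X_{\rm rat}$ is a finite subset, $\mathrm{ev}_{\mathbf x}(\alpha)=(\alpha(x))_{x\in\mathbf x}$, the $\rho_x:\mathfrak{g}^x\to\operatorname{End}_kV_x$ are representations, and $\otimes_{x}\rho_x$ is the tensor product representation of the direct sum; the trivial one-dimensional representation counts as an evaluation representation. *)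

theory Defs
  imports
    "HOL-Algebra.Group_Action"
    "HOL-Computational_Algebra.Polynomial"
    "HOL-Library.Function_Algebras"
begin

section \<open>Lie algebras and algebras over a field\<close>

locale lie_algebra = vector_space scale
  for scale :: "'k::field \<Rightarrow> 'g::ab_group_add \<Rightarrow> 'g" +
  fixes bracket :: "'g \<Rightarrow> 'g \<Rightarrow> 'g"
  assumes linear_left: "Vector_Spaces.linear scale scale (\<lambda>u. bracket u v)"
    and linear_right: "Vector_Spaces.linear scale scale (bracket u)"
    and alternating: "bracket u u = 0"
    and jacobi: "bracket u (bracket v w) + bracket v (bracket w u) + bracket w (bracket u v) = 0"

text \<open>The unit is an explicit parameter instead of being supplied by the class \<open>comm_ring_1\<close>,
  because that class demands \<open>0 \<noteq> 1\<close> and would exclude the zero algebra (the empty affine scheme).\<close>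

locale comm_algebra = vector_space scale
  for scale :: "'k::field \<Rightarrow> 'a::comm_ring \<Rightarrow> 'a" +
  fixes unit :: 'a
  assumes mult_scale_left: "scale c f * h = scale c (f * h)"
    and unit_left: "unit * f = f"

text \<open>\<open>[L, L]\<close> for a subalgebra \<open>L\<close>: the linear span of the brackets.\<close>

definition lie_derived ::
    "('k::field \<Rightarrow> 'l::ab_group_add \<Rightarrow> 'l) \<Rightarrow> ('l \<Rightarrow> 'l \<Rightarrow> 'l) \<Rightarrow> 'l set \<Rightarrow> 'l set"
  where "lie_derived scale bracket L = module.span scale {bracket u v | u v. u \<in> L \<and> v \<in> L}"


section \<open>Representations of Lie algebras on coordinate spaces\<close>

text \<open>For a finite set \<open>I\<close>, \<open>coord_space I\<close> is the space \<open>k\<^sup>I\<close>, encoded as the functions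
  vanishing outside \<open>I\<close>.  Every finite-dimensional vector space is isomorphic to
  \<open>coord_space {..<n}\<close> for some \<open>n\<close>.\<close>

definition coord_space :: "'i set \<Rightarrow> ('i \<Rightarrow> 'k::field) set"
  where "coord_space I = {v. \<forall>i. i \<notin> I \<longrightarrow> v i = 0}"

definition coord_scale :: "'k::field \<Rightarrow> ('i \<Rightarrow> 'k) \<Rightarrow> 'i \<Rightarrow> 'k"
  where "coord_scale c v = (\<lambda>i. c * v i)"

definition linear_on :: "'i set \<Rightarrow> 'j set \<Rightarrow> (('i \<Rightarrow> 'k::field) \<Rightarrow> 'j \<Rightarrow> 'k) \<Rightarrow> bool"
  where "linear_on I J T \<longleftrightarrow>
    (\<forall>v\<in>coord_space I. T v \<in> coord_space J) \<and>
    (\<forall>v\<in>coord_space I. \<forall>w\<in>coord_space I. T (v + w) = T v + T w) \<and>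
    (\<forall>c. \<forall>v\<in>coord_space I. T (coord_scale c v) = coord_scale c (T v))"

text \<open>A representation on \<open>k\<^sup>I\<close> of a subalgebra \<open>L\<close> (a subset of the type \<open>'l\<close>); the values of
  \<open>\<rho>\<close> outside \<open>L\<close>, and of the operators outside \<open>k\<^sup>I\<close>, are irrelevant.\<close>

definition lie_rep ::
    "('k::field \<Rightarrow> 'l::ab_group_add \<Rightarrow> 'l) \<Rightarrow> ('l \<Rightarrow> 'l \<Rightarrow> 'l) \<Rightarrow> 'l set \<Rightarrow>
     'i set \<Rightarrow> ('l \<Rightarrow> ('i \<Rightarrow> 'k) \<Rightarrow> 'i \<Rightarrow> 'k) \<Rightarrow> bool"
  where "lie_rep scale bracket L I \<rho> \<longleftrightarrow>
    (\<forall>a\<in>L. linear_on I I (\<rho> a)) \<and>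
    (\<forall>a\<in>L. \<forall>b\<in>L. \<forall>v\<in>coord_space I. \<rho> (a + b) v = \<rho> a v + \<rho> b v) \<and>
    (\<forall>c. \<forall>a\<in>L. \<forall>v\<in>coord_space I. \<rho> (scale c a) v = coord_scale c (\<rho> a v)) \<and>
    (\<forall>a\<in>L. \<forall>b\<in>L. \<forall>v\<in>coord_space I. \<rho> (bracket a b) v = \<rho> a (\<rho> b v) - \<rho> b (\<rho> a v))"

definition irreducible_rep ::
    "('k::field \<Rightarrow> 'l::ab_group_add \<Rightarrow> 'l) \<Rightarrow> ('l \<Rightarrow> 'l \<Rightarrow> 'l) \<Rightarrow> 'l set \<Rightarrow>
     'i set \<Rightarrow> ('l \<Rightarrow> ('i \<Rightarrow> 'k) \<Rightarrow> 'i \<Rightarrow> 'k) \<Rightarrow> bool"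
  where "irreducible_rep scale bracket L I \<rho> \<longleftrightarrow>
    lie_rep scale bracket L I \<rho> \<and>
    (coord_space I :: ('i \<Rightarrow> 'k) set) \<noteq> {0} \<and>
    (\<forall>W. module.subspace coord_scale W \<and> W \<subseteq> coord_space I \<and> (\<forall>a\<in>L. \<forall>w\<in>W. \<rho> a w \<in> W) \<longrightarrow>
      W = {0} \<or> W = coord_space I)"

definition isomorphic_reps ::
    "'l set \<Rightarrow> 'i set \<Rightarrow> ('l \<Rightarrow> ('i \<Rightarrow> 'k::field) \<Rightarrow> 'i \<Rightarrow> 'k) \<Rightarrow>
     'j set \<Rightarrow> ('l \<Rightarrow> ('j \<Rightarrow> 'k) \<Rightarrow> 'j \<Rightarrow> 'k) \<Rightarrow> bool"
  where "isomorphic_reps L I \<rho> J \<sigma> \<longleftrightarrow>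
    (\<exists>T. linear_on I J T \<and> bij_betw T (coord_space I) (coord_space J) \<and>
      (\<forall>a\<in>L. \<forall>v\<in>coord_space I. T (\<rho> a v) = \<sigma> a (T v)))"

text \<open>For a finite set \<open>S\<close>, the tensor product over \<open>x \<in> S\<close> of the spaces \<open>k\<^bsup>I x\<^esup>\<close> is \<open>k\<close> to the
  power \<open>PiE S I\<close>: multi-indices pick one basis vector in each factor.  For \<open>S = {}\<close> there is
  exactly one multi-index, and the tensor product is \<open>k\<close>.\<close>

definition pure_tensor ::
    "'x set \<Rightarrow> ('x \<Rightarrow> 'i set) \<Rightarrow> ('x \<Rightarrow> 'i \<Rightarrow> 'k::field) \<Rightarrow> ('x \<Rightarrow> 'i) \<Rightarrow> 'k"
  where "pure_tensor S I v = (\<lambda>i. if i \<in> PiE S I then \<Prod>x\<in>S. v x (i x) else 0)"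

text \<open>The tensor product representation of a direct sum: \<open>(a\<^sub>x)\<close> acts as the sum over \<open>x\<close> of
  \<open>id \<otimes> \<dots> \<otimes> r\<^sub>x(a\<^sub>x) \<otimes> \<dots> \<otimes> id\<close>.  An operator \<open>T\<close> on the factor \<open>x\<close> is applied to a tensor
  \<open>t\<close> by applying it to the vectors \<open>m \<mapsto> t (i(x := m))\<close> in \<open>k\<^bsup>I x\<^esup>\<close>; on pure tensors this is
  the Leibniz rule, lemma \<open>tensor_rep_pure_tensor\<close>.\<close>

definition tensor_rep ::
    "'x set \<Rightarrow> ('x \<Rightarrow> 'i set) \<Rightarrow> ('x \<Rightarrow> 'l \<Rightarrow> ('i \<Rightarrow> 'k::field) \<Rightarrow> 'i \<Rightarrow> 'k) \<Rightarrow>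
     ('x \<Rightarrow> 'l) \<Rightarrow> (('x \<Rightarrow> 'i) \<Rightarrow> 'k) \<Rightarrow> ('x \<Rightarrow> 'i) \<Rightarrow> 'k"
  where "tensor_rep S I r a t =
    (\<lambda>i. if i \<in> PiE S I then \<Sum>x\<in>S. r x (a x) (\<lambda>m. t (i(x := m))) (i x) else 0)"

lemma tensor_rep_pure_tensor:
  fixes r :: "'x \<Rightarrow> 'l \<Rightarrow> ('i \<Rightarrow> 'k::field) \<Rightarrow> 'i \<Rightarrow> 'k"
  assumes S: "finite S"
    and lin: "\<And>x. x \<in> S \<Longrightarrow> linear_on (I x) (I x) (r x (a x))"
    and v: "\<And>x. x \<in> S \<Longrightarrow> v x \<in> coord_space (I x)"
  shows "tensor_rep S I r a (pure_tensor S I v) =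
    (\<Sum>x\<in>S. pure_tensor S I (v(x := r x (a x) (v x))))"
proof
  fix i
  have sum_app: "(\<Sum>x\<in>S. f x) i = (\<Sum>x\<in>S. f x i)" for f :: "'x \<Rightarrow> ('x \<Rightarrow> 'i) \<Rightarrow> 'k"
    by (induction S rule: infinite_finite_induct) auto
  show "tensor_rep S I r a (pure_tensor S I v) i =
    (\<Sum>x\<in>S. pure_tensor S I (v(x := r x (a x) (v x)))) i"
  proof (cases "i \<in> PiE S I")
    case False
    then show ?thesis by (simp add: tensor_rep_def sum_app pure_tensor_def)
  next
    case True
    have "r x (a x) (\<lambda>m. pure_tensor S I v (i(x := m))) (i x) =
        pure_tensor S I (v(x := r x (a x) (v x))) i" if x: "x \<in> S" for x
    proof -
      let ?c = "\<Prod>y\<in>S - {x}. v y (i y)"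
      have "pure_tensor S I v (i(x := m)) = coord_scale ?c (v x) m" for m
      proof (cases "m \<in> I x")
        case m: True
        then have "i(x := m) \<in> PiE S I"
          using True x by (auto simp: PiE_def extensional_def)
        moreover have "(\<Prod>y\<in>S. v y ((i(x := m)) y)) = v x m * ?c"
          using S x by (subst prod.remove[of S x]) auto
        ultimately show ?thesis
          by (simp add: pure_tensor_def coord_scale_def mult.commute)
      next
        case m: False
        then have "i(x := m) \<notin> PiE S I" using x PiE_mem[of "i(x := m)" S I x] by auto
        then show ?thesis
          using m v[OF x] by (auto simp: pure_tensor_def coord_scale_def coord_space_def)
      qed
      then have "r x (a x) (\<lambda>m. pure_tensor S I v (i(x := m))) = coord_scale ?c (r x (a x) (v x))"
        using lin[OF x] v[OF x] by (simp add: linear_on_def)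
      moreover have "(\<Prod>y\<in>S. (v(x := r x (a x) (v x))) y (i y)) = r x (a x) (v x) (i x) * ?c"
        using S x by (subst prod.remove[of S x]) auto
      ultimately show ?thesis
        using True by (simp add: pure_tensor_def coord_scale_def mult.commute)
    qed
    then show ?thesis
      using True by (simp add: tensor_rep_def sum_app)
  qed
qed


section \<open>Equivariant map algebras\<close>

text \<open>The affine scheme \<open>X = Spec A\<close> is given by its coordinate algebra \<open>A\<close> (the type \<open>'a\<close>) and
  an action of \<open>\<Gamma>\<close> on \<open>X\<close> by the corresponding action on \<open>A\<close> by algebra automorphisms,
  \<open>g \<cdot> f = f \<circ> g\<^sup>-\<^sup>1\<close>.\<close>

locale equivariant_map_algebra =
  lie_algebra gscale gbracket +
  finite_dimensional_vector_space gscale B +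
  A: comm_algebra ascale aunit +
  A_act: group_action \<Gamma> "UNIV :: 'a set" aact +
  g_act: group_action \<Gamma> "UNIV :: 'g set" gact
  for gscale :: "'k::field \<Rightarrow> 'g::ab_group_add \<Rightarrow> 'g"
    and gbracket :: "'g \<Rightarrow> 'g \<Rightarrow> 'g"
    and B :: "'g set"
    and ascale :: "'k \<Rightarrow> 'a::comm_ring \<Rightarrow> 'a"
    and aunit :: 'a
    and \<Gamma> :: "('c, 'd) monoid_scheme" (structure)
    and aact :: "'c \<Rightarrow> 'a \<Rightarrow> 'a"
    and gact :: "'c \<Rightarrow> 'g \<Rightarrow> 'g" +
  assumes finite_group: "finite (carrier \<Gamma>)"
    and aact_linear: "s \<in> carrier \<Gamma> \<Longrightarrow> Vector_Spaces.linear ascale ascale (aact s)"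
    and aact_mult: "s \<in> carrier \<Gamma> \<Longrightarrow> aact s (f * h) = aact s f * aact s h"
    and aact_unit: "s \<in> carrier \<Gamma> \<Longrightarrow> aact s aunit = aunit"
    and gact_linear: "s \<in> carrier \<Gamma> \<Longrightarrow> Vector_Spaces.linear gscale gscale (gact s)"
    and gact_bracket: "s \<in> carrier \<Gamma> \<Longrightarrow> gact s (gbracket u v) = gbracket (gact s u) (gact s v)"
begin

text \<open>As \<open>g\<close> has the basis \<open>B\<close>, \<open>g \<otimes> A\<close> is the direct sum of the \<open>b \<otimes> A\<close>, \<open>b \<in> B\<close>.  The element
  \<open>\<Sum>b\<in>B. b \<otimes> \<alpha> b\<close>, i.e. the regular map \<open>X \<rightarrow> g\<close> with coordinate functions \<open>\<alpha> b\<close>, is encoded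
  as the function \<open>\<alpha>\<close>, extended by zero outside \<open>B\<close>.\<close>

definition maps :: "('g \<Rightarrow> 'a) set"
  where "maps = {\<alpha>. \<forall>b. b \<notin> B \<longrightarrow> \<alpha> b = 0}"

definition map_scale :: "'k \<Rightarrow> ('g \<Rightarrow> 'a) \<Rightarrow> 'g \<Rightarrow> 'a"
  where "map_scale c \<alpha> = (\<lambda>b. ascale c (\<alpha> b))"

definition tensor :: "'g \<Rightarrow> 'a \<Rightarrow> 'g \<Rightarrow> 'a"
  where "tensor u f = (\<lambda>b. ascale (representation B u b) f)"

definition map_bracket :: "('g \<Rightarrow> 'a) \<Rightarrow> ('g \<Rightarrow> 'a) \<Rightarrow> 'g \<Rightarrow> 'a"
  where "map_bracket \<alpha> \<beta> = (\<Sum>b\<in>B. \<Sum>c\<in>B. tensor (gbracket b c) (\<alpha> b * \<beta> c))"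

definition map_act :: "'c \<Rightarrow> ('g \<Rightarrow> 'a) \<Rightarrow> 'g \<Rightarrow> 'a"
  where "map_act s \<alpha> = (\<Sum>b\<in>B. tensor (gact s b) (aact s (\<alpha> b)))"

definition equivariant_maps :: "('g \<Rightarrow> 'a) set"
  where "equivariant_maps = {\<alpha> \<in> maps. \<forall>s\<in>carrier \<Gamma>. map_act s \<alpha> = \<alpha>}"

text \<open>The \<open>k\<close>-rational points of \<open>Spec A\<close> are the \<open>k\<close>-algebra homomorphisms \<open>A \<rightarrow> k\<close>; the value
  \<open>f(x)\<close> is \<open>x f\<close>.\<close>

definition rat_points :: "('a \<Rightarrow> 'k) set"
  where "rat_points = {x. Vector_Spaces.linear ascale (*) x \<and> (\<forall>f h. x (f * h) = x f * x h) \<and>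
    x aunit = 1}"

definition point_act :: "'c \<Rightarrow> ('a \<Rightarrow> 'k) \<Rightarrow> 'a \<Rightarrow> 'k"
  where "point_act s x = (\<lambda>f. x (aact (inv s) f))"

definition eval_at :: "('a \<Rightarrow> 'k) \<Rightarrow> ('g \<Rightarrow> 'a) \<Rightarrow> 'g"
  where "eval_at x \<alpha> = (\<Sum>b\<in>B. gscale (x (\<alpha> b)) b)"

text \<open>The subalgebra \<open>g\<^sup>x\<close> of fixed points of the stabilizer \<open>\<Gamma>\<^sub>x\<close>.\<close>

definition point_fixed :: "('a \<Rightarrow> 'k) \<Rightarrow> 'g set"
  where "point_fixed x = {u. \<forall>s\<in>stabilizer \<Gamma> point_act x. gact s u = u}"

definition tilde_points :: "('a \<Rightarrow> 'k) set"
  where "tilde_points =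
    {x \<in> rat_points. lie_derived gscale gbracket (point_fixed x) \<noteq> point_fixed x}"

definition maps_d :: "('g \<Rightarrow> 'a) set"
  where "maps_d = {\<alpha> \<in> equivariant_maps. \<forall>x\<in>rat_points.
    eval_at x \<alpha> \<in> lie_derived gscale gbracket (point_fixed x)}"

definition evaluation_rep ::
    "'i set \<Rightarrow> (('g \<Rightarrow> 'a) \<Rightarrow> ('i \<Rightarrow> 'k) \<Rightarrow> 'i \<Rightarrow> 'k) \<Rightarrow> bool"
  where "evaluation_rep I \<rho> \<longleftrightarrow>
    (\<exists>S (n :: ('a \<Rightarrow> 'k) \<Rightarrow> nat) r. finite S \<and> S \<subseteq> rat_points \<and>
      (\<forall>x\<in>S. lie_rep gscale gbracket (point_fixed x) {..<n x} (r x)) \<and>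
      isomorphic_reps equivariant_maps I \<rho>
        (PiE S (\<lambda>x. {..<n x}))
        (\<lambda>\<alpha>. tensor_rep S (\<lambda>x. {..<n x}) r (\<lambda>x. eval_at x \<alpha>)))"

text \<open>The basis-free description of the operations on \<open>g \<otimes> A\<close>.\<close>

lemma sum_fun_apply: "(\<Sum>x\<in>S. f x) y = (\<Sum>x\<in>S. f x y)" for f :: "'x \<Rightarrow> 'y \<Rightarrow> 'z::comm_monoid_add"
  by (induction S rule: infinite_finite_induct) auto

lemma representation_outside: "b \<notin> B \<Longrightarrow> representation B u b = 0"
  using representation_ne_zero by blast

lemma representation_linear:
  "representation B (u + v) = (\<lambda>b. representation B u b + representation B v b)"
  "representation B (gscale c u) = (\<lambda>b. c * representation B u b)"
  by (simp_all add: representation_add representation_scale independent_Basis span_Basis)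

lemma sum_representation: "(\<Sum>b\<in>B. gscale (representation B u b) b) = u"
  by (rule sum_representation_eq) (auto simp: finite_Basis independent_Basis span_Basis)

lemma tensor_add_left: "tensor (u + v) f = tensor u f + tensor v f"
  by (auto simp: tensor_def representation_linear A.scale_left_distrib)

lemma tensor_add_right: "tensor u (f + h) = tensor u f + tensor u h"
  by (auto simp: tensor_def A.scale_right_distrib)

lemma tensor_scale_left: "tensor (gscale c u) f = map_scale c (tensor u f)"
  by (auto simp: tensor_def map_scale_def representation_linear)

lemma tensor_scale_right: "tensor u (ascale c f) = map_scale c (tensor u f)"
  by (auto simp: tensor_def map_scale_def mult.commute)

lemma tensor_in_maps: "tensor u f \<in> maps"
  by (auto simp: tensor_def maps_def representation_outside)

lemma tensor_basis: "b \<in> B \<Longrightarrow> tensor b f = (\<lambda>c. if c = b then f else 0)"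
  by (auto simp: tensor_def representation_basis independent_Basis)

lemma maps_eq_sum_tensor:
  assumes "\<alpha> \<in> maps"
  shows "\<alpha> = (\<Sum>b\<in>B. tensor b (\<alpha> b))"
proof
  fix c
  have "(\<Sum>b\<in>B. tensor b (\<alpha> b)) c = (\<Sum>b\<in>B. if c = b then \<alpha> b else 0)"
    unfolding sum_fun_apply by (rule sum.cong) (simp_all add: tensor_basis)
  also have "\<dots> = \<alpha> c"
    using assms finite_Basis by (auto simp: maps_def sum.delta)
  finally show "\<alpha> c = (\<Sum>b\<in>B. tensor b (\<alpha> b)) c" ..
qed

lemma eval_at_tensor:
  assumes "x \<in> rat_points"
  shows "eval_at x (tensor u f) = gscale (x f) u"
proof -
  interpret x: Vector_Spaces.linear ascale "(*)" x
    using assms by (simp add: rat_points_def)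
  have "eval_at x (tensor u f) = gscale (x f) (\<Sum>b\<in>B. gscale (representation B u b) b)"
    by (simp add: eval_at_def tensor_def x.scale scale_sum_right mult.commute)
  then show ?thesis by (simp add: sum_representation)
qed

lemma tensor_sum_left: "tensor (\<Sum>b\<in>S. h b) f = (\<Sum>b\<in>S. tensor (h b) f)"
proof -
  have "tensor 0 f = 0"
    using tensor_add_left[of 0 0 f] by simp
  then show ?thesis
    by (induction S rule: infinite_finite_induct) (auto simp: tensor_add_left)
qed

lemma map_act_tensor:
  assumes "s \<in> carrier \<Gamma>"
  shows "map_act s (tensor u f) = tensor (gact s u) (aact s f)"
proof -
  interpret a: Vector_Spaces.linear ascale ascale "aact s" using assms by (rule aact_linear)
  interpret l: Vector_Spaces.linear gscale gscale "gact s" using assms by (rule gact_linear)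
  have "map_act s (tensor u f) =
      (\<Sum>b\<in>B. tensor (gact s (gscale (representation B u b) b)) (aact s f))"
    by (simp add: map_act_def tensor_def[of u] a.scale l.scale tensor_scale_left tensor_scale_right)
  also have "\<dots> = tensor (gact s u) (aact s f)"
    by (simp add: tensor_sum_left[symmetric] l.sum[symmetric] sum_representation)
  finally show ?thesis .
qed

lemma map_bracket_tensor: "map_bracket (tensor u f) (tensor v h) = tensor (gbracket u v) (f * h)"
proof -
  have l: "gbracket (\<Sum>b\<in>S. p b) w = (\<Sum>b\<in>S. gbracket (p b) w)"
    and l': "gbracket (gscale c p') w = gscale c (gbracket p' w)" for S :: "'g set" and p w c p'
    using Vector_Spaces.linear.axioms(3)[OF linear_left] module_hom.sum module_hom.scale by blast+
  have r: "gbracket w (\<Sum>b\<in>S. p b) = (\<Sum>b\<in>S. gbracket w (p b))"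
    and r': "gbracket w (gscale c p') = gscale c (gbracket w p')" for S :: "'g set" and p w c p'
    using Vector_Spaces.linear.axioms(3)[OF linear_right] module_hom.sum module_hom.scale by blast+
  have m: "p * ascale c q = ascale c (p * q)" for p q c
    using A.mult_scale_left by (metis mult.commute)
  have "map_bracket (tensor u f) (tensor v h) =
      (\<Sum>b\<in>B. \<Sum>c\<in>B. tensor (gbracket (gscale (representation B u b) b)
         (gscale (representation B v c) c)) (f * h))"
    by (simp add: map_bracket_def tensor_def[of u] tensor_def[of v] l' r' m A.mult_scale_left
        tensor_scale_left tensor_scale_right)
  also have "\<dots> = tensor (gbracket u v) (f * h)"
    by (simp add: tensor_sum_left[symmetric] r[symmetric] l[symmetric] sum_representation)
  finally show ?thesis .
qed

end

end

theory Submission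
  imports Defs
begin

text \<open>Write \<open>M\<close> for the Lie algebra of equivariant maps and \<open>R\<close> for the ring of \<open>\<Gamma>\<close>-invariant
  functions.  Evaluation at \<open>x\<close> is a Lie algebra homomorphism \<open>M \<rightarrow> g\<^sup>x\<close>, so \<open>[M, M] \<subseteq> M\<^sup>d\<close> always holds.

  Suppose that all irreducible representations are evaluation representations.  A linear form that
  vanishes on \<open>[M, M]\<close> is a one-dimensional representation.  If it is an evaluation representation,
  then all its tensor factors are one-dimensional, so each of them kills \<open>[g\<^sup>x, g\<^sup>x]\<close>, and the form
  vanishes on \<open>M\<^sup>d\<close>.  As linear forms separate \<open>[M, M]\<close> from any element outside it,
  \<open>M\<^sup>d = [M, M]\<close> (\<open>maps_d_if_evaluation\<close>).

  Conversely, suppose that \<open>[M, M] = M\<^sup>d\<close> and let \<open>M\<close> act irreducibly on \<open>V\<close>.  The argument finds a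
  finite set of points such that an element of \<open>M\<close> that vanishes there acts by zero, and then
  decomposes \<open>V\<close> over these points.

  \<^item> Let \<open>K\<close> be the set of elements of \<open>M\<close> that act by scalars.  Commutators have trace zero, so an element of
    \<open>K \<inter> [M, M]\<close> acts by zero.  By Schur's lemma \<open>K\<close> is closed under multiplication by \<open>R\<close>, and by
    the invariance of weight spaces (\<open>commuting_ideal_acts_by_scalars\<close>) every ideal \<open>N\<close> of \<open>M\<close> with
    \<open>[N, N] \<subseteq> K\<close> is contained in \<open>K\<close>.

  \<^item> Let \<open>I\<close> be the ideal of those functions \<open>f\<close> for which the symmetrization over \<open>\<Gamma>\<close> of every \<open>u \<otimes> f h\<close>
    lies in \<open>K\<close>.  The property of \<open>K\<close> just mentioned makes \<open>I\<close> a radical ideal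
    (\<open>coeff_ideal_radical\<close>).  As \<open>M / K\<close> is finite-dimensional, so is \<open>R / (R \<inter> I)\<close>, and the coordinate
    algebra is integral over \<open>R\<close>.  Hence prime ideals containing \<open>I\<close> that are maximal with respect to
    avoiding a given function have residue field \<open>k\<close> (\<open>rational_point_avoiding\<close>): \<open>I\<close> consists of the
    functions that vanish at all rational points of the closed subscheme defined by \<open>I\<close>.  These points form
    finitely many orbits.  So there are finitely many points such that the elements of \<open>M\<close> that vanish
    at them lie in \<open>K\<close> (\<open>finitely_many_points_detect_K\<close>).

  \<^item> Add the finitely many points of \<open>X\<close> with \<open>[g\<^sup>x, g\<^sup>x] \<noteq> g\<^sup>x\<close>.  An element of \<open>M\<close> that vanishes at all these points
    lies in \<open>K\<close> and in \<open>M\<^sup>d = [M, M]\<close>, so it acts by zero.  Choosing one point in each orbit, the action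
    factors through the evaluation \<open>M \<rightarrow> \<Oplus>\<^sub>x g\<^sup>x\<close>, which is onto by interpolation
    (\<open>evaluation_surjective\<close>).

  \<^item> The summands \<open>g\<^sup>x\<close> act on \<open>V\<close> by commuting operators.  An irreducible module for commuting families of
    operators is a tensor product of modules for the single families (\<open>tensor_basis_exists\<close>), by
    Jacobson's density theorem.\<close>

section \<open>Irreducible families of operators\<close>

locale alg_closed_vector_space = vector_space scale
  for scale :: "'k::alg_closed_field \<Rightarrow> 'b::ab_group_add \<Rightarrow> 'b"
begin

abbreviation linear_op :: "('b \<Rightarrow> 'b) \<Rightarrow> bool"
  where "linear_op \<equiv> Vector_Spaces.linear scale scale"

lemma linear_op_simps:
  assumes "linear_op T"
  shows "T (u + v) = T u + T v" "T (scale c v) = scale c (T v)" "T 0 = 0" "T (u - v) = T u - T v"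
    "T (\<Sum>x\<in>X. f x) = (\<Sum>x\<in>X. T (f x))"
  using assms
  by (auto simp: linear_iff_module_hom module_hom.add module_hom.scale module_hom.zero
      module_hom.diff module_hom.sum)

text \<open>Linearity on a subspace only: Schur's lemma is applied below to a map that is defined
  by a choice of operators and has no meaning outside the irreducible subspace.\<close>

definition linear_within :: "'b set \<Rightarrow> ('b \<Rightarrow> 'b) \<Rightarrow> bool"
  where "linear_within U \<theta> \<longleftrightarrow> subspace U \<and> (\<forall>u\<in>U. \<theta> u \<in> U) \<and>
    (\<forall>u\<in>U. \<forall>v\<in>U. \<theta> (u + v) = \<theta> u + \<theta> v) \<and> (\<forall>c. \<forall>u\<in>U. \<theta> (scale c u) = scale c (\<theta> u))"

lemma linear_op_within:
  "linear_op \<theta> \<Longrightarrow> subspace U \<Longrightarrow> (\<And>u. u \<in> U \<Longrightarrow> \<theta> u \<in> U) \<Longrightarrow> linear_within U \<theta>"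
  by (auto simp: linear_within_def linear_op_simps)

lemma linear_within_sum:
  assumes "linear_within U \<theta>" "\<And>i. i \<in> X \<Longrightarrow> f i \<in> U"
  shows "\<theta> (\<Sum>i\<in>X. f i) = (\<Sum>i\<in>X. \<theta> (f i))"
proof -
  have U: "subspace U" using assms(1) by (simp add: linear_within_def)
  have 0: "\<theta> 0 = 0"
    using assms(1) subspace_0[OF U] unfolding linear_within_def
    by (metis add_cancel_right_right)
  show ?thesis using assms(2)
  proof (induction X rule: infinite_finite_induct)
    case (insert x F)
    then show ?case
      using assms(1) subspace_sum[OF U, of F f] by (simp add: linear_within_def)
  qed (use 0 in auto)
qed

text \<open>A polynomial relation \<open>p(\<theta>) v \<in> W\<close> factors over an algebraically closed field: \<open>p = (X - c) q\<close>.
  Either \<open>q(\<theta>) v\<close> is the eigenvector modulo \<open>W\<close>, or \<open>q\<close> is a relation of smaller degree.  With \<open>W = {0}\<close> this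
  yields eigenvectors; with a prime ideal for \<open>W\<close> it yields residues in the ground field.\<close>

lemma eigenvector_modulo:
  assumes \<theta>: "linear_within U \<theta>" and v: "v \<in> U" "v \<notin> W" and W: "subspace W"
    and p: "p \<noteq> 0" "(\<Sum>i\<le>degree p. scale (coeff p i) ((\<theta> ^^ i) v)) \<in> W"
  shows "\<exists>c. \<exists>v'\<in>U. v' \<notin> W \<and> \<theta> v' - scale c v' \<in> W"
  using p
proof (induction "degree p" arbitrary: p)
  case 0
  then have "scale (coeff p 0) v \<in> W" "coeff p 0 \<noteq> 0"
    by (auto simp: leading_coeff_0_iff[symmetric])
  then have "scale (inverse (coeff p 0)) (scale (coeff p 0) v) \<in> W"
    using W subspace_scale by blast
  then show ?case using v \<open>coeff p 0 \<noteq> 0\<close> by simp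
next
  case (Suc d)
  have U: "subspace U" using \<theta> by (simp add: linear_within_def)
  have iter: "(\<theta> ^^ i) v \<in> U" for i
    using \<theta> v by (induction i) (auto simp: linear_within_def)
  obtain c where c: "poly p c = 0"
    using alg_closed_imp_poly_has_root[of p] Suc by auto
  then obtain q where q: "p = [:- c, 1:] * q" by (metis poly_eq_0_iff_dvd dvdE)
  have "q \<noteq> 0" using q Suc by auto
  then have deg: "degree q = d" using q Suc degree_mult_eq[of "[:- c, 1:]" q] by auto
  define w where "w = (\<Sum>i\<le>d. scale (coeff q i) ((\<theta> ^^ i) v))"
  have wU: "w \<in> U" unfolding w_def using iter U by (auto intro!: subspace_sum subspace_scale)
  have cp: "coeff p i = (case i of 0 \<Rightarrow> 0 | Suc j \<Rightarrow> coeff q j) - c * coeff q i" for i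
    unfolding q by (simp add: coeff_pCons split: nat.split)
  have "(\<Sum>i\<le>degree p. scale (coeff p i) ((\<theta> ^^ i) v)) =
     (\<Sum>i\<le>Suc d. scale (case i of 0 \<Rightarrow> 0 | Suc j \<Rightarrow> coeff q j) ((\<theta> ^^ i) v))
      - (\<Sum>i\<le>Suc d. scale (c * coeff q i) ((\<theta> ^^ i) v))"
    unfolding cp Suc(2)[symmetric] by (simp add: scale_left_diff_distrib sum_subtractf)
  also have "(\<Sum>i\<le>Suc d. scale (case i of 0 \<Rightarrow> 0 | Suc j \<Rightarrow> coeff q j) ((\<theta> ^^ i) v)) =
      (\<Sum>i\<le>d. scale (coeff q i) (\<theta> ((\<theta> ^^ i) v)))"
    by (subst sum.atMost_Suc_shift) simp
  also have "\<dots> = \<theta> w"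
    unfolding w_def using iter \<theta> U
    by (subst linear_within_sum[OF \<theta>]) (auto simp: linear_within_def subspace_scale)
  also have "(\<Sum>i\<le>Suc d. scale (c * coeff q i) ((\<theta> ^^ i) v)) = scale c w"
    unfolding w_def using coeff_eq_0[of q "Suc d"] deg
    by (simp add: scale_sum_right)
  finally have "\<theta> w - scale c w \<in> W" using Suc.prems by simp
  then show ?case
    using Suc.hyps(1)[of q] deg \<open>q \<noteq> 0\<close> wU unfolding w_def by blast
qed

text \<open>The vectors are given as a sequence and may repeat, as the powers of an operator do.\<close>

lemma linear_dependence_in_span:
  assumes F: "finite F" and w: "\<And>i. i \<le> card F \<Longrightarrow> w i \<in> span F"
  obtains c :: "nat \<Rightarrow> 'k" and j where "j \<le> card F" "c j \<noteq> 0" "(\<Sum>i\<le>card F. scale (c i) (w i)) = 0"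
proof (cases "inj_on w {..card F}")
  case True
  have "dependent (w ` {..card F})"
  proof (rule ccontr)
    assume "independent (w ` {..card F})"
    then have "card (w ` {..card F}) \<le> card F"
      using independent_span_bound[OF F, of "w ` {..card F}"] w by auto
    then show False using True by (simp add: card_image)
  qed
  then obtain u where u: "\<exists>v\<in>w ` {..card F}. u v \<noteq> 0" "(\<Sum>v\<in>w ` {..card F}. scale (u v) v) = 0"
    by (auto simp: dependent_finite)
  have "(\<Sum>i\<le>card F. scale (u (w i)) (w i)) = 0"
    using u(2) True by (simp add: sum.reindex)
  then show ?thesis using that[of _ "u \<circ> w"] u(1) by auto
next
  case False
  then obtain i j where ij: "i \<le> card F" "j \<le> card F" "i \<noteq> j" "w i = w j"
    by (auto simp: inj_on_def)
  define c :: "nat \<Rightarrow> 'k" where "c = (\<lambda>l. (if l = i then 1 else 0) - (if l = j then 1 else 0))"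
  have d: "scale (c l) (w l) = (if l = i then w i else 0) - (if l = j then w j else 0)" for l
    by (auto simp: c_def)
  have "(\<Sum>l\<le>card F. scale (c l) (w l)) = w i - w j"
    unfolding d sum_subtractf using ij by simp
  then show ?thesis using that[of i c] ij by (auto simp: c_def)
qed

lemma eigenvector_exists:
  assumes \<theta>: "linear_within U \<theta>" and U: "U \<noteq> {0}" and F: "finite F" "U \<subseteq> span F"
  shows "\<exists>c. \<exists>v\<in>U. v \<noteq> 0 \<and> \<theta> v = scale c v"
proof -
  have sU: "subspace U" using \<theta> by (simp add: linear_within_def)
  then obtain v where v: "v \<in> U" "v \<noteq> 0" using U subspace_0 by blast
  have iter: "(\<theta> ^^ i) v \<in> U" for i
    using \<theta> v by (induction i) (auto simp: linear_within_def)
  then have "(\<theta> ^^ i) v \<in> span F" for i using F by blast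
  then obtain c j where c: "j \<le> card F" "c j \<noteq> 0"
    "(\<Sum>i\<le>card F. scale (c i) ((\<theta> ^^ i) v)) = 0"
    by (rule linear_dependence_in_span[OF F(1)])
  define p where "p = (\<Sum>i\<le>card F. monom (c i) i)"
  have cp: "coeff p i = (if i \<le> card F then c i else 0)" for i
    by (simp add: p_def coeff_sum if_distrib cong: if_cong)
  have "coeff p j \<noteq> 0" using c(1,2) by (simp add: cp)
  then have p0: "p \<noteq> 0" by auto
  have dp: "degree p \<le> card F" by (rule degree_le) (simp add: cp)
  have "(\<Sum>i\<le>degree p. scale (coeff p i) ((\<theta> ^^ i) v)) =
      (\<Sum>i\<le>card F. scale (coeff p i) ((\<theta> ^^ i) v))"
    by (rule sum.mono_neutral_left) (use dp coeff_eq_0[of p] in auto)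
  also have "\<dots> = 0" using c(3) by (simp add: cp)
  finally have "\<exists>c. \<exists>v'\<in>U. v' \<notin> {0} \<and> \<theta> v' - scale c v' \<in> {0}"
    using v p0 by (intro eigenvector_modulo[OF \<theta> v(1)]) auto
  then show ?thesis by auto
qed

definition invariant_under :: "('b \<Rightarrow> 'b) set \<Rightarrow> 'b set \<Rightarrow> bool"
  where "invariant_under E W \<longleftrightarrow> (\<forall>T\<in>E. \<forall>w\<in>W. T w \<in> W)"

definition irreducible_under :: "('b \<Rightarrow> 'b) set \<Rightarrow> 'b set \<Rightarrow> bool"
  where "irreducible_under E U \<longleftrightarrow> subspace U \<and> U \<noteq> {0} \<and> invariant_under E U \<and>
    (\<forall>W. subspace W \<longrightarrow> W \<subseteq> U \<longrightarrow> invariant_under E W \<longrightarrow> W = {0} \<or> W = U)"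

lemma irreducible_underD:
  assumes "irreducible_under E U"
  shows "subspace U" "U \<noteq> {0}" "\<And>T u. T \<in> E \<Longrightarrow> u \<in> U \<Longrightarrow> T u \<in> U" "0 \<in> U"
  using assms by (auto simp: irreducible_under_def invariant_under_def subspace_0)

lemma irreducible_eqI:
  assumes "irreducible_under E U" "subspace W" "W \<subseteq> U" "\<And>T w. T \<in> E \<Longrightarrow> w \<in> W \<Longrightarrow> T w \<in> W"
    "w \<in> W" "w \<noteq> 0"
  shows "W = U"
  using assms unfolding irreducible_under_def invariant_under_def by blast

text \<open>An invariant subspace with a basis of least cardinality is irreducible: a basis of a smaller
  invariant subspace extends to a basis of the same cardinality, so nothing is added.\<close>

lemma exists_irreducible_subspace:
  assumes V: "subspace V" "V \<noteq> {0}" "invariant_under E V" and F: "finite F" "V \<subseteq> span F"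
  obtains U where "U \<subseteq> V" "irreducible_under E U"
proof -
  let ?P = "\<lambda>C. independent C \<and> C \<noteq> {} \<and> C \<subseteq> V \<and> invariant_under E (span C)"
  obtain C0 where C0: "C0 \<subseteq> V" "independent C0" "span C0 = V"
    using maximal_independent_subset[of V] V(1) by (metis span_subspace)
  have "?P C0" using C0 V by auto
  then have "?P (arg_min card ?P)" by (rule arg_min_natI)
  moreover have "\<And>D. ?P D \<Longrightarrow> card (arg_min card ?P) \<le> card D" by (rule arg_min_nat_le)
  ultimately obtain C where C: "?P C" and min: "\<And>D. ?P D \<Longrightarrow> card C \<le> card D"
    by blast
  have finC: "finite C"
    using independent_span_bound[OF F(1), of C] C F(2) by blast
  have "irreducible_under E (span C)"
    unfolding irreducible_under_def
  proof (intro conjI allI impI)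
    show "span C \<noteq> {0}"
      using C span_superset[of C] by (auto simp: dependent_zero)
    fix W assume W: "subspace W" "W \<subseteq> span C" "invariant_under E W"
    obtain D where D: "D \<subseteq> W" "independent D" "span D = W"
      using maximal_independent_subset[of W] W(1) by (metis span_subspace)
    show "W = {0} \<or> W = span C"
    proof (cases "D = {}")
      case False
      then have "?P D"
        using D W C by (metis V(1) order.trans span_minimal)
      then have le: "card C \<le> card D" by (rule min)
      obtain D' where D': "D \<subseteq> D'" "D' \<subseteq> span C" "independent D'" "span C \<subseteq> span D'"
        using maximal_independent_subset_extend[of D "span C"] D W by auto
      have "finite D'" "card D' \<le> card C"
        using independent_span_bound[OF finC D'(3,2)] by auto
      then have "D = D'" using le D' by (metis card_subset_eq card_mono order.antisym order.trans)
      then have "W = span C" using D D' W by auto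
      then show ?thesis ..
    qed (use D in auto)
  qed (use C in auto)
  moreover have "span C \<subseteq> V" using C V span_minimal by blast
  ultimately show ?thesis using that by blast
qed

lemma schur:
  assumes U: "irreducible_under E U" and F: "finite F" "U \<subseteq> span F"
    and E: "\<And>T. T \<in> E \<Longrightarrow> linear_op T"
    and \<theta>: "linear_within U \<theta>" and comm: "\<And>T u. T \<in> E \<Longrightarrow> u \<in> U \<Longrightarrow> \<theta> (T u) = T (\<theta> u)"
  shows "\<exists>c. \<forall>u\<in>U. \<theta> u = scale c u"
proof -
  note D = irreducible_underD[OF U]
  obtain c v where v: "v \<in> U" "v \<noteq> 0" "\<theta> v = scale c v"
    using eigenvector_exists[OF \<theta> D(2) F] by blast
  have "{u \<in> U. \<theta> u = scale c u} = U"
  proof (rule irreducible_eqI[OF U])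
    show "subspace {u \<in> U. \<theta> u = scale c u}"
    proof (rule subspaceI)
      have "\<theta> (scale 0 0) = scale 0 (\<theta> 0)" using \<theta> D(4) unfolding linear_within_def by blast
      then show "0 \<in> {u \<in> U. \<theta> u = scale c u}" using D(4) by simp
    qed (use \<theta> D(1) in \<open>auto simp: linear_within_def subspace_add subspace_scale
          scale_right_distrib scale_left_commute\<close>)
    show "T w \<in> {u \<in> U. \<theta> u = scale c u}" if "T \<in> E" "w \<in> {u \<in> U. \<theta> u = scale c u}" for T w
      using that comm D(3) linear_op_simps(2)[OF E] by auto
  qed (use v in auto)
  then show ?thesis by blast
qed

inductive_set op_algebra :: "('b \<Rightarrow> 'b) set \<Rightarrow> ('b \<Rightarrow> 'b) set"
  for E :: "('b \<Rightarrow> 'b) set"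
  where ident: "(\<lambda>v. v) \<in> op_algebra E"
  | comp: "T \<in> E \<Longrightarrow> A \<in> op_algebra E \<Longrightarrow> (\<lambda>v. T (A v)) \<in> op_algebra E"
  | add: "A \<in> op_algebra E \<Longrightarrow> A' \<in> op_algebra E \<Longrightarrow> (\<lambda>v. A v + A' v) \<in> op_algebra E"
  | scal: "A \<in> op_algebra E \<Longrightarrow> (\<lambda>v. scale c (A v)) \<in> op_algebra E"

lemma op_algebra_diff:
  "A \<in> op_algebra E \<Longrightarrow> A' \<in> op_algebra E \<Longrightarrow> (\<lambda>v. A v - A' v) \<in> op_algebra E"
  using op_algebra.add[of A E "\<lambda>v. scale (-1) (A' v)"] op_algebra.scal[of A' E "-1"] by simp

lemma op_algebra_zero: "(\<lambda>v. 0) \<in> op_algebra E"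
  using op_algebra.scal[OF op_algebra.ident, of 0] by simp

lemma op_algebra_sum:
  "(\<And>i. i \<in> X \<Longrightarrow> f i \<in> op_algebra E) \<Longrightarrow> (\<lambda>v. \<Sum>i\<in>X. f i v) \<in> op_algebra E"
  by (induction X rule: infinite_finite_induct) (auto simp: op_algebra_zero intro: op_algebra.add)

lemma op_algebra_linear:
  assumes "A \<in> op_algebra E" "\<And>T. T \<in> E \<Longrightarrow> linear_op T"
  shows "linear_op A"
  using assms
proof (induction rule: op_algebra.induct)
  case ident
  show ?case by (simp add: linear_iff_module_hom module_hom_iff module_axioms)
next
  case (comp T A)
  then show ?case
    using module_hom_compose[of scale scale A scale T] by (simp add: linear_iff_module_hom o_def)
qed (simp_all add: linear_iff_module_hom module_hom_iff algebra_simps scale_right_distrib)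

lemma op_algebra_invariant:
  assumes "A \<in> op_algebra E" "subspace W" "\<And>T w. T \<in> E \<Longrightarrow> w \<in> W \<Longrightarrow> T w \<in> W" "w \<in> W"
  shows "A w \<in> W"
  using assms(1) by induction (use assms(2-) in \<open>auto intro: subspace_add subspace_scale\<close>)

lemma op_algebra_commute:
  assumes "A \<in> op_algebra E" "linear_op T'" "\<And>T w. T \<in> E \<Longrightarrow> T' (T w) = T (T' w)"
  shows "T' (A v) = A (T' v)"
  using assms(1) by induction (use assms(2-) in \<open>auto simp: linear_op_simps\<close>)

text \<open>The operators that annihilate \<open>F\<close> form a left ideal, so their values at \<open>g\<close> form an invariant
  subspace.\<close>

lemma annihilator_orbit:
  assumes U: "irreducible_under E U" and E: "\<And>T. T \<in> E \<Longrightarrow> linear_op T" and g: "g \<in> U"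
    and A0: "A0 \<in> op_algebra E" "\<forall>f\<in>F. A0 f = 0" "A0 g \<noteq> 0"
  shows "{A g | A. A \<in> op_algebra E \<and> (\<forall>f\<in>F. A f = 0)} = U" (is "?W = U")
proof (rule irreducible_eqI[OF U])
  note D = irreducible_underD[OF U]
  show "subspace ?W"
  proof (rule subspaceI)
    show "0 \<in> ?W" by (intro CollectI exI[of _ "\<lambda>v. 0"]) (simp add: op_algebra_zero)
  next
    fix x y assume "x \<in> ?W" "y \<in> ?W"
    then obtain A A' where "A \<in> op_algebra E" "A' \<in> op_algebra E" "\<forall>f\<in>F. A f = 0" "\<forall>f\<in>F. A' f = 0"
      "x = A g" "y = A' g" by blast
    then show "x + y \<in> ?W"
      by (intro CollectI exI[of _ "\<lambda>v. A v + A' v"]) (simp add: op_algebra.add)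
  next
    fix c x assume "x \<in> ?W"
    then obtain A where "A \<in> op_algebra E" "\<forall>f\<in>F. A f = 0" "x = A g" by blast
    then show "scale c x \<in> ?W"
      by (intro CollectI exI[of _ "\<lambda>v. scale c (A v)"]) (simp add: op_algebra.scal)
  qed
  show "?W \<subseteq> U" using op_algebra_invariant[OF _ D(1)] D(3) g by blast
  show "T w \<in> ?W" if T: "T \<in> E" "w \<in> ?W" for T w
  proof -
    from T obtain A where "A \<in> op_algebra E" "\<forall>f\<in>F. A f = 0" "w = A g" by blast
    then show ?thesis using T(1) linear_op_simps(3)[OF E]
      by (intro CollectI exI[of _ "\<lambda>v. T (A v)"]) (simp add: op_algebra.comp)
  qed
  show "A0 g \<in> ?W" "A0 g \<noteq> 0" using A0 by blast+
qed

text \<open>Jacobson density, by induction on \<open>F\<close>.  Suppose that every operator that kills \<open>F\<close> and \<open>g\<close> also kills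
  \<open>u\<close>.  Then \<open>A g \<mapsto> A u\<close>, for \<open>A\<close> killing \<open>F\<close>, is a well defined endomorphism of the
  irreducible space, hence a scalar \<open>c\<close>, and all these \<open>A\<close> kill \<open>u - c g\<close>.  By induction \<open>u - c g\<close> lies in the
  span of \<open>F\<close>.\<close>

lemma density:
  assumes U: "irreducible_under E U" and G: "finite G" "U \<subseteq> span G"
    and E: "\<And>T. T \<in> E \<Longrightarrow> linear_op T"
    and F: "finite F" "F \<subseteq> U"
  shows "u \<in> U \<Longrightarrow> u \<notin> span F \<Longrightarrow> \<exists>A\<in>op_algebra E. (\<forall>f\<in>F. A f = 0) \<and> A u \<noteq> 0"
  using F
proof (induction F arbitrary: u rule: finite_induct)
  case empty
  then show ?case using op_algebra.ident by fastforce
next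
  case (insert g F)
  note D = irreducible_underD[OF U]
  have lin: "A \<in> op_algebra E \<Longrightarrow> linear_op A" for A using op_algebra_linear E by blast
  have inU: "A \<in> op_algebra E \<Longrightarrow> w \<in> U \<Longrightarrow> A w \<in> U" for A w
    using op_algebra_invariant[OF _ D(1)] D(3) by blast
  have "g \<in> U" "F \<subseteq> U" using insert by auto
  show ?case
  proof (cases "g \<in> span F")
    case True
    then have "u \<notin> span F" using insert.prems by (simp add: span_redundant)
    then obtain A where A: "A \<in> op_algebra E" "\<forall>f\<in>F. A f = 0" "A u \<noteq> 0"
      using insert by blast
    have "A g = 0"
      using True A(2) lin[OF A(1)]
      by (metis linear_iff_module_hom module_hom.eq_0_on_span)
    then show ?thesis using A by auto
  next
    case False
    show ?thesis
    proof (rule ccontr)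
      assume neg: "\<not> ?thesis"
      define L where "L = {A \<in> op_algebra E. \<forall>f\<in>F. A f = 0}"
      have Lu: "A u = 0" if "A \<in> L" "A g = 0" for A
        using neg that by (auto simp: L_def)
      have Ladd: "(\<lambda>v. A v + A' v) \<in> L" if "A \<in> L" "A' \<in> L" for A A'
        using that by (auto simp: L_def op_algebra.add)
      have Lscale: "(\<lambda>v. scale c (A v)) \<in> L" if "A \<in> L" for A c
        using that by (auto simp: L_def op_algebra.scal)
      have Ldiff: "(\<lambda>v. A v - A' v) \<in> L" if "A \<in> L" "A' \<in> L" for A A'
        using that by (auto simp: L_def op_algebra_diff)
      have Lcomp: "(\<lambda>v. T (A v)) \<in> L" if "T \<in> E" "A \<in> L" for T A
        using that linear_op_simps(3)[OF E] by (auto simp: L_def op_algebra.comp)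
      obtain A0 where A0: "A0 \<in> L" "A0 g \<noteq> 0"
        using insert.IH[of g] False \<open>g \<in> U\<close> \<open>F \<subseteq> U\<close> unfolding L_def by blast
      have LU: "{A g | A. A \<in> L} = U"
        using annihilator_orbit[OF U E \<open>g \<in> U\<close>, of A0 F] A0 by (simp add: L_def)
      have "\<forall>w\<in>U. \<exists>A. A \<in> L \<and> A g = w" using LU by blast
      from bchoice[OF this] obtain a where a: "\<And>w. w \<in> U \<Longrightarrow> a w \<in> L \<and> a w g = w" by blast
      have eq: "A u = a (A g) u" if "A \<in> L" for A
      proof -
        have "A g \<in> U" using that LU by blast
        then have 1: "a (A g) \<in> L" "a (A g) g = A g" using a by auto
        then show ?thesis using Lu[OF Ldiff[OF that 1(1)]] by simp
      qed
      define \<theta> where "\<theta> w = a w u" for w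
      have \<theta>A: "\<theta> (A g) = A u" if "A \<in> L" for A using eq[OF that] by (simp add: \<theta>_def)
      have aw: "a w \<in> L" "a w g = w" "\<theta> w = a w u" if "w \<in> U" for w
        using a[OF that] by (auto simp: \<theta>_def)
      have \<theta>lin: "linear_within U \<theta>"
        unfolding linear_within_def
      proof (intro conjI ballI allI)
        show "subspace U" by (rule D)
        show "\<theta> w \<in> U" if "w \<in> U" for w
          using aw[OF that] inU insert.prems by (auto simp: L_def)
        show "\<theta> (w + w') = \<theta> w + \<theta> w'" if "w \<in> U" "w' \<in> U" for w w'
          using \<theta>A[OF Ladd[OF aw(1)[OF that(1)] aw(1)[OF that(2)]]] aw[OF that(1)] aw[OF that(2)] by simp
        show "\<theta> (scale c w) = scale c (\<theta> w)" if "w \<in> U" for c w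
          using \<theta>A[OF Lscale[OF aw(1)[OF that]], of c] aw[OF that] by simp
      qed
      have "\<theta> (T w) = T (\<theta> w)" if "T \<in> E" "w \<in> U" for T w
        using \<theta>A[OF Lcomp[OF that(1) aw(1)[OF that(2)]]] aw[OF that(2)] by simp
      then obtain c where c: "\<And>w. w \<in> U \<Longrightarrow> \<theta> w = scale c w"
        using schur[OF U G E \<theta>lin] by blast
      have "A (u - scale c g) = 0" if "A \<in> L" for A
      proof -
        have "A u = scale c (A g)" using \<theta>A[OF that] c LU that by force
        then show ?thesis using lin that by (auto simp: L_def linear_op_simps)
      qed
      moreover have "u - scale c g \<in> U"
        using insert.prems \<open>g \<in> U\<close> D(1) by (auto intro: subspace_diff subspace_scale)
      ultimately have "u - scale c g \<in> span F"
        using insert.IH[of "u - scale c g"] \<open>F \<subseteq> U\<close> by (force simp: L_def)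
      then have "u \<in> span (insert g F)" by (auto simp: span_breakdown_eq)
      then show False using insert.prems by simp
    qed
  qed
qed

lemma density_basis:
  assumes U: "irreducible_under E U" and G: "finite G" "U \<subseteq> span G"
    and E: "\<And>T. T \<in> E \<Longrightarrow> linear_op T"
    and C: "finite C" "C \<subseteq> U" "independent C" "b \<in> C" and w: "w \<in> U"
  obtains A where "A \<in> op_algebra E" "A b = w" "\<And>b'. b' \<in> C - {b} \<Longrightarrow> A b' = 0"
proof -
  have "b \<notin> span (C - {b})" using C by (auto simp: dependent_def)
  then obtain A0 where A0: "A0 \<in> op_algebra E" "\<forall>f\<in>C - {b}. A0 f = 0" "A0 b \<noteq> 0"
    using density[OF U G E, of "C - {b}" b] C by blast
  have "b \<in> U" using C by blast
  then have "w \<in> {A b | A. A \<in> op_algebra E \<and> (\<forall>f\<in>C - {b}. A f = 0)}"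
    using annihilator_orbit[OF U E _ A0] w by simp
  then show ?thesis using that by blast
qed

end

section \<open>Tensor products of irreducible modules\<close>

lemma sum_PiE_insert:
  assumes "x \<notin> S"
  shows "(\<Sum>i\<in>PiE (insert x S) I. f i) = (\<Sum>j\<in>I x. \<Sum>i\<in>PiE S I. f (i(x := j)))"
proof -
  have "(\<Sum>i\<in>PiE (insert x S) I. f i) = (\<Sum>(j, i)\<in>I x \<times> PiE S I. f (i(x := j)))"
    unfolding PiE_insert_eq by (subst sum.reindex[OF inj_combinator[OF assms]]) (simp add: o_def case_prod_unfold)
  then show ?thesis by (simp add: sum.cartesian_product)
qed

context alg_closed_vector_space
begin

lemma in_span_imageE:
  assumes "finite J" "v \<in> span (f ` J)"
  obtains c where "v = (\<Sum>i\<in>J. scale (c i) (f i))"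
proof -
  let ?W = "{\<Sum>i\<in>J. scale (c i) (f i) | c. True}"
  have "f j \<in> ?W" if "j \<in> J" for j
  proof -
    have "f j = (\<Sum>i\<in>J. scale (if i = j then 1 else 0) (f i))"
      using assms(1) that by (simp add: if_distrib[of "\<lambda>c. scale c _"] sum.delta cong: if_cong)
    then show ?thesis by (intro CollectI exI[of _ "\<lambda>i. if i = j then 1 else 0"]) simp
  qed
  moreover have "subspace ?W"
  proof (rule subspaceI)
    show "0 \<in> ?W" by (intro CollectI exI[of _ "\<lambda>_. 0"]) simp
  next
    fix v w assume "v \<in> ?W" "w \<in> ?W"
    then obtain c d where "v = (\<Sum>i\<in>J. scale (c i) (f i))" "w = (\<Sum>i\<in>J. scale (d i) (f i))" by blast
    then show "v + w \<in> ?W"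
      by (intro CollectI exI[of _ "\<lambda>i. c i + d i"]) (simp add: scale_left_distrib sum.distrib)
  next
    fix k v assume "v \<in> ?W"
    then obtain c where "v = (\<Sum>i\<in>J. scale (c i) (f i))" by blast
    then show "scale k v \<in> ?W"
      by (intro CollectI exI[of _ "\<lambda>i. k * c i"]) (simp add: scale_sum_right)
  qed
  ultimately have "span (f ` J) \<subseteq> ?W" by (intro span_minimal) auto
  then show ?thesis using assms(2) that by blast
qed

text \<open>The vectors \<open>e i\<close>, where a multi-index \<open>i\<close> picks a number below \<open>n x\<close> for every \<open>x \<in> S\<close>, form a basis of
  \<open>V\<close> on which each \<open>\<sigma> x u\<close> acts through the matrix \<open>a x u\<close> on the index at \<open>x\<close> only.  This is the
  statement that \<open>V\<close> is a tensor product over \<open>S\<close>, without a tensor product of vector spaces.\<close>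

definition tensor_basis ::
    "'x set \<Rightarrow> ('x \<Rightarrow> 'l set) \<Rightarrow> ('x \<Rightarrow> 'l \<Rightarrow> 'b \<Rightarrow> 'b) \<Rightarrow> 'b set \<Rightarrow> ('x \<Rightarrow> nat) \<Rightarrow>
     (('x \<Rightarrow> nat) \<Rightarrow> 'b) \<Rightarrow> ('x \<Rightarrow> 'l \<Rightarrow> nat \<Rightarrow> nat \<Rightarrow> 'k) \<Rightarrow> bool"
  where "tensor_basis S G \<sigma> V n e a \<longleftrightarrow>
    e ` PiE S (\<lambda>x. {..<n x}) \<subseteq> V \<and>
    (\<forall>c. (\<Sum>i\<in>PiE S (\<lambda>x. {..<n x}). scale (c i) (e i)) = 0 \<longrightarrow> (\<forall>i\<in>PiE S (\<lambda>x. {..<n x}). c i = 0)) \<and>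
    V \<subseteq> span (e ` PiE S (\<lambda>x. {..<n x})) \<and>
    (\<forall>x\<in>S. \<forall>u\<in>G x. \<forall>i\<in>PiE S (\<lambda>x. {..<n x}).
      \<sigma> x u (e i) = (\<Sum>m<n x. scale (a x u m (i x)) (e (i(x := m)))))"

text \<open>Apply an element of the algebra generated by \<open>E\<close> that sends \<open>b j\<close> to \<open>w\<close> and the other basis vectors to
  zero; it commutes with all \<open>D i\<close>.\<close>

lemma commuting_independent:
  fixes b :: "nat \<Rightarrow> 'b"
  assumes U: "irreducible_under E U" and F: "finite F" "U \<subseteq> span F"
    and E: "\<And>T. T \<in> E \<Longrightarrow> linear_op T"
    and b: "inj_on b {..<m}" "b ` {..<m} \<subseteq> U" "independent (b ` {..<m})"
    and D: "\<And>j. j < m \<Longrightarrow> linear_op (D j)"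
    and comm: "\<And>j T w. j < m \<Longrightarrow> T \<in> E \<Longrightarrow> D j (T w) = T (D j w)"
    and 0: "(\<Sum>j<m. D j (b j)) = 0" and j: "j < m" and w: "w \<in> U"
  shows "D j w = 0"
proof -
  obtain A where A: "A \<in> op_algebra E" "A (b j) = w" "\<And>b'. b' \<in> b ` {..<m} - {b j} \<Longrightarrow> A b' = 0"
    using density_basis[OF U F E, of "b ` {..<m}" "b j" w] b j w by blast
  have Ab: "A (b i) = (if i = j then w else 0)" if "i < m" for i
    using A(2) A(3)[of "b i"] that j b(1) by (auto simp: inj_on_def)
  have linA: "linear_op A" using op_algebra_linear[OF A(1) E] .
  have "0 = A (\<Sum>i<m. D i (b i))" using 0 linear_op_simps(3)[OF linA] by simp
  also have "\<dots> = (\<Sum>i<m. D i (A (b i)))"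
    using op_algebra_commute[OF A(1) D comm] by (simp add: linear_op_simps(5)[OF linA])
  also have "\<dots> = (\<Sum>i<m. if i = j then D j w else 0)"
    using linear_op_simps(3)[OF D] by (intro sum.cong) (auto simp: Ab)
  also have "\<dots> = D j w" using j by simp
  finally show ?thesis by simp
qed

text \<open>Induction on \<open>S\<close>.  Let \<open>U\<close> be an irreducible subspace for the family at \<open>x\<close>, with basis \<open>b 0, b 1, \<dots>\<close>, and
  let \<open>A\<close> be the algebra generated by the other families.  As \<open>A\<close> commutes with the family at \<open>x\<close>, an
  element of \<open>A\<close> is determined on \<open>U\<close> by its value at \<open>b 0\<close>, and \<open>W = A (b 0)\<close> is irreducible for
  the other families.  If the \<open>T i (b 0)\<close> with \<open>T i \<in> A\<close> form a tensor basis of \<open>W\<close>, then the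
  \<open>T i (b j)\<close> form one of \<open>V\<close>.\<close>

theorem tensor_basis_exists:
  assumes "finite S"
    and "\<And>x u. x \<in> S \<Longrightarrow> u \<in> G x \<Longrightarrow> linear_op (\<sigma> x u)"
    and "\<And>x y u u' v. x \<in> S \<Longrightarrow> y \<in> S \<Longrightarrow> x \<noteq> y \<Longrightarrow> u \<in> G x \<Longrightarrow> u' \<in> G y \<Longrightarrow>
      \<sigma> x u (\<sigma> y u' v) = \<sigma> y u' (\<sigma> x u v)"
    and "irreducible_under (\<Union>x\<in>S. \<sigma> x ` G x) V" and F: "finite F" and "V \<subseteq> span F"
  shows "\<exists>n e a. tensor_basis S G \<sigma> V n e a"
  using assms(1-4,6)
proof (induction S arbitrary: V rule: finite_induct)
  case empty
  obtain v where v: "v \<in> V" "v \<noteq> 0" using irreducible_underD[OF empty(3)] by blast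
  have "span {v} = V"
    by (rule irreducible_eqI[OF empty(3) _ _ _ span_base v(2)])
      (use v irreducible_underD(1)[OF empty(3)] in \<open>auto intro: span_minimal[THEN subsetD]\<close>)
  then have "tensor_basis {} G \<sigma> V (\<lambda>_. 0) (\<lambda>_. v) a" for a
    using v by (auto simp: tensor_basis_def)
  then show ?case by blast
next
  case (insert x S V)
  define E where "E = \<sigma> x ` G x"
  define E' where "E' = (\<Union>y\<in>S. \<sigma> y ` G y)"
  have irrV: "irreducible_under (E \<union> E') V" using insert.prems by (simp add: E_def E'_def)
  note DV = irreducible_underD[OF irrV]
  have linE: "linear_op T" if "T \<in> E" for T using that insert.prems by (auto simp: E_def)
  have linE': "linear_op T" if "T \<in> E'" for T using that insert.prems by (auto simp: E'_def)
  have lin: "linear_op D" if "D \<in> op_algebra E'" for D using that linE' op_algebra_linear by blast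
  have commE: "D (T v) = T (D v)" if "D \<in> op_algebra E'" "T \<in> E" for D T v
  proof (rule op_algebra_commute[OF that(1) linE[OF that(2)], symmetric])
    fix T' w assume "T' \<in> E'"
    then obtain y u' where "y \<in> S" "u' \<in> G y" "T' = \<sigma> y u'" by (auto simp: E'_def)
    moreover obtain u where "u \<in> G x" "T = \<sigma> x u" using \<open>T \<in> E\<close> by (auto simp: E_def)
    ultimately show "T (T' w) = T' (T w)" using insert.hyps insert.prems(2)[of x y] by auto
  qed
  have "invariant_under E V" using DV(3) by (auto simp: invariant_under_def)
  then obtain U where U: "U \<subseteq> V" "irreducible_under E U"
    using exists_irreducible_subspace[OF DV(1,2) _ F insert.prems(4)] by blast
  note DU = irreducible_underD[OF U(2)]
  have UF: "U \<subseteq> span F" using U insert.prems(4) by blast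
  obtain C where C: "C \<subseteq> U" "independent C" "span C = U"
    using maximal_independent_subset[of U] DU(1) by (metis span_subspace)
  have finC: "finite C" using independent_span_bound[OF F C(2)] C(1) UF by blast
  define m where "m = card C"
  obtain b where bij: "bij_betw b {..<m} C"
    using ex_bij_betw_nat_finite[OF finC] by (auto simp: m_def atLeast0LessThan)
  then have bC: "b ` {..<m} = C" "inj_on b {..<m}" by (auto simp: bij_betw_def)
  have "C \<noteq> {}" using C DU(2) by auto
  then have m0: "0 < m" using finC by (simp add: m_def card_gt_0_iff)
  have bU: "b j \<in> U" if "j < m" for j using that bC C by auto
  have b0: "b 0 \<noteq> 0" using C(2) bC m0 dependent_zero by (metis imageI lessThan_iff)
  have indep: "D j w = 0"
    if "\<And>j. j < m \<Longrightarrow> D j \<in> op_algebra E'" "(\<Sum>j<m. D j (b j)) = 0" "j < m" "w \<in> U" for D j w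
    by (rule commuting_independent[OF U(2) F UF linE, of b m D])
      (use that bC C lin commE in auto)
  \<comment> \<open>The vectors of \<open>U\<close> killed by \<open>D\<close> form a subspace that the family at \<open>x\<close> leaves invariant.\<close>
  have kill: "D w = 0" if "D \<in> op_algebra E'" "D (b 0) = 0" "w \<in> U" for D w
  proof -
    have "{w \<in> U. D w = 0} = U"
    proof (rule irreducible_eqI[OF U(2)])
      show "subspace {w \<in> U. D w = 0}"
        using DU(1,4) by (intro subspaceI)
          (auto simp: linear_op_simps[OF lin[OF that(1)]] subspace_add subspace_scale)
      show "T w \<in> {w \<in> U. D w = 0}" if "T \<in> E" "w \<in> {w \<in> U. D w = 0}" for T w
        using that DU(3) commE[OF \<open>D \<in> op_algebra E'\<close>] linear_op_simps(3)[OF linE] by auto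
    qed (use b0 bU m0 that in auto)
    then show ?thesis using that by blast
  qed
  define s where "s u i j = representation C (\<sigma> x u (b j)) (b i)" for u i j
  have s: "\<sigma> x u (b j) = (\<Sum>i<m. scale (s u i j) (b i))" if "u \<in> G x" "j < m" for u j
  proof -
    have "\<sigma> x u (b j) \<in> span C" using that DU(3) bU C(3) by (auto simp: E_def)
    then have "(\<Sum>c\<in>C. scale (representation C (\<sigma> x u (b j)) c) c) = \<sigma> x u (b j)"
      by (intro sum_representation_eq) (use C finC in auto)
    then show ?thesis using sum.reindex_bij_betw[OF bij, of "\<lambda>c. scale (representation C (\<sigma> x u (b j)) c) c"]
      by (simp add: s_def)
  qed
  have invV: "D v \<in> V" if "D \<in> op_algebra E'" "v \<in> V" for D v
    using op_algebra_invariant[OF that(1) DV(1)] DV(3) that by blast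
  define W where "W = {D (b 0) | D. D \<in> op_algebra E'}"
  have irrW: "irreducible_under E' W"
    unfolding irreducible_under_def
  proof (intro conjI allI impI)
    show "subspace W"
    proof (rule subspaceI)
      show "0 \<in> W" unfolding W_def using op_algebra_zero by force
    next
      fix v w assume "v \<in> W" "w \<in> W"
      then show "v + w \<in> W" unfolding W_def using op_algebra.add by force
    next
      fix c v assume "v \<in> W"
      then show "scale c v \<in> W" unfolding W_def using op_algebra.scal by force
    qed
    show "W \<noteq> {0}" unfolding W_def using b0 op_algebra.ident by force
    show "invariant_under E' W"
      unfolding invariant_under_def W_def using op_algebra.comp by force
    fix W' assume W': "subspace W'" "W' \<subseteq> W" "invariant_under E' W'"
    have W'inv: "T w \<in> W'" if "T \<in> E'" "w \<in> W'" for T w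
      using W' that by (auto simp: invariant_under_def)
    show "W' = {0} \<or> W' = W"
    proof (cases "W' = {0}")
      case False
      then obtain w where w: "w \<in> W'" "w \<noteq> 0" using W' subspace_0 by blast
      then obtain D0 where D0: "D0 \<in> op_algebra E'" "w = D0 (b 0)" using W' by (auto simp: W_def)
      \<comment> \<open>The sums of \<open>D j (b j)\<close> with \<open>D j (b 0) \<in> W'\<close> form an invariant subspace, so they exhaust \<open>V\<close>.  Writing an
        element of \<open>W\<close> in this form and comparing with \<open>indep\<close> shows that it lies in \<open>W'\<close>.\<close>
      define P where "P D \<longleftrightarrow> (\<forall>j<m. D j \<in> op_algebra E' \<and> D j (b 0) \<in> W')" for D :: "nat \<Rightarrow> 'b \<Rightarrow> 'b"
      have single: "P (\<lambda>i. if i = 0 then D0 else (\<lambda>v. 0))"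
        using D0 w W' by (auto simp: P_def op_algebra_zero subspace_0)
      have "{\<Sum>j<m. D j (b j) | D. P D} = V"
      proof (rule irreducible_eqI[OF irrV])
        show "subspace {\<Sum>j<m. D j (b j) | D. P D}"
        proof (rule subspaceI)
          show "0 \<in> {\<Sum>j<m. D j (b j) | D. P D}"
            using W' by (intro CollectI exI[of _ "\<lambda>_ _. 0"]) (auto simp: P_def op_algebra_zero subspace_0)
        next
          fix v w assume "v \<in> {\<Sum>j<m. D j (b j) | D. P D}" "w \<in> {\<Sum>j<m. D j (b j) | D. P D}"
          then obtain D D' where "P D" "P D'" "v = (\<Sum>j<m. D j (b j))" "w = (\<Sum>j<m. D' j (b j))" by blast
          then show "v + w \<in> {\<Sum>j<m. D j (b j) | D. P D}"
            using W' by (intro CollectI exI[of _ "\<lambda>j v. D j v + D' j v"])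
              (auto simp: P_def op_algebra.add subspace_add sum.distrib)
        next
          fix c v assume "v \<in> {\<Sum>j<m. D j (b j) | D. P D}"
          then obtain D where "P D" "v = (\<Sum>j<m. D j (b j))" by blast
          then show "scale c v \<in> {\<Sum>j<m. D j (b j) | D. P D}"
            using W' by (intro CollectI exI[of _ "\<lambda>j v. scale c (D j v)"])
              (auto simp: P_def op_algebra.scal subspace_scale scale_sum_right)
        qed
        have "D j (b j) \<in> V" if "P D" "j < m" for D j
          using invV[of "D j" "b j"] that bU[OF that(2)] U(1) by (auto simp: P_def)
        then show "{\<Sum>j<m. D j (b j) | D. P D} \<subseteq> V"
          using DV(1) by (auto intro!: subspace_sum)
        show "T v \<in> {\<Sum>j<m. D j (b j) | D. P D}"
          if T: "T \<in> E \<union> E'" "v \<in> {\<Sum>j<m. D j (b j) | D. P D}" for T v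
        proof -
          from T obtain D where D: "P D" "v = (\<Sum>j<m. D j (b j))" by blast
          have linT: "linear_op T" using T linE linE' by blast
          show ?thesis
          proof (cases "T \<in> E'")
            case True
            then show ?thesis
              using D W'inv
              by (intro CollectI exI[of _ "\<lambda>j v. T (D j v)"])
                (auto simp: P_def op_algebra.comp linear_op_simps(5)[OF linT])
          next
            case False
            then have "T \<in> E" using T by blast
            then obtain u where u: "u \<in> G x" "T = \<sigma> x u" by (auto simp: E_def)
            have "T v = (\<Sum>j<m. D j (T (b j)))"
              unfolding D linear_op_simps(5)[OF linT]
              using D(1) commE[OF _ \<open>T \<in> E\<close>, symmetric] by (intro sum.cong) (auto simp: P_def)
            also have "\<dots> = (\<Sum>j<m. \<Sum>i<m. scale (s u i j) (D j (b i)))"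
              using D(1) s u lin by (intro sum.cong) (auto simp: P_def linear_op_simps)
            also have "\<dots> = (\<Sum>i<m. \<Sum>j<m. scale (s u i j) (D j (b i)))"
              by (rule sum.swap)
            finally show ?thesis
              using D(1) W'(1)
              by (intro CollectI exI[of _ "\<lambda>i v. \<Sum>j<m. scale (s u i j) (D j v)"])
                (auto simp: P_def intro!: op_algebra_sum op_algebra.scal subspace_sum subspace_scale)
          qed
        qed
        have "(\<Sum>j<m. (if j = 0 then D0 else (\<lambda>v. 0)) (b j)) = D0 (b 0)"
          using m0 by (simp add: if_distrib[of "\<lambda>f. f _"] cong: if_cong)
        then show "w \<in> {\<Sum>j<m. D j (b j) | D. P D}"
          using single D0 by (intro CollectI exI[of _ "\<lambda>i. if i = 0 then D0 else (\<lambda>v. 0)"]) simp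
      qed (use w in auto)
      moreover have "W \<subseteq> V" using invV bU[OF m0] U by (auto simp: W_def)
      moreover have "T0 (b 0) \<in> W'"
        if T0: "T0 \<in> op_algebra E'" "T0 (b 0) = (\<Sum>j<m. D j (b j))" "P D" for T0 D
      proof -
        define D' where "D' j = (\<lambda>v. D j v - (if j = 0 then T0 v else 0))" for j
        have "D' j \<in> op_algebra E'" if "j < m" for j
          using T0 that op_algebra_diff[of "D j" E' T0] by (cases "j = 0") (auto simp: D'_def P_def)
        moreover have "(\<Sum>j<m. D' j (b j)) = 0"
          using T0(2) m0 by (simp add: D'_def sum_subtractf)
        ultimately have "D' 0 (b 0) = 0" using indep m0 bU by blast
        then show ?thesis using T0 m0 by (auto simp: D'_def P_def)
      qed
      ultimately have "W \<subseteq> W'" unfolding W_def by blast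
      then show ?thesis using W' by blast
    qed simp
  qed
  have "W \<subseteq> V" using invV bU[OF m0] U by (auto simp: W_def)
  then have "\<exists>n e a. tensor_basis S G \<sigma> W n e a"
    using insert.IH[of W] insert.prems irrW by (auto simp: E'_def)
  then obtain n' e' a' where IH: "tensor_basis S G \<sigma> W n' e' a'" by blast
  define J' where "J' = PiE S (\<lambda>y. {..<n' y})"
  have fJ': "finite J'" unfolding J'_def using insert.hyps by (intro finite_PiE) auto
  have e'W: "e' i \<in> W" if "i \<in> J'" for i
    using IH that unfolding tensor_basis_def J'_def[symmetric] by blast
  have e'0: "(\<Sum>i\<in>J'. scale (c i) (e' i)) = 0 \<Longrightarrow> i \<in> J' \<Longrightarrow> c i = 0" for c i
    using IH unfolding tensor_basis_def J'_def[symmetric] by blast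
  have e'span: "W \<subseteq> span (e' ` J')"
    using IH unfolding tensor_basis_def J'_def[symmetric] by blast
  have e'act: "\<sigma> y u (e' i) = (\<Sum>l<n' y. scale (a' y u l (i y)) (e' (i(y := l))))"
    if "y \<in> S" "u \<in> G y" "i \<in> J'" for y u i
    using IH that unfolding tensor_basis_def J'_def[symmetric] by blast
  have "\<forall>i\<in>J'. \<exists>D. D \<in> op_algebra E' \<and> D (b 0) = e' i" using e'W by (force simp: W_def)
  from bchoice[OF this] obtain T where T: "\<And>i. i \<in> J' \<Longrightarrow> T i \<in> op_algebra E'"
    "\<And>i. i \<in> J' \<Longrightarrow> T i (b 0) = e' i" by blast
  define n where "n = n'(x := m)"
  define J where "J = PiE (insert x S) (\<lambda>y. {..<n y})"
  define e where "e i = T (restrict i S) (b (i x))" for i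
  define a where "a = a'(x := s)"
  have fJ: "finite J" unfolding J_def using insert.hyps by (intro finite_PiE) auto
  have JS: "PiE S (\<lambda>y. {..<n y}) = J'"
    unfolding J'_def n_def using insert.hyps by (intro PiE_cong) auto
  have J'J: "i(x := j) \<in> J" if "i \<in> J'" "j < m" for i j
    using that by (auto simp: J_def n_def J'_def PiE_iff extensional_def)
  have ej: "e (i(x := j)) = T i (b j)" if "i \<in> J'" for i j
  proof -
    have "restrict (i(x := j)) S = i"
      using that insert.hyps by (auto simp: J'_def PiE_iff extensional_def fun_eq_iff)
    then show ?thesis by (simp add: e_def)
  qed
  have Jrestrict: "restrict i S \<in> J'" "i x < m" if "i \<in> J" for i
    using that insert.hyps by (auto simp: J_def J'_def n_def PiE_iff split: if_splits)
  have eV: "e i \<in> V" if "i \<in> J" for i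
    unfolding e_def using Jrestrict(1)[OF that] bU[OF Jrestrict(2)[OF that]] T(1) U(1) invV by blast
  have sumJ: "(\<Sum>i\<in>J. scale (c i) (e i)) = (\<Sum>j<m. \<Sum>i\<in>J'. scale (c (i(x := j))) (T i (b j)))" for c
    unfolding J_def sum_PiE_insert[OF insert.hyps(2)] JS by (simp add: n_def ej)
  have e0: "c i = 0" if c: "(\<Sum>i\<in>J. scale (c i) (e i)) = 0" and i: "i \<in> J" for c i
  proof -
    have "(\<Sum>i'\<in>J'. scale (c (i'(x := j))) (T i' (b 0))) = 0" if "j < m" for j
      by (rule indep[of "\<lambda>j v. \<Sum>i'\<in>J'. scale (c (i'(x := j))) (T i' v)" j "b 0"])
        (use c T that bU m0 in \<open>auto simp: sumJ intro!: op_algebra_sum op_algebra.scal\<close>)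
    then have "c (i'(x := j)) = 0" if "j < m" "i' \<in> J'" for i' j
      using that e'0[of "\<lambda>i'. c (i'(x := j))" i'] T by simp
    moreover have "(restrict i S)(x := i x) = i"
      using i by (auto simp: J_def PiE_iff extensional_def fun_eq_iff)
    ultimately show ?thesis using Jrestrict[OF i] by metis
  qed
  have act: "\<sigma> y u (e i) = (\<Sum>l<n y. scale (a y u l (i y)) (e (i(y := l))))"
    if y: "y \<in> insert x S" "u \<in> G y" "i \<in> J" for y u i
  proof -
    define r where "r = restrict i S"
    have r: "r \<in> J'" "i x < m" using Jrestrict[OF y(3)] by (auto simp: r_def)
    show ?thesis
    proof (cases "y = x")
      case True
      have "\<sigma> x u (T r (b (i x))) = T r (\<sigma> x u (b (i x)))"
        using commE[OF T(1)[OF r(1)], of "\<sigma> x u"] y True by (auto simp: E_def)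
      also have "\<dots> = (\<Sum>l<m. scale (s u l (i x)) (T r (b l)))"
        using s y True r lin[OF T(1)[OF r(1)]] by (simp add: linear_op_simps)
      finally have "\<sigma> x u (T r (b (i x))) = (\<Sum>l<m. scale (s u l (i x)) (T r (b l)))" .
      moreover have "restrict (i(x := l)) S = r" for l
        using insert.hyps by (auto simp: r_def restrict_def)
      ultimately show ?thesis using True by (simp add: a_def n_def e_def r_def[symmetric])
    next
      case False
      then have yS: "y \<in> S" using y by blast
      have ry: "r y = i y" using yS by (simp add: r_def)
      have rl: "r(y := l) \<in> J'" if "l < n' y" for l
        using r(1) that yS by (auto simp: J'_def PiE_iff extensional_def)
      define D where "D = (\<lambda>v. \<sigma> y u (T r v) - (\<Sum>l<n' y. scale (a' y u l (i y)) (T (r(y := l)) v)))"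
      have "\<sigma> y u \<in> E'" using yS y by (auto simp: E'_def)
      moreover have "(\<lambda>v. \<Sum>l<n' y. scale (a' y u l (i y)) (T (r(y := l)) v)) \<in> op_algebra E'"
        by (rule op_algebra_sum, rule op_algebra.scal, rule T(1), rule rl) simp
      ultimately have "D \<in> op_algebra E'"
        unfolding D_def using op_algebra_diff op_algebra.comp[OF _ T(1)[OF r(1)]] by blast
      moreover have "D (b 0) = 0"
        using e'act[OF yS y(2) r(1)] T(2) rl r(1) by (simp add: D_def ry)
      ultimately have "D (b (i x)) = 0" using kill bU r by blast
      moreover have "restrict (i(y := l)) S = r(y := l)" for l
        using yS by (auto simp: r_def restrict_def)
      ultimately show ?thesis
        using False by (simp add: a_def n_def e_def r_def[symmetric] D_def)
    qed
  qed
  have "span (e ` J) = V"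
  proof -
    have "J' \<noteq> {}" using e'span irreducible_underD(2,4)[OF irrW] by auto
    then obtain i' where i': "i' \<in> J'" by blast
    define i where "i = i'(x := 0)"
    have iJ: "i \<in> J" using J'J i' m0 by (simp add: i_def)
    have ei: "e i \<noteq> 0"
    proof
      assume "e i = 0"
      then have "(\<Sum>j\<in>J. scale (if j = i then 1 else 0) (e j)) = 0"
        by (intro sum.neutral) auto
      from e0[OF this iJ] show False by simp
    qed
    show ?thesis
    proof (rule irreducible_eqI[OF irrV])
      show "span (e ` J) \<subseteq> V" using eV DV(1) by (intro span_minimal) auto
      show "T v \<in> span (e ` J)" if T: "T \<in> E \<union> E'" and v: "v \<in> span (e ` J)" for T v
      proof -
        obtain y u where yu: "y \<in> insert x S" "u \<in> G y" "T = \<sigma> y u"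
          using T by (auto simp: E_def E'_def)
        have linT: "linear_op T" using T linE linE' by blast
        have gen: "T (e i) \<in> span (e ` J)" if i: "i \<in> J" for i
        proof -
          have "i(y := l) \<in> J" if "l < n y" for l
            using i that yu(1) by (auto simp: J_def PiE_iff extensional_def)
          then show ?thesis
            unfolding yu(3) act[OF yu(1,2) i] by (intro span_sum span_scale span_base) auto
        qed
        obtain c where c: "v = (\<Sum>i\<in>J. scale (c i) (e i))"
          using in_span_imageE[OF fJ v] .
        show ?thesis
          unfolding c linear_op_simps(2,5)[OF linT] by (intro span_sum span_scale gen)
      qed
      show "e i \<in> span (e ` J)" using iJ by (intro span_base) auto
      show "e i \<noteq> 0" by (rule ei)
    qed auto
  qed
  then have "tensor_basis (insert x S) G \<sigma> V n e a"
    using eV e0 act unfolding tensor_basis_def J_def[symmetric] by blast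
  then show ?case by blast
qed

end

section \<open>Ideals acting by commuting operators\<close>

locale alg_closed_char_0_vector_space = alg_closed_vector_space scale
  for scale :: "'k::{alg_closed_field, field_char_0} \<Rightarrow> 'b::ab_group_add \<Rightarrow> 'b"
begin

text \<open>The vectors \<open>w, X w, X\<^sup>2 w, \<dots>\<close> span a flag on which \<open>N\<close> acts triangularly with the weight \<open>\<chi>\<close> on the
  diagonal (\<open>tri\<close>).  The next coefficient of \<open>T (X\<^sup>p w)\<close> is \<open>- p \<chi> [X, T]\<close> (\<open>lower\<close>).  At the first \<open>p\<close> for which
  \<open>X\<^sup>p w\<close> depends on its predecessors this coefficient has to vanish, and \<open>p \<noteq> 0\<close> in the field.\<close>

lemma weight_vanishes_on_commutators:
  assumes X: "linear_op X" "\<And>v. v \<in> V \<Longrightarrow> X v \<in> V" and F: "finite F" "V \<subseteq> span F"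
    and N: "\<And>T. T \<in> N \<Longrightarrow> linear_op T"
    and comm: "\<And>T. T \<in> N \<Longrightarrow> (\<lambda>v. X (T v) - T (X v)) \<in> N"
    and w: "w \<in> V" "w \<noteq> 0" "\<And>T. T \<in> N \<Longrightarrow> T w = scale (\<chi> T) w"
    and T: "T \<in> N"
  shows "\<chi> (\<lambda>v. X (T v) - T (X v)) = 0"
proof -
  define x where "x i = (X ^^ i) w" for i
  have xs: "x 0 = w" "x (Suc i) = X (x i)" for i by (auto simp: x_def)
  define L where "L p = span (x ` {..<p})" for p
  have Lsub: "subspace (L p)" for p by (simp add: L_def)
  have Lmono: "v \<in> L p \<Longrightarrow> p \<le> q \<Longrightarrow> v \<in> L q" for v p q
    unfolding L_def by (meson image_mono lessThan_subset_iff span_mono subsetD)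
  have xL: "i < p \<Longrightarrow> x i \<in> L p" for i p unfolding L_def by (auto intro: span_base)
  have XL: "X v \<in> L (Suc p)" if "v \<in> L p" for v p
  proof -
    obtain c where "v = (\<Sum>i<p. scale (c i) (x i))"
      using in_span_imageE[of "{..<p}" v x] \<open>v \<in> L p\<close> unfolding L_def by blast
    then have "X v = (\<Sum>i<p. scale (c i) (x (Suc i)))"
      by (simp add: linear_op_simps[OF X(1)] xs)
    then show ?thesis using Lsub xL by (auto intro!: subspace_sum subspace_scale)
  qed
  have tri: "\<exists>l\<in>L i. T (x i) = scale (\<chi> T) (x i) + l" if "T \<in> N" for T i
    using that
  proof (induction i arbitrary: T)
    case 0
    then show ?case using w(3) subspace_0[OF Lsub] by (auto simp: xs)
  next
    case (Suc i)
    define C where "C = (\<lambda>v. X (T v) - T (X v))"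
    have "C \<in> N" unfolding C_def using comm Suc by blast
    then obtain l l' where l: "l \<in> L i" "T (x i) = scale (\<chi> T) (x i) + l"
      "l' \<in> L i" "C (x i) = scale (\<chi> C) (x i) + l'"
      using Suc by metis
    have "T (x (Suc i)) = X (T (x i)) - C (x i)" by (simp add: C_def xs)
    also have "\<dots> = scale (\<chi> T) (x (Suc i)) + (X l - (scale (\<chi> C) (x i) + l'))"
      unfolding l by (simp add: linear_op_simps[OF X(1)] xs)
    finally have "T (x (Suc i)) = scale (\<chi> T) (x (Suc i)) + (X l - (scale (\<chi> C) (x i) + l'))" .
    moreover have "X l - (scale (\<chi> C) (x i) + l') \<in> L (Suc i)"
      using XL[OF l(1)] Lmono[OF l(3), of "Suc i"] xL[of i "Suc i"] Lsub[of "Suc i"]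
      by (auto intro: subspace_diff subspace_add subspace_scale)
    ultimately show ?case by blast
  qed
  define C where "C = (\<lambda>v. X (T v) - T (X v))"
  have "C \<in> N" unfolding C_def using comm T by blast
  have lower: "\<exists>l\<in>L i. T (x (Suc i)) = scale (\<chi> T) (x (Suc i)) - scale (of_nat (Suc i) * \<chi> C) (x i) + l" for i
  proof (induction i)
    case 0
    have "T (x (Suc 0)) = X (T w) - C w" by (simp add: C_def xs)
    also have "\<dots> = scale (\<chi> T) (x (Suc 0)) - scale (\<chi> C) w"
      unfolding w(3)[OF T] w(3)[OF \<open>C \<in> N\<close>] by (simp add: linear_op_simps(2)[OF X(1)] xs)
    finally show ?case using subspace_0[OF Lsub] by (auto simp: xs)
  next
    case (Suc i)
    then obtain l where l: "l \<in> L i"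
      "T (x (Suc i)) = scale (\<chi> T) (x (Suc i)) - scale (of_nat (Suc i) * \<chi> C) (x i) + l" by blast
    obtain l' where l': "l' \<in> L (Suc i)" "C (x (Suc i)) = scale (\<chi> C) (x (Suc i)) + l'"
      using tri \<open>C \<in> N\<close> by blast
    have "T (x (Suc (Suc i))) = X (T (x (Suc i))) - C (x (Suc i))"
      by (simp add: C_def xs)
    also have "\<dots> = scale (\<chi> T) (x (Suc (Suc i))) - scale (of_nat (Suc i) * \<chi> C) (x (Suc i)) + X l
        - (scale (\<chi> C) (x (Suc i)) + l')"
      unfolding l'(2) l(2) by (simp only: linear_op_simps[OF X(1)] xs)
    also have "\<dots> = scale (\<chi> T) (x (Suc (Suc i))) - scale (of_nat (Suc (Suc i)) * \<chi> C) (x (Suc i)) + (X l - l')"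
    proof -
      have "of_nat (Suc (Suc i)) * \<chi> C = of_nat (Suc i) * \<chi> C + \<chi> C" by (simp add: distrib_right)
      then show ?thesis by (simp only: scale_left_distrib) (simp del: of_nat_Suc)
    qed
    finally have "T (x (Suc (Suc i))) =
      scale (\<chi> T) (x (Suc (Suc i))) - scale (of_nat (Suc (Suc i)) * \<chi> C) (x (Suc i)) + (X l - l')" .
    moreover have "X l - l' \<in> L (Suc i)" using XL[OF l(1)] l'(1) Lsub subspace_diff by blast
    ultimately show ?case by blast
  qed
  have xV: "x i \<in> V" for i using X(2) w(1) by (induction i) (auto simp: xs)
  have "\<exists>p. x p \<in> L p"
  proof (rule ccontr)
    assume neg: "\<not> (\<exists>p. x p \<in> L p)"
    have "independent (x ` {..<p}) \<and> card (x ` {..<p}) = p" for p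
    proof (induction p)
      case (Suc p)
      have "x ` {..<Suc p} = insert (x p) (x ` {..<p})" by (auto simp: lessThan_Suc)
      moreover have "x p \<notin> span (x ` {..<p})" using neg by (simp add: L_def)
      moreover from this have "x p \<notin> x ` {..<p}" using span_base by metis
      ultimately show ?case using Suc independent_insertI by simp
    qed (simp add: dependent_def)
    then have "independent (x ` {..<Suc (card F)})" "card (x ` {..<Suc (card F)}) = Suc (card F)"
      by blast+
    then show False using independent_span_bound[OF F(1), of "x ` {..<Suc (card F)}"] xV F(2) by auto
  qed
  then have p: "x (LEAST p. x p \<in> L p) \<in> L (LEAST p. x p \<in> L p)" by (rule LeastI_ex)
  have "x 0 \<notin> L 0" using w by (simp add: L_def xs)
  then obtain q where q: "(LEAST p. x p \<in> L p) = Suc q"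
    using p by (metis not0_implies_Suc)
  then have xq: "x (Suc q) \<in> L (Suc q)" "x q \<notin> L q"
    using p not_less_Least[of q "\<lambda>p. x p \<in> L p"] by auto
  have T': "T v - scale (\<chi> T) v \<in> L q" if "v \<in> L (Suc q)" for v
  proof -
    obtain c where c: "v = (\<Sum>i<Suc q. scale (c i) (x i))"
      using in_span_imageE[of "{..<Suc q}" v x] \<open>v \<in> L (Suc q)\<close> unfolding L_def by blast
    have "T (x i) - scale (\<chi> T) (x i) \<in> L q" if "i < Suc q" for i
    proof -
      obtain l where "l \<in> L i" "T (x i) = scale (\<chi> T) (x i) + l" using tri T by blast
      then show ?thesis using Lmono[of l i q] that by simp
    qed
    moreover have "T v - scale (\<chi> T) v = (\<Sum>i<Suc q. scale (c i) (T (x i) - scale (\<chi> T) (x i)))"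
      unfolding c linear_op_simps(5)[OF N[OF T]] scale_sum_right sum_subtractf[symmetric]
      by (intro sum.cong) (auto simp: linear_op_simps(2)[OF N[OF T]] scale_right_diff_distrib mult.commute)
    ultimately show ?thesis
      using subspace_sum[OF Lsub, of "{..<Suc q}" "\<lambda>i. scale (c i) (T (x i) - scale (\<chi> T) (x i))"]
        subspace_scale[OF Lsub] by (simp only:) simp
  qed
  obtain l where l: "l \<in> L q"
    "T (x (Suc q)) = scale (\<chi> T) (x (Suc q)) - scale (of_nat (Suc q) * \<chi> C) (x q) + l"
    using lower by blast
  have "l - (T (x (Suc q)) - scale (\<chi> T) (x (Suc q))) \<in> L q"
    using T'[OF xq(1)] l(1) Lsub subspace_diff by blast
  then have m: "scale (of_nat (Suc q) * \<chi> C) (x q) \<in> L q" unfolding l(2) by simp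
  have "\<chi> C = 0"
  proof (rule ccontr)
    assume "\<chi> C \<noteq> 0"
    then have nz: "of_nat (Suc q) * \<chi> C \<noteq> 0" using of_nat_neq_0 by (metis mult_eq_0_iff)
    have "scale (inverse (of_nat (Suc q) * \<chi> C)) (scale (of_nat (Suc q) * \<chi> C) (x q)) \<in> L q"
      using m Lsub subspace_scale by blast
    then show False using xq(2) by (simp only: scale_scale left_inverse[OF nz] scale_one)
  qed
  then show ?thesis by (simp add: C_def)
qed

text \<open>An irreducible subspace for a commuting family consists of common eigenvectors, by Schur's
  lemma.  Since \<open>\<chi>\<close> vanishes on commutators with \<open>E\<close>, its whole weight space is invariant under \<open>E\<close>.\<close>

lemma commuting_ideal_acts_by_scalars:
  assumes V: "irreducible_under E V" and F: "finite F" "V \<subseteq> span F"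
    and E: "\<And>X. X \<in> E \<Longrightarrow> linear_op X"
    and N: "\<And>T. T \<in> N \<Longrightarrow> linear_op T" "\<And>T v. T \<in> N \<Longrightarrow> v \<in> V \<Longrightarrow> T v \<in> V"
    and ideal: "\<And>X T. X \<in> E \<Longrightarrow> T \<in> N \<Longrightarrow> (\<lambda>v. X (T v) - T (X v)) \<in> N"
    and comm: "\<And>T T' v. T \<in> N \<Longrightarrow> T' \<in> N \<Longrightarrow> v \<in> V \<Longrightarrow> T (T' v) = T' (T v)"
    and T: "T \<in> N"
  shows "\<exists>c. \<forall>v\<in>V. T v = scale c v"
proof -
  note D = irreducible_underD[OF V]
  have "invariant_under N V" using N by (auto simp: invariant_under_def)
  then obtain W where W: "W \<subseteq> V" "irreducible_under N W"
    using exists_irreducible_subspace[OF D(1,2) _ F] by blast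
  note DW = irreducible_underD[OF W(2)]
  have "\<exists>c. \<forall>w\<in>W. T w = scale c w" if "T \<in> N" for T
  proof (rule schur[OF W(2) F(1) _ N(1)])
    show "W \<subseteq> span F" using W F by blast
    show "linear_within W T" using that DW N by (auto intro!: linear_op_within)
    show "T (T' u) = T' (T u)" if "T' \<in> N" "u \<in> W" for T' u
      using that \<open>T \<in> N\<close> comm W by blast
  qed
  then obtain \<chi> where \<chi>: "\<And>T w. T \<in> N \<Longrightarrow> w \<in> W \<Longrightarrow> T w = scale (\<chi> T) w" by metis
  obtain w where w: "w \<in> W" "w \<noteq> 0" using DW by blast
  have "{v \<in> V. \<forall>T\<in>N. T v = scale (\<chi> T) v} = V"
  proof (rule irreducible_eqI[OF V])
    show "subspace {v \<in> V. \<forall>T\<in>N. T v = scale (\<chi> T) v}"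
      using D(1,4) by (intro subspaceI)
        (auto simp: linear_op_simps[OF N(1)] subspace_add subspace_scale scale_right_distrib mult.commute)
    show "X v \<in> {v \<in> V. \<forall>T\<in>N. T v = scale (\<chi> T) v}"
      if X: "X \<in> E" "v \<in> {v \<in> V. \<forall>T\<in>N. T v = scale (\<chi> T) v}" for X v
    proof -
      have "T (X v) = scale (\<chi> T) (X v)" if T: "T \<in> N" for T
      proof -
        let ?C = "\<lambda>v. X (T v) - T (X v)"
        have "\<chi> ?C = 0"
          by (rule weight_vanishes_on_commutators[OF E[OF X(1)] _ F N(1) ideal[OF X(1)], where w = w])
            (use X D(3) w W \<chi> T in auto)
        moreover have "\<And>T. T \<in> N \<Longrightarrow> T v = scale (\<chi> T) v" using X(2) by blast
        from this[OF ideal[OF X(1) T]] have "?C v = scale (\<chi> ?C) v" .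
        ultimately have "T (X v) = X (T v)" by simp
        moreover have "T v = scale (\<chi> T) v" using X(2) T by blast
        ultimately show ?thesis by (simp add: linear_op_simps(2)[OF E[OF X(1)]])
      qed
      then show ?thesis using X D(3) by blast
    qed
    show "w \<in> {v \<in> V. \<forall>T\<in>N. T v = scale (\<chi> T) v}" using w W \<chi> by blast
  qed (use w in auto)
  then show ?thesis using T by blast
qed

end

section \<open>Rational points of the coordinate algebra\<close>

text \<open>The hypotheses on the field are carried by its sort: algebraic closedness gives
  eigenvalues and residue fields, characteristic zero gives averages over \<open>\<Gamma>\<close> and traces of scalars.\<close>

locale char_0_equivariant_map_algebra =
  equivariant_map_algebra gscale gbracket B ascale aunit \<Gamma> aact gact
  for gscale :: "'k::{alg_closed_field, field_char_0} \<Rightarrow> 'g::ab_group_add \<Rightarrow> 'g"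
    and gbracket :: "'g \<Rightarrow> 'g \<Rightarrow> 'g"
    and B :: "'g set"
    and ascale :: "'k \<Rightarrow> 'a::comm_ring \<Rightarrow> 'a"
    and aunit :: 'a
    and \<Gamma> :: "('c, 'd) monoid_scheme" (structure)
    and aact :: "'c \<Rightarrow> 'a \<Rightarrow> 'a"
    and gact :: "'c \<Rightarrow> 'g \<Rightarrow> 'g"
begin

sublocale A: alg_closed_char_0_vector_space ascale by unfold_locales

lemma group_\<Gamma>: "group \<Gamma>"
  using A_act.group_hom group_hom.axioms(1) by blast

sublocale \<Gamma>: group \<Gamma> by (rule group_\<Gamma>)

lemma unit_right: "f * aunit = f"
  by (subst mult.commute) (rule A.unit_left)

lemma mult_scale_right: "f * ascale c h = ascale c (f * h)"
  using A.mult_scale_left by (metis mult.commute)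

lemma aact_simps:
  assumes "s \<in> carrier \<Gamma>"
  shows "aact s (f + h) = aact s f + aact s h" "aact s (ascale c f) = ascale c (aact s f)"
    "aact s 0 = 0" "aact s (- f) = - aact s f" "aact s (f - h) = aact s f - aact s h"
    "aact s (\<Sum>i\<in>X. F i) = (\<Sum>i\<in>X. aact s (F i))"
proof -
  interpret a: Vector_Spaces.linear ascale ascale "aact s" using assms by (rule aact_linear)
  show "aact s (f + h) = aact s f + aact s h" "aact s (ascale c f) = ascale c (aact s f)"
    "aact s 0 = 0" "aact s (- f) = - aact s f" "aact s (f - h) = aact s f - aact s h"
    "aact s (\<Sum>i\<in>X. F i) = (\<Sum>i\<in>X. aact s (F i))"
    by (rule a.add a.scale a.zero a.neg a.diff a.sum)+
qed

lemma aact_one: "aact \<one> f = f"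
  using A_act.id_eq_one by (metis UNIV_I restrict_apply)

lemma aact_comp: "s \<in> carrier \<Gamma> \<Longrightarrow> t \<in> carrier \<Gamma> \<Longrightarrow> aact (s \<otimes> t) f = aact s (aact t f)"
  using A_act.composition_rule by simp

lemma aact_inv: "s \<in> carrier \<Gamma> \<Longrightarrow> aact s (aact (inv s) f) = f" "s \<in> carrier \<Gamma> \<Longrightarrow> aact (inv s) (aact s f) = f"
  by (simp_all add: aact_comp[symmetric] aact_one)

lemma translate_bij: "s \<in> carrier \<Gamma> \<Longrightarrow> bij_betw (\<lambda>t. s \<otimes> t) (carrier \<Gamma>) (carrier \<Gamma>)"
  by (rule bij_betw_byWitness[of _ "\<lambda>t. inv s \<otimes> t"]) (auto simp: \<Gamma>.m_assoc[symmetric])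

definition invariant_functions :: "'a set"
  where "invariant_functions = {f. \<forall>s\<in>carrier \<Gamma>. aact s f = f}"

definition alg_ideal :: "'a set \<Rightarrow> bool"
  where "alg_ideal I \<longleftrightarrow> A.subspace I \<and> (\<forall>f\<in>I. \<forall>h. h * f \<in> I)"

lemma alg_idealD:
  assumes "alg_ideal I"
  shows "0 \<in> I" "f \<in> I \<Longrightarrow> h \<in> I \<Longrightarrow> f + h \<in> I" "f \<in> I \<Longrightarrow> h \<in> I \<Longrightarrow> f - h \<in> I" "f \<in> I \<Longrightarrow> h * f \<in> I"
    "f \<in> I \<Longrightarrow> f * h \<in> I" "f \<in> I \<Longrightarrow> ascale c f \<in> I" "f \<in> I \<Longrightarrow> - f \<in> I"
    "(\<And>i. i \<in> X \<Longrightarrow> F i \<in> I) \<Longrightarrow> (\<Sum>i\<in>X. F i) \<in> I" "A.subspace I"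
  using assms
  by (auto simp: alg_ideal_def A.subspace_0 A.subspace_add A.subspace_diff A.subspace_scale
      A.subspace_neg mult.commute intro: A.subspace_sum)

text \<open>The type of the coordinate algebra has no unit of its own, so powers start at \<open>aunit\<close>.\<close>

definition pow :: "'a \<Rightarrow> nat \<Rightarrow> 'a" where "pow f i = ((*) f ^^ i) aunit"

lemma poly_eq_sum_pow:
  "(\<And>i. i > N \<Longrightarrow> coeff p i = 0) \<Longrightarrow> poly p h = (\<Sum>i\<le>N. coeff p i * pow h i)"
proof (induction p arbitrary: N)
  case 0
  then show ?case by simp
next
  case (pCons a p)
  show ?case
  proof (cases N)
    case 0
    then have "coeff p i = 0" for i using pCons(3)[of "Suc i"] by simp
    then have "p = 0" by (simp add: poly_eqI)
    then show ?thesis using 0 by (simp add: pow_def unit_right)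
  next
    case (Suc M)
    have "poly p h = (\<Sum>i\<le>M. coeff p i * pow h i)"
    proof (rule pCons(2))
      fix i assume "M < i"
      then show "coeff p i = 0" using pCons(3)[of "Suc i"] Suc by simp
    qed
    then have "poly (pCons a p) h = a + (\<Sum>i\<le>M. coeff p i * pow h (Suc i))"
      by (simp add: sum_distrib_left pow_def mult.left_commute)
    also have "\<dots> = (\<Sum>i\<le>Suc M. coeff (pCons a p) i * pow h i)"
      by (subst sum.atMost_Suc_shift) (simp add: pow_def unit_right)
    finally show ?thesis using Suc by simp
  qed
qed

lemma poly_unit: "[:aunit:] * p = (p :: 'a poly)"
  by (rule poly_eqI) (simp add: A.unit_left)

interpretation poly_prod: comm_monoid_set "(*) :: 'a poly \<Rightarrow> _" "[:aunit:]"
  by unfold_locales (subst mult.commute, rule poly_unit)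

text \<open>The polynomial \<open>\<Prod>\<^sub>s (X - s h)\<close>: it is monic, has the root \<open>h\<close> and has invariant coefficients, so it
  shows that \<open>h\<close> is integral over the invariants.\<close>

definition orbit_poly :: "'a \<Rightarrow> 'a poly"
  where "orbit_poly h = poly_prod.F (\<lambda>s. [:- aact s h, aunit:]) (carrier \<Gamma>)"

lemma orbit_poly_root: "poly (orbit_poly h) h = 0"
  unfolding orbit_poly_def
  by (subst poly_prod.remove[OF finite_group, of \<one>]) (simp_all add: aact_one A.unit_left)

lemma orbit_poly_coeff:
  "coeff (orbit_poly h) (card (carrier \<Gamma>)) = aunit"
  "i > card (carrier \<Gamma>) \<Longrightarrow> coeff (orbit_poly h) i = 0"
proof -
  have "coeff (poly_prod.F (\<lambda>s. [:- aact s h, aunit:]) S) (card S) = aunit \<and>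
     (\<forall>i>card S. coeff (poly_prod.F (\<lambda>s. [:- aact s h, aunit:]) S) i = 0)" if "finite S" for S
    using that
  proof (induction S rule: finite_induct)
    case (insert x S)
    then show ?case
      by (auto simp: coeff_pCons A.unit_left split: nat.split)
  qed (auto simp: coeff_pCons split: nat.split)
  from this[OF finite_group]
  show "coeff (orbit_poly h) (card (carrier \<Gamma>)) = aunit"
    "i > card (carrier \<Gamma>) \<Longrightarrow> coeff (orbit_poly h) i = 0"
    by (auto simp: orbit_poly_def)
qed

text \<open>Applying \<open>t\<close> to the coefficients permutes the factors of the product.\<close>

lemma orbit_poly_invariant: "coeff (orbit_poly h) i \<in> invariant_functions"
proof -
  have "aact t (coeff (orbit_poly h) i) = coeff (orbit_poly h) i" if t: "t \<in> carrier \<Gamma>" for t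
  proof -
    note at = aact_simps[OF t]
    have mult: "map_poly (aact t) (p * q) = map_poly (aact t) p * map_poly (aact t) q" for p q
      by (rule poly_eqI) (simp add: coeff_map_poly at coeff_mult aact_mult[OF t])
    have lin: "map_poly (aact t) [:f, h:] = [:aact t f, aact t h:]" for f h
      by (rule poly_eqI) (simp add: coeff_map_poly at coeff_pCons split: nat.split)
    have one: "map_poly (aact t) [:f:] = [:aact t f:]" for f
      by (rule poly_eqI) (simp add: coeff_map_poly at coeff_pCons split: nat.split)
    have "map_poly (aact t) (poly_prod.F g S) = poly_prod.F (\<lambda>s. map_poly (aact t) (g s)) S" for g and S :: "'c set"
      by (induction S rule: infinite_finite_induct)
        (simp_all del: mult_pCons_left mult_pCons_right add: one mult aact_unit[OF t])
    then have "map_poly (aact t) (orbit_poly h) =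
        poly_prod.F (\<lambda>s. [:- aact (t \<otimes> s) h, aunit:]) (carrier \<Gamma>)"
      unfolding orbit_poly_def using t
      by (auto simp: lin at aact_unit aact_comp intro!: poly_prod.cong)
    also have "\<dots> = orbit_poly h"
      unfolding orbit_poly_def
      by (rule poly_prod.reindex_bij_betw[OF translate_bij[OF t], of "\<lambda>s. [:- aact s h, aunit:]"])
    finally have "coeff (map_poly (aact t) (orbit_poly h)) i = coeff (orbit_poly h) i" by simp
    then show ?thesis by (simp add: coeff_map_poly at)
  qed
  then show ?thesis by (auto simp: invariant_functions_def)
qed

text \<open>An ideal that is maximal among those that contain \<open>I\<close> and avoid the iterated squares
  \<open>f, f\<^sup>2, f\<^sup>4, \<dots>\<close> is prime.  Iterated squares serve as well as all powers: any two of them divide a later one, and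
  the product of that one with itself is the next.  None of them lies in \<open>I\<close>, because \<open>I\<close> is radical.\<close>

lemma prime_ideal_avoiding:
  assumes I: "alg_ideal I" and rad: "\<And>f. f * f \<in> I \<Longrightarrow> f \<in> I" and f: "f \<notin> I"
  obtains P where "alg_ideal P" "I \<subseteq> P" "f \<notin> P" "\<And>a b. a * b \<in> P \<Longrightarrow> a \<in> P \<or> b \<in> P"
proof -
  define sq where "sq i = ((\<lambda>g. g * g) ^^ i) f" for i
  have sqS: "sq 0 = f" "sq (Suc i) = sq i * sq i" for i by (auto simp: sq_def)
  define \<A> where "\<A> = {m. alg_ideal m \<and> I \<subseteq> m \<and> (\<forall>i. sq i \<notin> m)}"
  have "sq i \<notin> I" for i
  proof (induction i)
    case (Suc i)
    then show ?case using rad[of "sq i"] by (metis sqS(2))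
  qed (simp add: f sqS(1))
  then have "I \<in> \<A>" using I by (auto simp: \<A>_def)
  then have "\<A> \<noteq> {}" by blast
  moreover have "\<Union>\<C> \<in> \<A>" if C: "\<C> \<noteq> {}" "subset.chain \<A> \<C>" for \<C>
  proof -
    have CA: "\<C> \<subseteq> \<A>" and ch: "\<And>X Y. X \<in> \<C> \<Longrightarrow> Y \<in> \<C> \<Longrightarrow> X \<subseteq> Y \<or> Y \<subseteq> X"
      using C by (auto simp: subset.chain_def)
    have id: "alg_ideal X" if "X \<in> \<C>" for X using that CA by (auto simp: \<A>_def)
    have "alg_ideal (\<Union>\<C>)"
      unfolding alg_ideal_def
    proof (intro conjI A.subspaceI ballI allI)
      show "0 \<in> \<Union>\<C>" using C(1) id alg_idealD(1) by blast
      show "g + h \<in> \<Union>\<C>" if "g \<in> \<Union>\<C>" "h \<in> \<Union>\<C>" for g h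
      proof -
        from that obtain X Y where "X \<in> \<C>" "g \<in> X" "Y \<in> \<C>" "h \<in> Y" by blast
        then show ?thesis using ch[of X Y] id alg_idealD(2) by blast
      qed
      show "ascale c g \<in> \<Union>\<C>" if "g \<in> \<Union>\<C>" for c g using that id alg_idealD(6) by blast
      show "h * g \<in> \<Union>\<C>" if "g \<in> \<Union>\<C>" for h g using that id alg_idealD(4) by blast
    qed
    moreover have "I \<subseteq> \<Union>\<C>" "\<forall>i. sq i \<notin> \<Union>\<C>" using CA C(1) by (auto simp: \<A>_def)
    ultimately show ?thesis by (auto simp: \<A>_def)
  qed
  ultimately obtain P where P: "P \<in> \<A>" "\<And>X. X \<in> \<A> \<Longrightarrow> P \<subseteq> X \<Longrightarrow> X = P"
    using subset_Zorn_nonempty[of \<A>] by blast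
  have idP: "alg_ideal P" "I \<subseteq> P" "\<And>i. sq i \<notin> P" using P by (auto simp: \<A>_def)
  note DP = alg_idealD[OF idP(1)]
  \<comment> \<open>By maximality, the ideal generated by \<open>P\<close> and any \<open>a \<notin> P\<close> contains an iterated square.\<close>
  have meet: "\<exists>i. \<exists>x\<in>P. \<exists>h. sq i = x + h * a" if "a \<notin> P" for a
  proof (rule ccontr)
    assume neg: "\<not> ?thesis"
    let ?X = "{x + h * a | x h. x \<in> P}"
    have sub: "P \<subseteq> ?X"
    proof
      fix x assume "x \<in> P"
      then have "x = x + 0 * a" by simp
      with \<open>x \<in> P\<close> show "x \<in> ?X" by blast
    qed
    have "alg_ideal ?X"
      unfolding alg_ideal_def
    proof (intro conjI A.subspaceI ballI allI)
      show "0 \<in> ?X" using sub DP(1) by blast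
      show "g + g' \<in> ?X" if "g \<in> ?X" "g' \<in> ?X" for g g'
      proof -
        from that obtain x h x' h' where "x \<in> P" "x' \<in> P" "g = x + h * a" "g' = x' + h' * a" by blast
        then have "g + g' = (x + x') + (h + h') * a" "x + x' \<in> P"
          using DP(2) by (auto simp: algebra_simps)
        then show ?thesis by blast
      qed
      show "ascale c g \<in> ?X" if "g \<in> ?X" for c g
      proof -
        from that obtain x h where "x \<in> P" "g = x + h * a" by blast
        then have "ascale c g = ascale c x + ascale c h * a" "ascale c x \<in> P"
          using DP(6) by (auto simp: A.scale_right_distrib A.mult_scale_left)
        then show ?thesis by blast
      qed
      show "h' * g \<in> ?X" if "g \<in> ?X" for h' g
      proof -
        from that obtain x h where "x \<in> P" "g = x + h * a" by blast
        then have "h' * g = h' * x + (h' * h) * a" by (simp add: algebra_simps)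
        moreover have "h' * x \<in> P" using \<open>x \<in> P\<close> by (rule DP(4))
        ultimately show ?thesis by blast
      qed
    qed
    then have "?X \<in> \<A>" using neg sub idP(2) by (auto simp: \<A>_def)
    then have "?X = P" using P(2) sub by blast
    moreover have "a = 0 + aunit * a" by (simp add: A.unit_left)
    then have "a \<in> ?X" using DP(1) by blast
    ultimately show False using \<open>a \<notin> P\<close> by blast
  qed
  have prime: "a \<in> P \<or> b \<in> P" if ab: "a * b \<in> P" for a b
  proof (rule ccontr)
    assume neg: "\<not> (a \<in> P \<or> b \<in> P)"
    obtain i x h where 1: "x \<in> P" "sq i = x + h * a" using meet neg by blast
    obtain j y h' where 2: "y \<in> P" "sq j = y + h' * b" using meet neg by blast
    have mul: "\<exists>g. sq (i + d) = g * sq i" for i d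
    proof (induction d)
      case 0
      show ?case using A.unit_left by (metis add_0_right)
    next
      case (Suc d)
      then obtain g where "sq (i + d) = g * sq i" by blast
      then have "sq (i + Suc d) = (sq (i + d) * g) * sq i" by (simp add: sqS mult.assoc)
      then show ?case by blast
    qed
    obtain g g' where g: "sq (i + j) = g * sq i" "sq (i + j) = g' * sq j"
      using mul[of i j] mul[of j i] by (auto simp: add.commute)
    have "sq (Suc (i + j)) = (g * sq i) * (g' * sq j)" using g by (simp add: sqS)
    also have "\<dots> = (g * g' * (y + h' * b)) * x + (g * g' * h * a) * y + (g * g' * h * h') * (a * b)"
      unfolding 1(2) 2(2) by (simp add: algebra_simps)
    also have "\<dots> \<in> P" by (intro DP(2) DP(4) 1(1) 2(1) ab)
    finally show False using idP(3) by blast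
  qed
  show ?thesis using that idP prime sqS(1) by metis
qed

text \<open>The Nullstellensatz for radical ideals modulo which the invariants are algebraic over \<open>k\<close>.  Take a
  prime ideal \<open>P \<supseteq> I\<close> with \<open>f \<notin> P\<close>.  An algebraic relation of \<open>r\<close> modulo \<open>P\<close> splits into linear factors, so
  \<open>r\<close> is congruent to a constant.  This applies first to invariant \<open>r\<close> and then, as the
  coefficients of \<open>orbit_poly\<close> are congruent to constants, to every function.  So \<open>P\<close> is the kernel of a rational
  point.\<close>

lemma rational_point_avoiding:
  assumes I: "alg_ideal I" and rad: "\<And>f. f * f \<in> I \<Longrightarrow> f \<in> I"
    and alg: "\<And>r. r \<in> invariant_functions \<Longrightarrow> \<exists>p. p \<noteq> 0 \<and> (\<Sum>i\<le>degree p. ascale (coeff p i) (pow r i)) \<in> I"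
    and f: "f \<notin> I"
  obtains x where "x \<in> rat_points" "\<And>h. h \<in> I \<Longrightarrow> x h = 0" "x f \<noteq> 0"
proof -
  obtain P where P: "alg_ideal P" "I \<subseteq> P" "f \<notin> P" "\<And>a b. a * b \<in> P \<Longrightarrow> a \<in> P \<or> b \<in> P"
    using prime_ideal_avoiding[OF I rad f] by metis
  note DP = alg_idealD[OF P(1)]
  have unit: "aunit \<notin> P" using P(3) DP(4)[of aunit f] unit_right by auto
  have residue: "\<exists>c. h - ascale c aunit \<in> P"
    if "p \<noteq> 0" "(\<Sum>i\<le>degree p. ascale (coeff p i) (pow h i)) \<in> P" for h p
  proof -
    have "A.linear_within UNIV ((*) h)"
      by (auto simp: A.linear_within_def distrib_left mult_scale_right)
    then have "\<exists>c. \<exists>v\<in>UNIV. v \<notin> P \<and> h * v - ascale c v \<in> P"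
      using unit DP(9) that unfolding pow_def by (intro A.eigenvector_modulo[of UNIV "(*) h" aunit P p]) auto
    then obtain c v where "v \<notin> P" "h * v - ascale c v \<in> P" by blast
    moreover have "h * v - ascale c v = (h - ascale c aunit) * v"
      by (simp add: left_diff_distrib A.mult_scale_left A.unit_left)
    ultimately show ?thesis using P(4) by metis
  qed
  have "\<exists>c. r - ascale c aunit \<in> P" if "r \<in> invariant_functions" for r
    using alg[OF that] residue P(2) by blast
  then obtain y where y: "\<And>r. r \<in> invariant_functions \<Longrightarrow> r - ascale (y r) aunit \<in> P" by metis
  have "\<exists>c. h - ascale c aunit \<in> P" for h
  proof -
    define n where "n = card (carrier \<Gamma>)"
    define p where "p = orbit_poly h"
    \<comment> \<open>Replace the coefficients of \<open>orbit_poly h\<close> by their residues; the value at \<open>h\<close> changes by an element of \<open>P\<close>.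
      The leading coefficient \<open>aunit\<close> has residue different from zero.\<close>
    define q where "q = (\<Sum>i\<le>n. monom (y (coeff p i)) i)"
    have cq: "coeff q i = (if i \<le> n then y (coeff p i) else 0)" for i
      by (simp add: q_def coeff_sum if_distrib cong: if_cong)
    have "y aunit \<noteq> 0"
      using y[of aunit] unit aact_unit by (auto simp: invariant_functions_def)
    then have "coeff q n \<noteq> 0"
      using orbit_poly_coeff(1) by (simp add: cq p_def n_def)
    then have q0: "q \<noteq> 0" by auto
    have dq: "degree q \<le> n" by (rule degree_le) (simp add: cq)
    have "0 = (\<Sum>i\<le>n. coeff p i * pow h i)"
      using poly_eq_sum_pow[of n p h] orbit_poly_coeff(2) orbit_poly_root by (simp add: p_def n_def)
    then have "(\<Sum>i\<le>n. ascale (coeff q i) (pow h i)) =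
        - (\<Sum>i\<le>n. (coeff p i - ascale (y (coeff p i)) aunit) * pow h i)"
      by (simp add: left_diff_distrib sum_subtractf A.mult_scale_left A.unit_left cq)
    also have "\<dots> \<in> P"
      unfolding p_def by (intro DP(7) DP(8) DP(5) y orbit_poly_invariant)
    also have "(\<Sum>i\<le>n. ascale (coeff q i) (pow h i)) = (\<Sum>i\<le>degree q. ascale (coeff q i) (pow h i))"
      by (rule sum.mono_neutral_right) (use dq coeff_eq_0[of q] in auto)
    finally show ?thesis by (rule residue[OF q0])
  qed
  then obtain x where x: "\<And>h. h - ascale (x h) aunit \<in> P" by metis
  have uniq: "x h = c" if "h - ascale c aunit \<in> P" for h c
  proof (rule ccontr)
    assume ne: "x h \<noteq> c"
    have "(h - ascale c aunit) - (h - ascale (x h) aunit) \<in> P" using DP(3) that x by blast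
    then have "ascale (x h - c) aunit \<in> P" by (simp add: A.scale_left_diff_distrib)
    then have "ascale (inverse (x h - c)) (ascale (x h - c) aunit) \<in> P" by (rule DP(6))
    then show False using ne unit by simp
  qed
  have "x \<in> rat_points"
    unfolding rat_points_def
  proof (intro CollectI conjI allI)
    have "vector_space ascale" "vector_space ((*) :: 'k \<Rightarrow> 'k \<Rightarrow> 'k)"
      by unfold_locales (auto simp: algebra_simps)
    moreover have "x (g + h) = x g + x h" for g h
    proof (rule uniq)
      show "g + h - ascale (x g + x h) aunit \<in> P"
        using DP(2)[OF x[of g] x[of h]] by (simp add: A.scale_left_distrib algebra_simps)
    qed
    moreover have "x (ascale c h) = c * x h" for c h
    proof (rule uniq)
      show "ascale c h - ascale (c * x h) aunit \<in> P"
        using DP(6)[OF x[of h], of c] by (simp add: A.scale_right_diff_distrib)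
    qed
    ultimately show "Vector_Spaces.linear ascale (*) x" by (simp add: Vector_Spaces.linear_iff)
    show "x (g * h) = x g * x h" for g h
    proof (rule uniq)
      have "g * h - ascale (x g * x h) aunit =
        g * (h - ascale (x h) aunit) + ascale (x h) (g - ascale (x g) aunit)"
        by (simp add: right_diff_distrib A.scale_right_diff_distrib mult_scale_right unit_right mult.commute[of "x g"])
      also have "\<dots> \<in> P" by (rule DP(2)[OF DP(4)[OF x] DP(6)[OF x]])
      finally show "g * h - ascale (x g * x h) aunit \<in> P" .
    qed
    show "x aunit = 1" by (rule uniq) (simp add: DP(1))
  qed
  moreover have "x h = 0" if "h \<in> I" for h by (rule uniq) (use that P(2) in auto)
  moreover have "x f \<noteq> 0" using x[of f] P(3) by auto
  ultimately show ?thesis using that by blast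
qed

end

section \<open>Operations on equivariant maps\<close>

context char_0_equivariant_map_algebra
begin

abbreviation (input) \<MM> :: "('g \<Rightarrow> 'a) set" where "\<MM> \<equiv> equivariant_maps"

sublocale maps: vector_space map_scale
  by unfold_locales (auto simp: map_scale_def A.scale_right_distrib A.scale_left_distrib)

lemma gbracket_simps:
  "gbracket (u + u') v = gbracket u v + gbracket u' v" "gbracket u (v + v') = gbracket u v + gbracket u v'"
  "gbracket (gscale c u) v = gscale c (gbracket u v)" "gbracket u (gscale c v) = gscale c (gbracket u v)"
  "gbracket (\<Sum>i\<in>X. p i) v = (\<Sum>i\<in>X. gbracket (p i) v)"
  "gbracket u (\<Sum>i\<in>X. p i) = (\<Sum>i\<in>X. gbracket u (p i))"
proof -
  interpret l: Vector_Spaces.linear gscale gscale "\<lambda>u. gbracket u v" for v by (rule linear_left)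
  interpret r: Vector_Spaces.linear gscale gscale "gbracket u" for u by (rule linear_right)
  show "gbracket (u + u') v = gbracket u v + gbracket u' v" "gbracket u (v + v') = gbracket u v + gbracket u v'"
    "gbracket (gscale c u) v = gscale c (gbracket u v)" "gbracket u (gscale c v) = gscale c (gbracket u v)"
    "gbracket (\<Sum>i\<in>X. p i) v = (\<Sum>i\<in>X. gbracket (p i) v)"
    "gbracket u (\<Sum>i\<in>X. p i) = (\<Sum>i\<in>X. gbracket u (p i))"
    by (rule l.add r.add l.scale r.scale l.sum r.sum)+
qed

lemma gact_simps:
  assumes "s \<in> carrier \<Gamma>"
  shows "gact s (u + v) = gact s u + gact s v" "gact s (gscale c u) = gscale c (gact s u)"
    "gact s (\<Sum>i\<in>X. p i) = (\<Sum>i\<in>X. gact s (p i))" "gact s 0 = 0"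
  using Vector_Spaces.linear.axioms(3)[OF gact_linear[OF assms]]
  by (simp_all add: module_hom.add module_hom.scale module_hom.sum module_hom.zero)

lemma gact_one: "gact \<one> u = u"
  using g_act.id_eq_one by (metis UNIV_I restrict_apply)

lemma gact_comp: "s \<in> carrier \<Gamma> \<Longrightarrow> t \<in> carrier \<Gamma> \<Longrightarrow> gact (s \<otimes> t) u = gact s (gact t u)"
  using g_act.composition_rule by simp

lemma maps_subspace: "maps.subspace maps"
  by (auto simp: maps.subspace_def maps_def map_scale_def)

lemma map_bracket_add:
  "map_bracket (\<alpha> + \<alpha>') \<beta> = map_bracket \<alpha> \<beta> + map_bracket \<alpha>' \<beta>"
  "map_bracket \<alpha> (\<beta> + \<beta>') = map_bracket \<alpha> \<beta> + map_bracket \<alpha> \<beta>'"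
  by (simp_all add: map_bracket_def distrib_right distrib_left tensor_add_right sum.distrib)

lemma map_scale_sum: "map_scale c (\<Sum>i\<in>X. f i) = (\<Sum>i\<in>X. map_scale c (f i))"
  by (rule maps.scale_sum_right)

lemma map_bracket_sum:
  "map_bracket (\<Sum>i\<in>X. f i) \<beta> = (\<Sum>i\<in>X. map_bracket (f i) \<beta>)"
  "map_bracket \<alpha> (\<Sum>i\<in>X. f i) = (\<Sum>i\<in>X. map_bracket \<alpha> (f i))"
proof -
  have "map_bracket 0 \<beta> = 0" "map_bracket \<alpha> 0 = 0"
    using map_bracket_add(1)[of 0 0 \<beta>] map_bracket_add(2)[of \<alpha> 0 0] by simp_all
  then show "map_bracket (\<Sum>i\<in>X. f i) \<beta> = (\<Sum>i\<in>X. map_bracket (f i) \<beta>)"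
    "map_bracket \<alpha> (\<Sum>i\<in>X. f i) = (\<Sum>i\<in>X. map_bracket \<alpha> (f i))"
    by (induction X rule: infinite_finite_induct) (auto simp: map_bracket_add)
qed

lemma map_bracket_in_maps: "map_bracket \<alpha> \<beta> \<in> maps"
  unfolding map_bracket_def
  by (intro maps.subspace_sum maps_subspace tensor_in_maps)

lemma map_act_add: "s \<in> carrier \<Gamma> \<Longrightarrow> map_act s (\<alpha> + \<beta>) = map_act s \<alpha> + map_act s \<beta>"
  by (simp add: map_act_def aact_simps tensor_add_right sum.distrib)

lemma map_act_scale: "s \<in> carrier \<Gamma> \<Longrightarrow> map_act s (map_scale c \<alpha>) = map_scale c (map_act s \<alpha>)"
  by (simp add: map_act_def map_scale_sum map_scale_def[of _ \<alpha>] aact_simps tensor_scale_right)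

lemma map_act_sum: "s \<in> carrier \<Gamma> \<Longrightarrow> map_act s (\<Sum>i\<in>X. f i) = (\<Sum>i\<in>X. map_act s (f i))"
proof -
  assume s: "s \<in> carrier \<Gamma>"
  then have "map_act s 0 = 0" using map_act_add[of s 0 0] by simp
  then show ?thesis by (induction X rule: infinite_finite_induct) (auto simp: map_act_add s)
qed

lemma map_act_in_maps: "map_act s \<alpha> \<in> maps"
  unfolding map_act_def by (intro maps.subspace_sum maps_subspace tensor_in_maps)

lemma map_act_comp:
  assumes "s \<in> carrier \<Gamma>" "t \<in> carrier \<Gamma>"
  shows "map_act (s \<otimes> t) \<alpha> = map_act s (map_act t \<alpha>)"
  using assms
  by (simp add: map_act_def[of t] map_act_sum map_act_tensor)
    (simp add: map_act_def aact_comp gact_comp)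

lemma map_act_bracket:
  assumes s: "s \<in> carrier \<Gamma>"
  shows "map_act s (map_bracket \<alpha> \<beta>) = map_bracket (map_act s \<alpha>) (map_act s \<beta>)"
  unfolding map_act_def[of s \<alpha>] map_act_def[of s \<beta>]
  by (simp add: map_bracket_def[of \<alpha> \<beta>] map_act_sum[OF s] map_act_tensor[OF s] gact_bracket[OF s] aact_mult[OF s]
      map_bracket_sum map_bracket_tensor) (rule sum.swap)

lemma equivariant_maps_subspace: "maps.subspace \<MM>"
proof (rule maps.subspaceI)
  have "map_act s 0 = 0" if "s \<in> carrier \<Gamma>" for s using map_act_add[OF that, of 0 0] by simp
  then show "0 \<in> \<MM>"
    using maps.subspace_0[OF maps_subspace] by (auto simp: equivariant_maps_def)
qed (auto simp: equivariant_maps_def map_act_add map_act_scale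
    intro: maps.subspace_add[OF maps_subspace] maps.subspace_scale[OF maps_subspace])

lemma equivariant_in_maps: "\<alpha> \<in> \<MM> \<Longrightarrow> \<alpha> \<in> maps"
  by (simp add: equivariant_maps_def)

lemma equivariant_bracket:
  "\<alpha> \<in> \<MM> \<Longrightarrow> \<beta> \<in> \<MM> \<Longrightarrow> map_bracket \<alpha> \<beta> \<in> \<MM>"
  by (auto simp: equivariant_maps_def map_bracket_in_maps map_act_bracket)

text \<open>The sum over \<open>\<Gamma>\<close>, that is, the average up to the factor \<open>|\<Gamma>|\<close>, which is invertible in \<open>k\<close>.\<close>

definition symm :: "('g \<Rightarrow> 'a) \<Rightarrow> 'g \<Rightarrow> 'a"
  where "symm \<alpha> = (\<Sum>s\<in>carrier \<Gamma>. map_act s \<alpha>)"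

lemma symm_add: "symm (\<alpha> + \<beta>) = symm \<alpha> + symm \<beta>"
  by (simp add: symm_def map_act_add sum.distrib)

lemma symm_scale: "symm (map_scale c \<alpha>) = map_scale c (symm \<alpha>)"
  by (simp add: symm_def map_act_scale map_scale_sum)

lemma symm_sum: "symm (\<Sum>i\<in>X. f i) = (\<Sum>i\<in>X. symm (f i))"
  unfolding symm_def by (subst sum.swap) (simp add: map_act_sum)

lemma symm_equivariant: "symm \<alpha> \<in> \<MM>"
proof -
  have "symm \<alpha> \<in> maps"
    unfolding symm_def by (intro maps.subspace_sum maps_subspace map_act_in_maps)
  moreover have "map_act s (symm \<alpha>) = symm \<alpha>" if s: "s \<in> carrier \<Gamma>" for s
  proof -
    have "map_act s (symm \<alpha>) = (\<Sum>t\<in>carrier \<Gamma>. map_act (s \<otimes> t) \<alpha>)"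
      unfolding symm_def map_act_sum[OF s] using s by (intro sum.cong) (auto simp: map_act_comp)
    also have "\<dots> = symm \<alpha>"
      unfolding symm_def by (rule sum.reindex_bij_betw[OF translate_bij[OF s], of "\<lambda>t. map_act t \<alpha>"])
    finally show ?thesis .
  qed
  ultimately show ?thesis by (auto simp: equivariant_maps_def)
qed

lemma symm_of_equivariant:
  "\<alpha> \<in> \<MM> \<Longrightarrow> symm \<alpha> = map_scale (of_nat (card (carrier \<Gamma>))) \<alpha>"
  by (simp add: symm_def equivariant_maps_def maps.sum_constant_scale)

lemma card_\<Gamma>_nonzero: "of_nat (card (carrier \<Gamma>)) \<noteq> (0 :: 'k)"
  using finite_group \<Gamma>.one_closed by (auto simp: card_eq_0_iff)

lemma symm_bracket:
  assumes "\<beta> \<in> \<MM>"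
  shows "symm (map_bracket \<beta> \<gamma>) = map_bracket \<beta> (symm \<gamma>)"
  using assms
  by (simp add: symm_def map_bracket_sum map_act_bracket equivariant_maps_def)

lemma symm_act:
  assumes t: "t \<in> carrier \<Gamma>"
  shows "symm (map_act t \<alpha>) = symm \<alpha>"
proof -
  have b: "bij_betw (\<lambda>s. s \<otimes> t) (carrier \<Gamma>) (carrier \<Gamma>)"
    by (rule bij_betw_byWitness[of _ "\<lambda>s. s \<otimes> inv t"]) (use t in \<open>auto simp: \<Gamma>.m_assoc\<close>)
  have "symm (map_act t \<alpha>) = (\<Sum>s\<in>carrier \<Gamma>. map_act (s \<otimes> t) \<alpha>)"
    unfolding symm_def by (intro sum.cong) (auto simp: map_act_comp t)
  also have "\<dots> = symm \<alpha>"
    unfolding symm_def by (rule sum.reindex_bij_betw[OF b, of "\<lambda>s. map_act s \<alpha>"])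
  finally show ?thesis .
qed

definition amul :: "'a \<Rightarrow> ('g \<Rightarrow> 'a) \<Rightarrow> 'g \<Rightarrow> 'a"
  where "amul f \<alpha> = (\<lambda>b. f * \<alpha> b)"

lemma amul_tensor: "amul f (tensor u h) = tensor u (f * h)"
  by (simp add: amul_def tensor_def mult_scale_right)

lemma amul_add:
  "amul f (\<alpha> + \<beta>) = amul f \<alpha> + amul f \<beta>"
  by (auto simp: amul_def distrib_left)

lemma amul_diff: "amul f (\<alpha> - \<beta>) = amul f \<alpha> - amul f \<beta>"
  by (auto simp: amul_def right_diff_distrib)

lemma amul_scale:
  "amul f (map_scale c \<alpha>) = map_scale c (amul f \<alpha>)"
  by (auto simp: amul_def map_scale_def mult_scale_right)

lemma amul_sum: "amul f (\<Sum>i\<in>X. p i) = (\<Sum>i\<in>X. amul f (p i))"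
  by (auto simp: amul_def sum_fun_apply sum_distrib_left)

lemma amul_mult: "amul f (amul h \<alpha>) = amul (f * h) \<alpha>"
  by (simp add: amul_def mult.assoc)

lemma amul_bracket:
  "map_bracket (amul f \<alpha>) \<beta> = amul f (map_bracket \<alpha> \<beta>)"
  "map_bracket \<alpha> (amul f \<beta>) = amul f (map_bracket \<alpha> \<beta>)"
  by (simp_all add: map_bracket_def amul_sum amul_tensor) (simp_all add: amul_def ac_simps)

lemma amul_in_maps: "\<alpha> \<in> maps \<Longrightarrow> amul f \<alpha> \<in> maps"
  by (auto simp: amul_def maps_def)

lemma map_act_amul:
  assumes "s \<in> carrier \<Gamma>"
  shows "map_act s (amul f \<alpha>) = amul (aact s f) (map_act s \<alpha>)"
  by (simp add: map_act_def amul_sum amul_tensor) (simp add: amul_def aact_mult[OF assms])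

lemma amul_equivariant:
  "r \<in> invariant_functions \<Longrightarrow> \<alpha> \<in> \<MM> \<Longrightarrow> amul r \<alpha> \<in> \<MM>"
  by (auto simp: equivariant_maps_def invariant_functions_def amul_in_maps map_act_amul)

lemma symm_amul: "r \<in> invariant_functions \<Longrightarrow> symm (amul r \<alpha>) = amul r (symm \<alpha>)"
  by (simp add: symm_def amul_sum map_act_amul invariant_functions_def)

lemma rat_point_simps:
  assumes "x \<in> rat_points"
  shows "x (f + h) = x f + x h" "x (ascale c f) = c * x f" "x (f * h) = x f * x h" "x aunit = 1"
    "x 0 = 0" "x (\<Sum>i\<in>X. p i) = (\<Sum>i\<in>X. x (p i))" "x (f - h) = x f - x h"
proof -
  interpret x: Vector_Spaces.linear ascale "(*)" x
    using assms by (simp add: rat_points_def)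
  show "x (f + h) = x f + x h" "x (ascale c f) = c * x f" "x (f * h) = x f * x h" "x aunit = 1"
    "x 0 = 0" "x (\<Sum>i\<in>X. p i) = (\<Sum>i\<in>X. x (p i))" "x (f - h) = x f - x h"
    using assms by (auto simp: x.add x.scale x.zero x.sum x.diff rat_points_def)
qed

lemma eval_at_add: "x \<in> rat_points \<Longrightarrow> eval_at x (\<alpha> + \<beta>) = eval_at x \<alpha> + eval_at x \<beta>"
  by (simp add: eval_at_def rat_point_simps scale_left_distrib sum.distrib)

lemma eval_at_scale: "x \<in> rat_points \<Longrightarrow> eval_at x (map_scale c \<alpha>) = gscale c (eval_at x \<alpha>)"
  by (simp add: eval_at_def rat_point_simps map_scale_def scale_sum_right)

lemma eval_at_zero: "x \<in> rat_points \<Longrightarrow> eval_at x 0 = 0"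
  by (simp add: eval_at_def rat_point_simps)

lemma eval_at_sum: "x \<in> rat_points \<Longrightarrow> eval_at x (\<Sum>i\<in>X. p i) = (\<Sum>i\<in>X. eval_at x (p i))"
  by (induction X rule: infinite_finite_induct) (auto simp: eval_at_zero eval_at_add)

lemma eval_at_diff: "x \<in> rat_points \<Longrightarrow> eval_at x (\<alpha> - \<beta>) = eval_at x \<alpha> - eval_at x \<beta>"
  by (simp add: eval_at_def rat_point_simps scale_left_diff_distrib sum_subtractf)

lemma eval_at_bracket:
  "x \<in> rat_points \<Longrightarrow> eval_at x (map_bracket \<alpha> \<beta>) = gbracket (eval_at x \<alpha>) (eval_at x \<beta>)"
  by (simp add: map_bracket_def eval_at_sum eval_at_tensor)
    (simp only: eval_at_def gbracket_simps(3,5), simp add: gbracket_simps(4,6) rat_point_simps scale_sum_right)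

lemma eval_at_eq_0_iff:
  assumes "\<alpha> \<in> maps"
  shows "eval_at x \<alpha> = 0 \<longleftrightarrow> (\<forall>b\<in>B. x (\<alpha> b) = 0)"
  using finite_Basis independent_Basis independentD[of B B "\<lambda>b. x (\<alpha> b)"]
  by (auto simp: eval_at_def)

lemma point_act_rat: "s \<in> carrier \<Gamma> \<Longrightarrow> x \<in> rat_points \<Longrightarrow> point_act s x \<in> rat_points"
proof -
  assume s: "s \<in> carrier \<Gamma>" and x: "x \<in> rat_points"
  have "vector_space ascale" "vector_space ((*) :: 'k \<Rightarrow> 'k \<Rightarrow> 'k)"
    by unfold_locales (auto simp: algebra_simps)
  then show ?thesis using s x
    by (auto simp: rat_points_def point_act_def Vector_Spaces.linear_iff aact_simps aact_mult aact_unit)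
qed

lemma point_act_comp:
  "s \<in> carrier \<Gamma> \<Longrightarrow> t \<in> carrier \<Gamma> \<Longrightarrow> point_act s (point_act t x) = point_act (s \<otimes> t) x"
  by (simp add: point_act_def \<Gamma>.inv_mult_group aact_comp)

lemma point_act_one: "point_act \<one> x = x"
  by (simp add: point_act_def aact_one)

lemma eval_at_map_act:
  assumes "s \<in> carrier \<Gamma>" "x \<in> rat_points"
  shows "eval_at x (map_act s \<alpha>) = gact s (eval_at (point_act (inv s) x) \<alpha>)"
  using assms by (simp add: map_act_def eval_at_sum eval_at_tensor)
    (simp add: eval_at_def gact_simps point_act_def)

lemma eval_at_point_act:
  assumes s: "s \<in> carrier \<Gamma>" and x: "x \<in> rat_points" and \<alpha>: "\<alpha> \<in> \<MM>"
  shows "eval_at (point_act s x) \<alpha> = gact s (eval_at x \<alpha>)"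
proof -
  have "eval_at (point_act s x) (map_act s \<alpha>) = gact s (eval_at x \<alpha>)"
    using s x by (simp add: eval_at_map_act point_act_rat point_act_comp point_act_one)
  then show ?thesis using s \<alpha> by (simp add: equivariant_maps_def)
qed

lemma eval_at_point_fixed:
  "x \<in> rat_points \<Longrightarrow> \<alpha> \<in> \<MM> \<Longrightarrow> eval_at x \<alpha> \<in> point_fixed x"
  using eval_at_point_act[of _ x \<alpha>, symmetric] by (auto simp: point_fixed_def stabilizer_def)

end

section \<open>Coordinate spaces\<close>

lemma coord_vector_space: "vector_space (coord_scale :: 'k::field \<Rightarrow> ('i \<Rightarrow> 'k) \<Rightarrow> 'i \<Rightarrow> 'k)"
  by unfold_locales (auto simp: coord_scale_def fun_eq_iff algebra_simps)

interpretation coord: alg_closed_char_0_vector_space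
  "coord_scale :: 'k::{alg_closed_field, field_char_0} \<Rightarrow> ('i \<Rightarrow> 'k) \<Rightarrow> 'i \<Rightarrow> 'k"
  by (simp add: alg_closed_char_0_vector_space_def alg_closed_vector_space_def coord_vector_space)

lemma fun_sum_apply: "(\<Sum>x\<in>S. f x) y = (\<Sum>x\<in>S. f x y)" for f :: "'x \<Rightarrow> 'y \<Rightarrow> 'z::comm_monoid_add"
  by (induction S rule: infinite_finite_induct) auto

definition unit_vec :: "'i \<Rightarrow> 'i \<Rightarrow> 'k::field" where "unit_vec i = (\<lambda>j. if j = i then 1 else 0)"

lemma coord_eq_sum_unit_vec:
  assumes "finite I" "v \<in> coord_space I"
  shows "v = (\<Sum>i\<in>I. coord_scale (v i) (unit_vec i))"
proof
  fix j
  have "(\<Sum>i\<in>I. coord_scale (v i) (unit_vec i)) j = (\<Sum>i\<in>I. if j = i then v j else 0)"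
    unfolding fun_sum_apply by (intro sum.cong) (auto simp: coord_scale_def unit_vec_def)
  also have "\<dots> = v j" using assms by (auto simp: coord_space_def)
  finally show "v j = (\<Sum>i\<in>I. coord_scale (v i) (unit_vec i)) j" ..
qed

lemma coord_space_in_span:
  "finite I \<Longrightarrow> (coord_space I :: ('i \<Rightarrow> 'k::{alg_closed_field, field_char_0}) set) \<subseteq> coord.span (unit_vec ` I)"
  using coord_eq_sum_unit_vec by (metis (no_types, lifting) coord.span_base coord.span_scale coord.span_sum imageI subsetI)

lemma coord_space_subspace:
  "coord.subspace (coord_space I :: ('i \<Rightarrow> 'k::{alg_closed_field, field_char_0}) set)"
  by (auto simp: coord.subspace_def coord_space_def coord_scale_def)

context char_0_equivariant_map_algebra
begin

section \<open>Interpolation at points of distinct orbits\<close>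

lemma separating_function:
  assumes S: "finite S" "S \<subseteq> rat_points" and x: "x \<in> rat_points" "x \<notin> S"
  obtains f where "x f = 1" "\<And>y. y \<in> S \<Longrightarrow> y f = 0"
proof -
  have "\<exists>f. x f = 1 \<and> (\<forall>y\<in>S. y f = 0)" using S x(2)
  proof (induction S rule: finite_induct)
    case empty
    then show ?case using rat_point_simps(4)[OF x(1)] by blast
  next
    case (insert y S)
    then obtain f where f: "x f = 1" "\<forall>y\<in>S. y f = 0" by auto
    obtain g where g: "x g \<noteq> y g" using insert.prems by auto
    have y: "y \<in> rat_points" using insert.prems by auto
    define h where "h = ascale (inverse (x g - y g)) (g - ascale (y g) aunit)"
    have "x h = 1" "y h = 0"
      using g by (auto simp: h_def rat_point_simps[OF x(1)] rat_point_simps[OF y])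
    moreover have "x (f * h) = x f * x h" "y (f * h) = y f * y h"
      by (rule rat_point_simps(3)[OF x(1)], rule rat_point_simps(3)[OF y])
    moreover have "\<forall>z\<in>S. z (f * h) = z f * z h"
      using insert.prems by (intro ballI rat_point_simps(3)) auto
    ultimately have "x (f * h) = 1 \<and> (\<forall>z\<in>insert y S. z (f * h) = 0)"
      using f by auto
    then show ?case by blast
  qed
  then show ?thesis using that by blast
qed

definition orbit_distinct :: "('a \<Rightarrow> 'k) set \<Rightarrow> bool"
  where "orbit_distinct S \<longleftrightarrow> (\<forall>x\<in>S. \<forall>y\<in>S. \<forall>s\<in>carrier \<Gamma>. point_act s x = y \<longrightarrow> x = y)"

lemma point_act_inv: "s \<in> carrier \<Gamma> \<Longrightarrow> point_act s x = y \<longleftrightarrow> x = point_act (inv s) y"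
  by (auto simp: point_act_comp point_act_one)

text \<open>Take \<open>f\<close> with value \<open>1\<close> at \<open>x\<close> and \<open>0\<close> at all other points of the orbits that meet \<open>S\<close>.\<close>

lemma orbit_separating_function:
  assumes S: "finite S" "S \<subseteq> rat_points" "orbit_distinct S" and x: "x \<in> S"
  obtains f where "\<And>y s. y \<in> S \<Longrightarrow> s \<in> carrier \<Gamma> \<Longrightarrow>
    y (aact s f) = (if y = x \<and> s \<in> stabilizer \<Gamma> point_act x then 1 else 0)"
proof -
  define O' where "O' = (\<lambda>(y, s). point_act s y) ` (S \<times> carrier \<Gamma>) - {x}"
  have "finite O'" "O' \<subseteq> rat_points" "x \<notin> O'"
    using S finite_group by (auto simp: O'_def point_act_rat)
  then obtain f where f: "x f = 1" "\<And>y. y \<in> O' \<Longrightarrow> y f = 0"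
    using separating_function S x by (metis subsetD)
  have "y (aact s f) = (if y = x \<and> s \<in> stabilizer \<Gamma> point_act x then 1 else 0)"
    if y: "y \<in> S" and s: "s \<in> carrier \<Gamma>" for y s
  proof -
    have e: "y (aact s f) = point_act (inv s) y f" using s by (simp add: point_act_def)
    have eq: "point_act (inv s) y = x \<longleftrightarrow> y = x \<and> s \<in> stabilizer \<Gamma> point_act x"
    proof
      assume a: "point_act (inv s) y = x"
      then have "y = x" using S(3) y x \<Gamma>.inv_closed[OF s] unfolding orbit_distinct_def by blast
      then show "y = x \<and> s \<in> stabilizer \<Gamma> point_act x"
        using a s point_act_inv[of s x x] by (auto simp: stabilizer_def)
    next
      assume "y = x \<and> s \<in> stabilizer \<Gamma> point_act x"
      then show "point_act (inv s) y = x" using s point_act_inv[of s x x] by (auto simp: stabilizer_def)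
    qed
    show ?thesis
    proof (cases "point_act (inv s) y = x")
      case False
      have "point_act (inv s) y \<in> (\<lambda>(y, s). point_act s y) ` (S \<times> carrier \<Gamma>)"
        using y s by (intro image_eqI[of _ _ "(y, inv s)"]) auto
      then have "point_act (inv s) y \<in> O'" using False by (simp add: O'_def)
      then show ?thesis using e f False eq by auto
    qed (use e f eq in auto)
  qed
  then show ?thesis using that by blast
qed

lemma stabilizer_card_nonzero: "of_nat (card (stabilizer \<Gamma> point_act x)) \<noteq> (0 :: 'k)"
proof -
  have "finite (stabilizer \<Gamma> point_act x)" "\<one> \<in> stabilizer \<Gamma> point_act x"
    using finite_group by (auto simp: stabilizer_def point_act_one)
  then show ?thesis by (auto simp: card_eq_0_iff)
qed

lemma sum_over_stabilizer:
  "(\<Sum>s\<in>carrier \<Gamma>. if s \<in> stabilizer \<Gamma> point_act x then F s else 0) = (\<Sum>s\<in>stabilizer \<Gamma> point_act x. F s)"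
  using finite_group by (subst sum.inter_restrict[symmetric])
    (auto simp: stabilizer_def intro: sum.cong)

text \<open>Sum the translates of the function \<open>f\<close> of \<open>orbit_separating_function\<close>; the value at \<open>x\<close> is the order of the
  stabilizer, which is invertible in \<open>k\<close>.\<close>

lemma invariant_separating_function:
  assumes S: "finite S" "S \<subseteq> rat_points" "orbit_distinct S" and x: "x \<in> S"
  obtains r where "r \<in> invariant_functions" "\<And>y. y \<in> S \<Longrightarrow> y r = (if y = x then 1 else 0)"
proof -
  obtain f where f: "\<And>y s. y \<in> S \<Longrightarrow> s \<in> carrier \<Gamma> \<Longrightarrow>
    y (aact s f) = (if y = x \<and> s \<in> stabilizer \<Gamma> point_act x then 1 else 0)"
    using orbit_separating_function[OF S x] by metis
  define r where "r = (\<Sum>s\<in>carrier \<Gamma>. aact s f)"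
  have "aact t r = r" if t: "t \<in> carrier \<Gamma>" for t
  proof -
    have "aact t r = (\<Sum>s\<in>carrier \<Gamma>. aact (t \<otimes> s) f)"
      unfolding r_def using t by (simp add: aact_simps aact_comp)
    also have "\<dots> = r"
      unfolding r_def by (rule sum.reindex_bij_betw[OF translate_bij[OF t], of "\<lambda>s. aact s f"])
    finally show ?thesis .
  qed
  then have r: "r \<in> invariant_functions" by (auto simp: invariant_functions_def)
  let ?c = "of_nat (card (stabilizer \<Gamma> point_act x)) :: 'k"
  have yr: "y r = (if y = x then ?c else 0)" if "y \<in> S" for y
  proof -
    have "y \<in> rat_points" using that S by blast
    then have "y r = (\<Sum>s\<in>carrier \<Gamma>. y (aact s f))"
      unfolding r_def by (rule rat_point_simps(6))
    also have "\<dots> = (\<Sum>s\<in>carrier \<Gamma>. if s \<in> stabilizer \<Gamma> point_act x then (if y = x then 1 else 0) else 0)"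
      using f[OF that] by (intro sum.cong) auto
    finally show ?thesis unfolding sum_over_stabilizer by auto
  qed
  show ?thesis
  proof (rule that)
    show "ascale (inverse ?c) r \<in> invariant_functions"
      using r by (auto simp: invariant_functions_def aact_simps)
    show "y (ascale (inverse ?c) r) = (if y = x then 1 else 0)" if "y \<in> S" for y
      using yr[OF that] rat_point_simps(2)[of y "inverse ?c" r] that S stabilizer_card_nonzero by auto
  qed
qed

text \<open>Symmetrize \<open>u \<otimes> f\<close> with \<open>f\<close> as in \<open>orbit_separating_function\<close>.  At \<open>x\<close> only the terms of the stabilizer
  survive; as these fix \<open>u\<close>, the value is a nonzero multiple of \<open>u\<close>.\<close>

lemma evaluation_surjective:
  assumes S: "finite S" "S \<subseteq> rat_points" "orbit_distinct S" and x: "x \<in> S" and u: "u \<in> point_fixed x"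
  obtains \<alpha> where "\<alpha> \<in> \<MM>" "eval_at x \<alpha> = u" "\<And>y. y \<in> S - {x} \<Longrightarrow> eval_at y \<alpha> = 0"
proof -
  obtain f where f: "\<And>y s. y \<in> S \<Longrightarrow> s \<in> carrier \<Gamma> \<Longrightarrow>
    y (aact s f) = (if y = x \<and> s \<in> stabilizer \<Gamma> point_act x then 1 else 0)"
    using orbit_separating_function[OF S x] by metis
  let ?c = "of_nat (card (stabilizer \<Gamma> point_act x)) :: 'k"
  define \<alpha> where "\<alpha> = map_scale (inverse ?c) (symm (tensor u f))"
  have ev: "eval_at y (symm (tensor u f)) = (if y = x then gscale ?c u else 0)" if "y \<in> S" for y
  proof -
    have "y \<in> rat_points" using that S by auto
    then have "eval_at y (symm (tensor u f)) = (\<Sum>s\<in>carrier \<Gamma>. gscale (y (aact s f)) (gact s u))"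
      by (simp add: symm_def eval_at_sum map_act_tensor eval_at_tensor)
    also have "\<dots> = (\<Sum>s\<in>carrier \<Gamma>. if s \<in> stabilizer \<Gamma> point_act x then (if y = x then u else 0) else 0)"
      using f[OF that] u by (intro sum.cong) (auto simp: point_fixed_def)
    finally show ?thesis unfolding sum_over_stabilizer by (auto simp: sum_constant_scale)
  qed
  show ?thesis
  proof (rule that)
    show "\<alpha> \<in> \<MM>"
      unfolding \<alpha>_def by (intro maps.subspace_scale equivariant_maps_subspace symm_equivariant)
    show "eval_at x \<alpha> = u"
      using x S ev stabilizer_card_nonzero by (auto simp: \<alpha>_def eval_at_scale)
    show "eval_at y \<alpha> = 0" if "y \<in> S - {x}" for y
      using that S ev by (auto simp: \<alpha>_def eval_at_scale)
  qed
qed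

lemma orbit_distinct_insert:
  assumes "orbit_distinct S" "\<And>y s. y \<in> S \<Longrightarrow> s \<in> carrier \<Gamma> \<Longrightarrow> x \<noteq> point_act s y"
  shows "orbit_distinct (insert x S)"
  unfolding orbit_distinct_def
proof (intro ballI impI)
  fix y z s assume a: "y \<in> insert x S" "z \<in> insert x S" "s \<in> carrier \<Gamma>" "point_act s y = z"
  have b: "y = point_act (inv s) z" "inv s \<in> carrier \<Gamma>" using a point_act_inv by auto
  consider "y \<in> S" "z \<in> S" | "y = x" "z = x" | "y = x" "z \<in> S" | "y \<in> S" "z = x" using a by blast
  then show "y = z"
  proof cases
    case 1
    then show ?thesis using a assms(1) unfolding orbit_distinct_def by blast
  next
    case 3
    then show ?thesis using assms(2)[OF 3(2) b(2)] b(1) by simp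
  next
    case 4
    then show ?thesis using assms(2)[OF 4(1) a(3)] a(4) by simp
  qed simp
qed

lemma orbit_representatives:
  assumes "finite S"
  obtains S' where "S' \<subseteq> S" "orbit_distinct S'"
    "\<And>x. x \<in> S \<Longrightarrow> \<exists>y\<in>S'. \<exists>s\<in>carrier \<Gamma>. x = point_act s y"
proof -
  have "\<exists>S'\<subseteq>S. orbit_distinct S' \<and> (\<forall>x\<in>S. \<exists>y\<in>S'. \<exists>s\<in>carrier \<Gamma>. x = point_act s y)"
    using assms
  proof (induction S rule: finite_induct)
    case empty
    then show ?case by (auto simp: orbit_distinct_def)
  next
    case (insert x S)
    then obtain S' where S': "S' \<subseteq> S" "orbit_distinct S'" "\<forall>x\<in>S. \<exists>y\<in>S'. \<exists>s\<in>carrier \<Gamma>. x = point_act s y"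
      by blast
    show ?case
    proof (cases "\<exists>y\<in>S'. \<exists>s\<in>carrier \<Gamma>. x = point_act s y")
      case True
      then show ?thesis using S' by (intro exI[of _ S']) auto
    next
      case False
      then have "orbit_distinct (insert x S')" using orbit_distinct_insert S' by blast
      moreover have "x = point_act \<one> x" by (simp add: point_act_one)
      ultimately show ?thesis using S' by (intro exI[of _ "insert x S'"]) blast
    qed
  qed
  then show ?thesis using that by blast
qed

section \<open>The ideal of coefficients of an ideal of maps\<close>

interpretation unit_prod: comm_monoid_set "(*) :: 'a \<Rightarrow> _" aunit
  by unfold_locales (rule unit_right)

text \<open>In this context \<open>K\<close> stands for the set of elements of \<open>M\<close> that act by scalars in an irreducible
  representation.  It is the kernel of a linear map \<open>\<tau>\<close> into a finite-dimensional space, it is closed under multiplication by invariants, and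
  it contains every ideal \<open>N\<close> of \<open>M\<close> with \<open>[N, N] \<subseteq> K\<close>.\<close>

context
  fixes K :: "('g \<Rightarrow> 'a) set" and \<tau> :: "('g \<Rightarrow> 'a) \<Rightarrow> 't \<Rightarrow> 'k" and T :: "'t set"
  assumes K_amul: "\<And>r \<alpha>. r \<in> invariant_functions \<Longrightarrow> \<alpha> \<in> K \<Longrightarrow> amul r \<alpha> \<in> K"
    and K_rad: "\<And>N. maps.subspace N \<Longrightarrow> N \<subseteq> \<MM> \<Longrightarrow>
      (\<And>\<alpha> \<beta>. \<beta> \<in> \<MM> \<Longrightarrow> \<alpha> \<in> N \<Longrightarrow> map_bracket \<beta> \<alpha> \<in> N) \<Longrightarrow>
      (\<And>\<alpha> \<beta>. \<alpha> \<in> N \<Longrightarrow> \<beta> \<in> N \<Longrightarrow> map_bracket \<alpha> \<beta> \<in> K) \<Longrightarrow> N \<subseteq> K"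
    and K_def: "K = {\<alpha> \<in> \<MM>. \<tau> \<alpha> = 0}"
    and finT: "finite T" and \<tau>T: "\<And>\<alpha>. \<alpha> \<in> \<MM> \<Longrightarrow> \<tau> \<alpha> \<in> coord_space T"
    and \<tau>_add: "\<And>\<alpha> \<beta>. \<alpha> \<in> \<MM> \<Longrightarrow> \<beta> \<in> \<MM> \<Longrightarrow> \<tau> (\<alpha> + \<beta>) = \<tau> \<alpha> + \<tau> \<beta>"
    and \<tau>_scale: "\<And>c \<alpha>. \<alpha> \<in> \<MM> \<Longrightarrow> \<tau> (map_scale c \<alpha>) = coord_scale c (\<tau> \<alpha>)"
begin

lemma \<tau>_zero: "\<tau> 0 = 0"
  using \<tau>_scale[of 0 0] maps.subspace_0[OF equivariant_maps_subspace] by (simp add: coord_scale_def zero_fun_def)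

lemma K_subspace: "maps.subspace K"
  using \<tau>_zero equivariant_maps_subspace unfolding K_def maps.subspace_def
  by (auto simp: \<tau>_add \<tau>_scale)

lemma \<tau>_sum: "(\<And>i. i \<in> X \<Longrightarrow> f i \<in> \<MM>) \<Longrightarrow> \<tau> (\<Sum>i\<in>X. f i) = (\<Sum>i\<in>X. \<tau> (f i))"
  by (induction X rule: infinite_finite_induct)
    (auto simp: \<tau>_zero \<tau>_add maps.subspace_sum[OF equivariant_maps_subspace])

text \<open>The factor \<open>h\<close> makes this set an ideal; without it only the span of \<open>f\<close> would be tested.\<close>

definition coeff_ideal :: "'a set"
  where "coeff_ideal = {f. \<forall>u h. symm (tensor u (f * h)) \<in> K}"

lemma coeff_ideal_ideal: "alg_ideal coeff_ideal"
  unfolding alg_ideal_def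
proof (intro conjI A.subspaceI ballI allI)
  have "symm (tensor u 0) = 0" for u
    using symm_scale[of 0 "tensor u 0"] tensor_scale_right[of u 0 0] by simp
  then show "0 \<in> coeff_ideal" using maps.subspace_0[OF K_subspace] by (simp add: coeff_ideal_def)
  show "f + g \<in> coeff_ideal" if "f \<in> coeff_ideal" "g \<in> coeff_ideal" for f g
    using that by (auto simp: coeff_ideal_def distrib_right tensor_add_right symm_add intro: maps.subspace_add[OF K_subspace])
  show "ascale c f \<in> coeff_ideal" if "f \<in> coeff_ideal" for c f
    using that by (auto simp: coeff_ideal_def A.mult_scale_left tensor_scale_right symm_scale intro: maps.subspace_scale[OF K_subspace])
  show "h * f \<in> coeff_ideal" if "f \<in> coeff_ideal" for h f
  proof -
    have "h * f * g = f * (h * g)" for g by (simp add: mult.left_commute mult.assoc)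
    then show ?thesis using that by (simp add: coeff_ideal_def)
  qed
qed

lemmas coeff_ideal_closed = alg_idealD[OF coeff_ideal_ideal]

lemma symm_in_K_if_coefficients_in_ideal:
  assumes "\<gamma> \<in> maps" "\<And>b. \<gamma> b \<in> coeff_ideal"
  shows "symm \<gamma> \<in> K"
proof -
  have "symm (tensor b (\<gamma> b * aunit)) \<in> K" for b
    using assms(2) unfolding coeff_ideal_def by blast
  then have "(\<Sum>b\<in>B. symm (tensor b (\<gamma> b))) \<in> K"
    by (intro maps.subspace_sum K_subspace) (simp add: unit_right)
  then show ?thesis using maps_eq_sum_tensor[OF assms(1)] symm_sum by metis
qed

lemma in_K_if_coefficients_in_ideal:
  assumes "\<alpha> \<in> \<MM>" "\<And>b. \<alpha> b \<in> coeff_ideal"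
  shows "\<alpha> \<in> K"
proof -
  have "map_scale (of_nat (card (carrier \<Gamma>))) \<alpha> \<in> K"
    using symm_in_K_if_coefficients_in_ideal[OF equivariant_in_maps[OF assms(1)] assms(2)] symm_of_equivariant[OF assms(1)] by simp
  then have "map_scale (inverse (of_nat (card (carrier \<Gamma>)))) (map_scale (of_nat (card (carrier \<Gamma>))) \<alpha>) \<in> K"
    by (rule maps.subspace_scale[OF K_subspace])
  then show ?thesis using card_\<Gamma>_nonzero by simp
qed

lemma coeff_ideal_stable:
  assumes s: "s \<in> carrier \<Gamma>" and f: "f \<in> coeff_ideal"
  shows "aact s f \<in> coeff_ideal"
  unfolding coeff_ideal_def
proof (intro CollectI allI)
  fix u h
  have "gact s (gact (inv s) u) = u" using s gact_comp[of s "inv s" u] by (simp add: gact_one)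
  then have "tensor u (aact s f * h) = map_act s (tensor (gact (inv s) u) (f * aact (inv s) h))"
    using s by (simp add: map_act_tensor aact_mult aact_inv)
  then have "symm (tensor u (aact s f * h)) = symm (tensor (gact (inv s) u) (f * aact (inv s) h))"
    using s by (simp add: symm_act)
  then show "symm (tensor u (aact s f * h)) \<in> K" using f by (simp add: coeff_ideal_def)
qed

lemma invariant_in_coeff_ideal:
  assumes r: "r \<in> invariant_functions"
  shows "r \<in> coeff_ideal \<longleftrightarrow> (\<forall>\<beta>\<in>\<MM>. amul r \<beta> \<in> K)"
proof
  assume "r \<in> coeff_ideal"
  then show "\<forall>\<beta>\<in>\<MM>. amul r \<beta> \<in> K"
    using coeff_ideal_closed(5) by (intro ballI in_K_if_coefficients_in_ideal amul_equivariant r) (auto simp: amul_def)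
next
  assume a: "\<forall>\<beta>\<in>\<MM>. amul r \<beta> \<in> K"
  show "r \<in> coeff_ideal"
    unfolding coeff_ideal_def
  proof (intro CollectI allI)
    fix u h
    show "symm (tensor u (r * h)) \<in> K"
      using a symm_amul[OF r, of "tensor u h"] symm_equivariant by (simp add: amul_tensor)
  qed
qed

text \<open>The symmetrizations of maps with coefficients in \<open>h A\<close> form an ideal \<open>N\<close> of \<open>M\<close>.  A bracket of two of them is
  the symmetrization of a map with coefficients in the sum of the ideals \<open>h s(h) A\<close>; here one factor stays unsymmetrized
  because symmetrization is linear over brackets with \<open>M\<close>.  So \<open>[N, N] \<subseteq> K\<close>.\<close>

lemma coeff_ideal_translates:
  assumes h: "\<And>t. t \<in> carrier \<Gamma> \<Longrightarrow> h * aact t h \<in> coeff_ideal"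
  shows "h \<in> coeff_ideal"
proof -
  let ?N = "{symm (amul h \<delta>) | \<delta>. \<delta> \<in> maps}"
  have "?N \<subseteq> K"
  proof (rule K_rad)
    have "Vector_Spaces.linear map_scale map_scale (\<lambda>\<delta>. symm (amul h \<delta>))"
      by (simp add: Vector_Spaces.linear_iff maps.vector_space_axioms amul_add amul_scale symm_add symm_scale)
    then have "maps.subspace ((\<lambda>\<delta>. symm (amul h \<delta>)) ` maps)"
      by (intro module_hom.subspace_image[OF _ maps_subspace]) (simp add: linear_iff_module_hom)
    then show "maps.subspace ?N" by (simp add: Setcompr_eq_image)
    show "?N \<subseteq> \<MM>" using symm_equivariant by auto
    show "map_bracket \<beta> \<alpha> \<in> ?N" if "\<beta> \<in> \<MM>" "\<alpha> \<in> ?N" for \<alpha> \<beta>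
    proof -
      from that obtain \<delta> where "\<delta> \<in> maps" "\<alpha> = symm (amul h \<delta>)" by blast
      then have "map_bracket \<beta> \<alpha> = symm (amul h (map_bracket \<beta> \<delta>))"
        using that by (simp add: symm_bracket[symmetric] amul_bracket)
      then show ?thesis using map_bracket_in_maps by blast
    qed
    show "map_bracket \<alpha> \<beta> \<in> K" if "\<alpha> \<in> ?N" "\<beta> \<in> ?N" for \<alpha> \<beta>
    proof -
      from that obtain \<delta> \<epsilon> where de: "\<delta> \<in> maps" "\<epsilon> \<in> maps" "\<alpha> = symm (amul h \<delta>)" "\<beta> = symm (amul h \<epsilon>)" by blast
      have "map_bracket \<alpha> \<beta> = symm (map_bracket \<alpha> (amul h \<epsilon>))"
        unfolding de(4) using de(3) symm_equivariant by (simp add: symm_bracket)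
      also have "map_bracket \<alpha> (amul h \<epsilon>) = (\<Sum>s\<in>carrier \<Gamma>. amul (h * aact s h) (map_bracket (map_act s \<delta>) \<epsilon>))"
        unfolding de(3) symm_def
        by (simp add: map_bracket_sum amul_bracket map_act_amul amul_mult amul_sum)
      also have "symm \<dots> = (\<Sum>s\<in>carrier \<Gamma>. symm (amul (h * aact s h) (map_bracket (map_act s \<delta>) \<epsilon>)))"
        by (rule symm_sum)
      also have "\<dots> \<in> K"
        using coeff_ideal_closed(5)[OF h] by (intro maps.subspace_sum K_subspace symm_in_K_if_coefficients_in_ideal amul_in_maps map_bracket_in_maps)
          (auto simp: amul_def)
      finally show ?thesis .
    qed
  qed
  then have "symm (amul h (tensor u f)) \<in> K" for u f using tensor_in_maps by blast
  then show ?thesis by (simp add: coeff_ideal_def amul_tensor)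
qed

text \<open>The previous lemma needs \<open>h t(h) \<in> I\<close> for all \<open>t\<close>, which need not hold for \<open>h = f\<close>.  Let \<open>h\<close> be the product of
  the translates \<open>s f\<close> over a set \<open>Y \<subseteq> \<Gamma>\<close> of largest size for which this product is not in \<open>I\<close>.  If the translate of \<open>Y\<close> by
  \<open>t\<close> contains an element outside \<open>Y\<close>, then \<open>h t(h)\<close> is a multiple of a product over a larger set; otherwise it is a
  multiple of the square of a translate of \<open>f\<close>.  In both cases it lies in \<open>I\<close>.\<close>

lemma coeff_ideal_radical:
  assumes ff: "f * f \<in> coeff_ideal"
  shows "f \<in> coeff_ideal"
proof (rule ccontr)
  assume f: "f \<notin> coeff_ideal"
  define p where "p Y = unit_prod.F (\<lambda>s. aact s f) Y" for Y
  define P where "P Y \<longleftrightarrow> Y \<subseteq> carrier \<Gamma> \<and> p Y \<notin> coeff_ideal" for Y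
  have P1: "P {\<one>}" using f by (simp add: P_def p_def aact_one unit_right)
  have "\<forall>Y. P Y \<longrightarrow> card Y < Suc (card (carrier \<Gamma>))"
    using finite_group card_mono by (auto simp: P_def less_Suc_eq_le)
  then obtain Y where Y: "P Y" "\<And>Z. P Z \<Longrightarrow> card Z \<le> card Y"
    using ex_has_greatest_nat[of P "{\<one>}" card, OF P1] by metis
  have XG: "Y \<subseteq> carrier \<Gamma>" "p Y \<notin> coeff_ideal" and fX: "finite Y"
    using Y finite_group finite_subset by (auto simp: P_def)
  have "Y \<noteq> {}" using Y(2)[OF P1] by auto
  then obtain s where s: "s \<in> Y" by blast
  have "p Y * aact t (p Y) \<in> coeff_ideal" if t: "t \<in> carrier \<Gamma>" for t
  proof -
    have aactp: "aact t (p Z) = unit_prod.F (\<lambda>s. aact (t \<otimes> s) f) Z" if "Z \<subseteq> carrier \<Gamma>" for Z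
      using finite_subset[OF that finite_group] that t
      by (induction Z rule: finite_induct) (auto simp: p_def aact_unit aact_mult aact_comp)
    have split: "\<exists>g. aact t (p Y) = aact (t \<otimes> s) f * g" if "s \<in> Y" for s
      unfolding aactp[OF XG(1)] using unit_prod.remove[OF fX that] by blast
    show ?thesis
    proof (cases "\<exists>s\<in>Y. t \<otimes> s \<notin> Y")
      case True
      then obtain s where s: "s \<in> Y" "t \<otimes> s \<notin> Y" by blast
      have "\<not> P (insert (t \<otimes> s) Y)" using Y(2)[of "insert (t \<otimes> s) Y"] s fX by auto
      then have "p (insert (t \<otimes> s) Y) \<in> coeff_ideal" using s t XG by (auto simp: P_def)
      then have *: "aact (t \<otimes> s) f * p Y \<in> coeff_ideal" using s fX by (simp add: p_def)
      obtain g where "aact t (p Y) = aact (t \<otimes> s) f * g" using split s by blast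
      then have "p Y * aact t (p Y) = (aact (t \<otimes> s) f * p Y) * g" by (simp add: ac_simps)
      then show ?thesis using coeff_ideal_closed(5)[OF *] by simp
    next
      case False
      then have ts: "t \<otimes> s \<in> Y" using s by blast
      obtain g where g: "aact t (p Y) = aact (t \<otimes> s) f * g" using split s by blast
      obtain g' where g': "p Y = aact (t \<otimes> s) f * g'"
        unfolding p_def using unit_prod.remove[OF fX ts] by blast
      have "t \<otimes> s \<in> carrier \<Gamma>" using ts XG by blast
      then have *: "aact (t \<otimes> s) f * aact (t \<otimes> s) f \<in> coeff_ideal"
        using coeff_ideal_stable[OF _ ff] by (simp add: aact_mult)
      have "p Y * aact t (p Y) = (aact (t \<otimes> s) f * aact (t \<otimes> s) f) * (g' * g)"
        by (simp only: g) (simp add: g' ac_simps)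
      then show ?thesis using coeff_ideal_closed(5)[OF *] by simp
    qed
  qed
  then have "p Y \<in> coeff_ideal" by (rule coeff_ideal_translates)
  then show False using XG by simp
qed

text \<open>An invariant \<open>r\<close> lies in the ideal as soon as it multiplies finitely many elements \<open>F\<close> that span \<open>M\<close> modulo
  \<open>K\<close> into \<open>K\<close>.  So the invariants modulo the ideal embed into the space of maps from \<open>F\<close> to \<open>M / K\<close>.\<close>

lemma coeff_ideal_finite_codimension:
  obtains d where "\<And>w :: nat \<Rightarrow> 'a. (\<And>i. i \<le> d \<Longrightarrow> w i \<in> invariant_functions) \<Longrightarrow>
    \<exists>c. (\<exists>j\<le>d. c j \<noteq> 0) \<and> (\<Sum>i\<le>d. ascale (c i) (w i)) \<in> coeff_ideal"
proof -
  obtain D where D: "D \<subseteq> \<tau> ` \<MM>" "coord.independent D" "\<tau> ` \<MM> \<subseteq> coord.span D"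
    using coord.maximal_independent_subset[of "\<tau> ` \<MM>"] by blast
  have "D \<subseteq> coord.span (unit_vec ` T)"
    using D(1) \<tau>T coord_space_in_span[OF finT] by blast
  then have finD: "finite D" using coord.independent_span_bound[OF _ D(2), of "unit_vec ` T"] finT by blast
  obtain F where F: "F \<subseteq> \<MM>" "finite F" "D = \<tau> ` F"
    using finite_subset_image[OF finD D(1)] by blast
  have gen: "amul r \<beta> \<in> K"
    if r: "r \<in> invariant_functions" and rF: "\<And>\<phi>. \<phi> \<in> F \<Longrightarrow> amul r \<phi> \<in> K" and \<beta>: "\<beta> \<in> \<MM>" for r \<beta>
  proof -
    \<comment> \<open>The \<open>\<zeta>\<close> with \<open>r \<zeta> \<in> K\<close> form a subspace that contains \<open>K\<close>, the kernel of \<open>\<tau>\<close>; so it is enough that their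
      images under \<open>\<tau>\<close> contain the basis \<open>D\<close> of the image of \<open>M\<close>.\<close>
    let ?Z = "{\<zeta> \<in> \<MM>. amul r \<zeta> \<in> K}"
    have subZ: "maps.subspace ?Z"
    proof (rule maps.subspaceI)
      have "amul r 0 = 0" using amul_scale(1)[of r 0 0] by simp
      then show "0 \<in> ?Z"
        using maps.subspace_0[OF equivariant_maps_subspace] maps.subspace_0[OF K_subspace] by simp
    qed (auto simp: amul_add amul_scale intro: maps.subspace_add[OF equivariant_maps_subspace]
        maps.subspace_add[OF K_subspace] maps.subspace_scale[OF equivariant_maps_subspace] maps.subspace_scale[OF K_subspace])
    have "coord.subspace (\<tau> ` ?Z)"
    proof (rule coord.subspaceI)
      show "0 \<in> \<tau> ` ?Z" using imageI[OF maps.subspace_0[OF subZ], of \<tau>] by (simp only: \<tau>_zero)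
      show "v + w \<in> \<tau> ` ?Z" if "v \<in> \<tau> ` ?Z" "w \<in> \<tau> ` ?Z" for v w
      proof -
        from that obtain a b where "a \<in> ?Z" "b \<in> ?Z" "v = \<tau> a" "w = \<tau> b" by blast
        then have "v + w = \<tau> (a + b)" "a + b \<in> ?Z" using \<tau>_add maps.subspace_add[OF subZ] by auto
        then show ?thesis by blast
      qed
      show "coord_scale c v \<in> \<tau> ` ?Z" if "v \<in> \<tau> ` ?Z" for c v
      proof -
        from that obtain a where "a \<in> ?Z" "v = \<tau> a" by blast
        then have "coord_scale c v = \<tau> (map_scale c a)" "map_scale c a \<in> ?Z"
          using \<tau>_scale maps.subspace_scale[OF subZ] by auto
        then show ?thesis by blast
      qed
    qed
    moreover have "D \<subseteq> \<tau> ` ?Z" using F rF by blast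
    ultimately have "coord.span D \<subseteq> \<tau> ` ?Z" by (intro coord.span_minimal)
    then obtain \<zeta> where \<zeta>: "\<zeta> \<in> ?Z" "\<tau> \<beta> = \<tau> \<zeta>" using D(3) \<beta> by blast
    have \<zeta>M: "\<zeta> \<in> \<MM>" using \<zeta> by blast
    have "\<beta> - \<zeta> \<in> \<MM>" using \<zeta> \<beta> maps.subspace_diff[OF equivariant_maps_subspace] by blast
    moreover have "\<tau> \<beta> = \<tau> (\<beta> - \<zeta>) + \<tau> \<zeta>" using \<tau>_add[OF calculation \<zeta>M] by simp
    ultimately have "\<beta> - \<zeta> \<in> K" using \<zeta> by (simp add: K_def)
    then have "amul r (\<beta> - \<zeta>) + amul r \<zeta> \<in> K"
      using K_amul[OF r] \<zeta> maps.subspace_add[OF K_subspace] by blast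
    then show ?thesis by (simp add: amul_diff)
  qed
  define G :: "(('g \<Rightarrow> 'a) \<times> 't \<Rightarrow> 'k) set" where "G = unit_vec ` (F \<times> T)"
  have "\<exists>c. (\<exists>j\<le>card G. c j \<noteq> 0) \<and> (\<Sum>i\<le>card G. ascale (c i) (w i)) \<in> coeff_ideal"
    if w: "\<And>i. i \<le> card G \<Longrightarrow> w i \<in> invariant_functions" for w
  proof -
    define W :: "nat \<Rightarrow> ('g \<Rightarrow> 'a) \<times> 't \<Rightarrow> 'k" where "W i = (\<lambda>(\<phi>, t). if \<phi> \<in> F then \<tau> (amul (w i) \<phi>) t else 0)" for i
    have "W i \<in> coord_space (F \<times> T)" if "i \<le> card G" for i
      using \<tau>T[OF amul_equivariant[OF w[OF that]]] F(1) by (auto simp: W_def coord_space_def)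
    then have WG: "W i \<in> coord.span G" if "i \<le> card G" for i
      using that coord_space_in_span[of "F \<times> T"] F(2) finT unfolding G_def by blast
    have finG: "finite G" using F finT by (simp add: G_def)
    obtain c j where c: "j \<le> card G" "c j \<noteq> 0"
      "(\<Sum>i\<le>card G. coord_scale (c i) (W i)) = 0"
      by (rule coord.linear_dependence_in_span[OF finG WG])
    define r where "r = (\<Sum>i\<le>card G. ascale (c i) (w i))"
    have rinv: "r \<in> invariant_functions"
      using w unfolding r_def invariant_functions_def by (auto simp: aact_simps)
    have "amul r \<phi> \<in> K" if \<phi>: "\<phi> \<in> F" for \<phi>
    proof -
      have \<phi>M: "\<phi> \<in> \<MM>" using \<phi> F by blast
      have am: "amul r \<phi> = (\<Sum>i\<le>card G. map_scale (c i) (amul (w i) \<phi>))"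
        by (auto simp: r_def amul_def map_scale_def sum_distrib_right A.mult_scale_left sum_fun_apply)
      have "\<tau> (amul r \<phi>) = (\<Sum>i\<le>card G. coord_scale (c i) (\<tau> (amul (w i) \<phi>)))"
        unfolding am using w \<phi>M
        by (subst \<tau>_sum) (auto simp: \<tau>_scale amul_equivariant maps.subspace_scale[OF equivariant_maps_subspace])
      also have "\<dots> = 0"
      proof
        fix t
        have "(\<Sum>i\<le>card G. coord_scale (c i) (W i)) (\<phi>, t) = 0" using c(3) by simp
        then show "(\<Sum>i\<le>card G. coord_scale (c i) (\<tau> (amul (w i) \<phi>))) t = 0 t"
          using \<phi> by (simp add: fun_sum_apply coord_scale_def W_def)
      qed
      finally show ?thesis using amul_equivariant[OF rinv \<phi>M] by (simp add: K_def)
    qed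
    then have "r \<in> coeff_ideal" using gen rinv invariant_in_coeff_ideal by blast
    then show ?thesis using c unfolding r_def by blast
  qed
  then show ?thesis using that by blast
qed

text \<open>Invariant functions that separate points in different orbits are linearly independent modulo the ideal, so the
  points at which the ideal vanishes form at most \<open>d\<close> orbits.  An equivariant map that vanishes at one point of each orbit
  vanishes at all of them, hence has its coefficients in the ideal.\<close>

lemma finitely_many_points_detect_K:
  obtains S where "finite S" "S \<subseteq> rat_points"
    "\<And>\<alpha>. \<alpha> \<in> \<MM> \<Longrightarrow> (\<And>x. x \<in> S \<Longrightarrow> eval_at x \<alpha> = 0) \<Longrightarrow> \<alpha> \<in> K"
proof -
  obtain d where d: "\<And>w :: nat \<Rightarrow> 'a. (\<And>i. i \<le> d \<Longrightarrow> w i \<in> invariant_functions) \<Longrightarrow>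
    \<exists>c. (\<exists>j\<le>d. c j \<noteq> 0) \<and> (\<Sum>i\<le>d. ascale (c i) (w i)) \<in> coeff_ideal"
    using coeff_ideal_finite_codimension by metis
  have powinv: "pow r i \<in> invariant_functions" if "r \<in> invariant_functions" for r i
    using that by (induction i) (auto simp: pow_def invariant_functions_def aact_unit aact_mult)
  have alg: "\<exists>p. p \<noteq> 0 \<and> (\<Sum>i\<le>degree p. ascale (coeff p i) (pow r i)) \<in> coeff_ideal"
    if r: "r \<in> invariant_functions" for r
  proof -
    obtain c j where c: "j \<le> d" "c j \<noteq> 0" "(\<Sum>i\<le>d. ascale (c i) (pow r i)) \<in> coeff_ideal"
      using d[of "pow r"] powinv[OF r] by blast
    define p where "p = (\<Sum>i\<le>d. monom (c i) i)"
    have cp: "coeff p i = (if i \<le> d then c i else 0)" for i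
      by (simp add: p_def coeff_sum if_distrib cong: if_cong)
    have "coeff p j \<noteq> 0" using c(1,2) by (simp add: cp)
    then have p0: "p \<noteq> 0" by auto
    have dp: "degree p \<le> d" by (rule degree_le) (simp add: cp)
    have "(\<Sum>i\<le>degree p. ascale (coeff p i) (pow r i)) = (\<Sum>i\<le>d. ascale (coeff p i) (pow r i))"
      by (rule sum.mono_neutral_left) (use dp coeff_eq_0[of p] in auto)
    also have "\<dots> = (\<Sum>i\<le>d. ascale (c i) (pow r i))" by (simp add: cp)
    finally show ?thesis using p0 c(3) by auto
  qed
  define P where "P = {x \<in> rat_points. \<forall>h\<in>coeff_ideal. x h = 0}"
  have detect: "f \<in> coeff_ideal" if "\<And>x. x \<in> P \<Longrightarrow> x f = 0" for f
  proof (rule ccontr)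
    assume "f \<notin> coeff_ideal"
    then obtain x where "x \<in> rat_points" "\<And>h. h \<in> coeff_ideal \<Longrightarrow> x h = 0" "x f \<noteq> 0"
      using rational_point_avoiding[OF coeff_ideal_ideal coeff_ideal_radical alg] by metis
    then show False using that by (auto simp: P_def)
  qed
  define Q where "Q S \<longleftrightarrow> finite S \<and> S \<subseteq> P \<and> orbit_distinct S" for S
  have bound: "card S \<le> d" if S: "Q S" for S
  proof (rule ccontr)
    assume "\<not> card S \<le> d"
    then obtain S0 where S0: "S0 \<subseteq> S" "card S0 = Suc d"
      by (metis not_less_eq_eq obtain_subset_with_card_n)
    have fS0: "finite S0" using S0 card.infinite by fastforce
    then obtain x where x: "bij_betw x {..d} S0"
      using ex_bij_betw_nat_finite[OF fS0] S0(2) by (auto simp: atLeast0LessThan lessThan_Suc_atMost)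
    have xS: "x i \<in> S0" if "i \<le> d" for i using x that by (auto simp: bij_betw_def)
    have S0': "finite S0" "S0 \<subseteq> rat_points" "orbit_distinct S0"
      using fS0 S S0 unfolding Q_def P_def orbit_distinct_def by blast+
    have "\<exists>r. r \<in> invariant_functions \<and> (\<forall>y\<in>S0. y r = (if y = x i then 1 else 0))" if "i \<le> d" for i
      using invariant_separating_function[OF S0' xS[OF that]] by metis
    then obtain w where w: "\<And>i. i \<le> d \<Longrightarrow> w i \<in> invariant_functions"
      "\<And>i y. i \<le> d \<Longrightarrow> y \<in> S0 \<Longrightarrow> y (w i) = (if y = x i then 1 else 0)" by metis
    obtain c j where c: "j \<le> d" "c j \<noteq> 0" "(\<Sum>i\<le>d. ascale (c i) (w i)) \<in> coeff_ideal"
      using d[of w] w by blast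
    have xj: "x j \<in> rat_points" "x j (\<Sum>i\<le>d. ascale (c i) (w i)) = 0"
      using xS[OF c(1)] S0 S c(3) by (auto simp: Q_def P_def)
    have "x j (\<Sum>i\<le>d. ascale (c i) (w i)) = (\<Sum>i\<le>d. c i * (if x j = x i then 1 else 0))"
      using w(2) xS[OF c(1)] by (simp add: rat_point_simps[OF xj(1)])
    also have "\<dots> = (\<Sum>i\<le>d. if i = j then c j else 0)"
      using x c(1) by (intro sum.cong) (auto simp: bij_betw_def inj_on_def)
    also have "\<dots> = c j" using c(1) by simp
    finally show False using xj c by simp
  qed
  have "Q {}" by (simp add: Q_def orbit_distinct_def)
  moreover have "\<forall>S. Q S \<longrightarrow> card S < Suc d" using bound by (simp add: less_Suc_eq_le)
  ultimately obtain S where S: "Q S" "\<And>S'. Q S' \<Longrightarrow> card S' \<le> card S"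
    using ex_has_greatest_nat[of Q "{}" card "Suc d"] by metis
  have orbit: "\<exists>y\<in>S. \<exists>s\<in>carrier \<Gamma>. x = point_act s y" if x: "x \<in> P" for x
  proof (rule ccontr)
    assume neg: "\<not> ?thesis"
    have "orbit_distinct (insert x S)"
      by (rule orbit_distinct_insert) (use S(1) neg in \<open>auto simp: Q_def\<close>)
    then have "Q (insert x S)" using S(1) x by (simp add: Q_def)
    then have "card (insert x S) \<le> card S" by (rule S(2))
    moreover have "x = point_act \<one> x" by (simp add: point_act_one)
    then have "x \<notin> S" using neg by blast
    ultimately show False using S by (auto simp: Q_def)
  qed
  show ?thesis
  proof (rule that)
    show "finite S" "S \<subseteq> rat_points" using S by (auto simp: Q_def P_def)
    fix \<alpha> assume \<alpha>: "\<alpha> \<in> \<MM>" "\<And>x. x \<in> S \<Longrightarrow> eval_at x \<alpha> = 0"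
    show "\<alpha> \<in> K"
    proof (rule in_K_if_coefficients_in_ideal[OF \<alpha>(1)])
      fix b
      show "\<alpha> b \<in> coeff_ideal"
      proof (cases "b \<in> B")
        case True
        show ?thesis
        proof (rule detect)
          fix x assume "x \<in> P"
          then obtain y s where y: "y \<in> S" "s \<in> carrier \<Gamma>" "x = point_act s y" using orbit by blast
          have "eval_at x \<alpha> = gact s (eval_at y \<alpha>)"
            unfolding y(3) using y S \<alpha>(1) by (intro eval_at_point_act) (auto simp: Q_def P_def)
          also have "\<dots> = 0" using \<alpha>(2) y by (simp add: gact_simps)
          finally show "x (\<alpha> b) = 0"
            using eval_at_eq_0_iff[OF equivariant_in_maps[OF \<alpha>(1)]] True by blast
        qed
      next
        case False
        then show ?thesis using equivariant_in_maps[OF \<alpha>(1)] coeff_ideal_closed(1) by (simp add: maps_def)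
      qed
    qed
  qed
qed

end

end

section \<open>Tensor product representations in coordinates\<close>

text \<open>Exchanging the index at \<open>x\<close> with the summation index \<open>m\<close> is an involution; it turns matrices acting on
  basis vectors into matrices acting on coordinates.\<close>

lemma sum_update_swap:
  fixes f :: "('x \<Rightarrow> nat) \<Rightarrow> nat \<Rightarrow> 'z::comm_monoid_add"
  assumes x: "x \<in> S" and S: "finite S"
  shows "(\<Sum>i\<in>PiE S (\<lambda>x. {..<n x}). \<Sum>m<n x. f i m) =
    (\<Sum>i\<in>PiE S (\<lambda>x. {..<n x}). \<Sum>m<n x. f (i(x := m)) (i x))"
proof -
  let ?J = "PiE S (\<lambda>x. {..<n x})"
  have up: "i(x := m) \<in> ?J" if "i \<in> ?J" "m < n x" for i m
    using that x by (auto simp: PiE_iff extensional_def)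
  have lt: "i x < n x" if "i \<in> ?J" for i using that x by auto
  show ?thesis
    unfolding sum.cartesian_product
  proof (rule sum.reindex_bij_witness[of _ "\<lambda>(i, m). (i(x := m), i x)" "\<lambda>(i, m). (i(x := m), i x)"])
    fix p assume "p \<in> ?J \<times> {..<n x}"
    then obtain i m where p: "p = (i, m)" "i \<in> ?J" "m < n x" by auto
    show "(case p of (i, m) \<Rightarrow> (i(x := m), i x)) \<in> ?J \<times> {..<n x}"
      "(case p of (i, m) \<Rightarrow> (i(x := m), i x)) \<in> ?J \<times> {..<n x}"
      using up[OF p(2,3)] lt[OF p(2)] p(1) by simp_all
    show "(case case p of (i, m) \<Rightarrow> (i(x := m), i x) of (i, m) \<Rightarrow> (i(x := m), i x)) = p"
      "(case case p of (i, m) \<Rightarrow> (i(x := m), i x) of (i, m) \<Rightarrow> (i(x := m), i x)) = p"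
      "(case case p of (i, m) \<Rightarrow> (i(x := m), i x) of (i, m) \<Rightarrow> f (i(x := m)) (i x)) =
        (case p of (i, m) \<Rightarrow> f i m)"
      using p(1) by simp_all
  qed
qed

text \<open>The vectors that differ in the index at \<open>x\<close> only are independent, so matrices are determined by their
  action on them.\<close>

lemma tensor_basis_coeff_zero:
  fixes S :: "'x set" and G :: "'x \<Rightarrow> 'l set"
    and V :: "('i \<Rightarrow> 'k::{alg_closed_field, field_char_0}) set"
  assumes tb: "coord.tensor_basis S G \<sigma> V n e a" and S: "finite S" and x: "x \<in> S"
    and i: "i \<in> PiE S (\<lambda>x. {..<n x})"
    and 0: "(\<Sum>m<n x. coord_scale (c m) (e (i(x := m)))) = 0" and m: "m < n x"
  shows "c m = 0"
proof -
  let ?J = "PiE S (\<lambda>x. {..<n x})"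
  let ?I = "(\<lambda>m. i(x := m)) ` {..<n x}"
  have finJ: "finite ?J" using S by (intro finite_PiE) auto
  have IJ: "?I \<subseteq> ?J" using i x by (auto simp: PiE_iff extensional_def)
  define d where "d j = (if j \<in> ?I then c (j x) else 0)" for j
  have "(\<Sum>j\<in>?J. coord_scale (d j) (e j)) = (\<Sum>j\<in>?I. coord_scale (d j) (e j))"
    using finJ IJ by (intro sum.mono_neutral_right) (auto simp: d_def)
  also have "\<dots> = (\<Sum>m<n x. coord_scale (d (i(x := m))) (e (i(x := m))))"
    by (rule sum.reindex_cong[of "\<lambda>m. i(x := m)"]) (auto simp: inj_on_def fun_eq_iff split: if_splits)
  also have "\<dots> = 0" using 0 by (simp add: d_def)
  finally have "\<forall>j\<in>?J. d j = 0" using tb unfolding coord.tensor_basis_def by blast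
  then have "d (i(x := m)) = 0" using IJ m by blast
  then show ?thesis using m by (simp add: d_def)
qed

definition matrix_rep :: "('x \<Rightarrow> nat) \<Rightarrow> ('x \<Rightarrow> 'l \<Rightarrow> nat \<Rightarrow> nat \<Rightarrow> 'k::field) \<Rightarrow> 'x \<Rightarrow> 'l \<Rightarrow> (nat \<Rightarrow> 'k) \<Rightarrow> nat \<Rightarrow> 'k"
  where "matrix_rep n a x u v = (\<lambda>m. if m < n x then \<Sum>l<n x. a x u m l * v l else 0)"

text \<open>The identities for \<open>\<sigma> x\<close> hold on the basis vectors with a fixed multi-index away from \<open>x\<close>; comparing coefficients
  gives the identities for the matrices.\<close>

lemma matrix_rep_lie_rep:
  fixes S :: "'x set" and G :: "'x \<Rightarrow> 'l::ab_group_add set"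
    and V :: "('i \<Rightarrow> 'k::{alg_closed_field, field_char_0}) set"
  assumes tb: "coord.tensor_basis S G \<sigma> V n e a" and S: "finite S" and x: "x \<in> S"
    and J: "PiE S (\<lambda>x. {..<n x}) \<noteq> {}"
    and lin: "\<And>u. u \<in> G x \<Longrightarrow> coord.linear_op (\<sigma> x u)"
    and G: "\<And>u w. u \<in> G x \<Longrightarrow> w \<in> G x \<Longrightarrow> u + w \<in> G x" "\<And>c u. u \<in> G x \<Longrightarrow> scale c u \<in> G x"
      "\<And>u w. u \<in> G x \<Longrightarrow> w \<in> G x \<Longrightarrow> bracket u w \<in> G x"
    and \<sigma>: "\<And>u w v. u \<in> G x \<Longrightarrow> w \<in> G x \<Longrightarrow> \<sigma> x (u + w) v = \<sigma> x u v + \<sigma> x w v"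
      "\<And>c u v. u \<in> G x \<Longrightarrow> \<sigma> x (scale c u) v = coord_scale c (\<sigma> x u v)"
      "\<And>u w v. u \<in> G x \<Longrightarrow> w \<in> G x \<Longrightarrow> \<sigma> x (bracket u w) v = \<sigma> x u (\<sigma> x w v) - \<sigma> x w (\<sigma> x u v)"
  shows "lie_rep scale bracket (G x) {..<n x} (matrix_rep n a x)"
proof -
  let ?J = "PiE S (\<lambda>x. {..<n x})"
  obtain i0 where i0: "i0 \<in> ?J" using J by blast
  have act: "\<sigma> x u (e (i0(x := l))) = (\<Sum>m<n x. coord_scale (a x u m l) (e (i0(x := m))))"
    if "u \<in> G x" "l < n x" for u l
  proof -
    have "i0(x := l) \<in> ?J" using i0 x that by (auto simp: PiE_iff extensional_def)
    then have "\<sigma> x u (e (i0(x := l))) =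
        (\<Sum>m<n x. coord_scale (a x u m ((i0(x := l)) x)) (e ((i0(x := l))(x := m))))"
      using tb x that unfolding coord.tensor_basis_def by blast
    then show ?thesis by simp
  qed
  have coeff: "c m = d m"
    if "(\<Sum>m<n x. coord_scale (c m) (e (i0(x := m)))) = (\<Sum>m<n x. coord_scale (d m) (e (i0(x := m))))" "m < n x" for c d m
  proof -
    have "(\<Sum>m<n x. coord_scale (c m - d m) (e (i0(x := m)))) = 0"
      using that(1) by (simp add: coord.scale_left_diff_distrib sum_subtractf)
    from tensor_basis_coeff_zero[OF tb S x i0 this that(2)] show ?thesis by simp
  qed
  have a_add: "a x (u + w) m l = a x u m l + a x w m l"
    if "u \<in> G x" "w \<in> G x" "m < n x" "l < n x" for u w m l
  proof (rule coeff[of "\<lambda>m. a x (u + w) m l" "\<lambda>m. a x u m l + a x w m l"])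
    show "(\<Sum>m<n x. coord_scale (a x (u + w) m l) (e (i0(x := m)))) =
       (\<Sum>m<n x. coord_scale (a x u m l + a x w m l) (e (i0(x := m))))"
      using \<sigma>(1)[of u w "e (i0(x := l))"] that G(1)
      by (simp add: act coord.scale_left_distrib sum.distrib)
  qed (rule that)
  have a_scale: "a x (scale c u) m l = c * a x u m l" if "u \<in> G x" "m < n x" "l < n x" for c u m l
  proof (rule coeff[of "\<lambda>m. a x (scale c u) m l" "\<lambda>m. c * a x u m l"])
    show "(\<Sum>m<n x. coord_scale (a x (scale c u) m l) (e (i0(x := m)))) =
       (\<Sum>m<n x. coord_scale (c * a x u m l) (e (i0(x := m))))"
      using \<sigma>(2)[of u c "e (i0(x := l))"] that G(2)
      by (simp add: act coord.scale_sum_right)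
  qed (rule that)
  have comp: "\<sigma> x u (\<sigma> x w (e (i0(x := l)))) =
      (\<Sum>m<n x. coord_scale (\<Sum>p<n x. a x u m p * a x w p l) (e (i0(x := m))))"
    if "u \<in> G x" "w \<in> G x" "l < n x" for u w l
  proof -
    have "\<sigma> x u (\<sigma> x w (e (i0(x := l)))) =
      (\<Sum>p<n x. coord_scale (a x w p l) (\<Sum>m<n x. coord_scale (a x u m p) (e (i0(x := m)))))"
      using that by (simp add: act coord.linear_op_simps[OF lin])
    also have "\<dots> = (\<Sum>m<n x. \<Sum>p<n x. coord_scale (a x u m p * a x w p l) (e (i0(x := m))))"
      unfolding coord.scale_sum_right coord.scale_scale by (subst sum.swap) (simp add: mult.commute)
    finally show ?thesis by (simp add: coord.scale_sum_left)
  qed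
  have a_bracket: "a x (bracket u w) m l = (\<Sum>p<n x. a x u m p * a x w p l) - (\<Sum>p<n x. a x w m p * a x u p l)"
    if "u \<in> G x" "w \<in> G x" "m < n x" "l < n x" for u w m l
  proof (rule coeff[of "\<lambda>m. a x (bracket u w) m l"
        "\<lambda>m. (\<Sum>p<n x. a x u m p * a x w p l) - (\<Sum>p<n x. a x w m p * a x u p l)"])
    show "(\<Sum>m<n x. coord_scale (a x (bracket u w) m l) (e (i0(x := m)))) =
       (\<Sum>m<n x. coord_scale ((\<Sum>p<n x. a x u m p * a x w p l) - (\<Sum>p<n x. a x w m p * a x u p l)) (e (i0(x := m))))"
      unfolding act[OF G(3)[OF that(1,2)] that(4), symmetric] \<sigma>(3)[OF that(1,2)]
        comp[OF that(1,2,4)] comp[OF that(2,1,4)]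
      by (simp add: coord.scale_left_diff_distrib sum_subtractf)
  qed (rule that)
  have mm: "(\<Sum>l<n x. a x u m l * matrix_rep n a x w v l) = (\<Sum>l<n x. (\<Sum>p<n x. a x u m p * a x w p l) * v l)" for u w v m
  proof -
    have "(\<Sum>l<n x. a x u m l * matrix_rep n a x w v l) = (\<Sum>p<n x. \<Sum>l<n x. a x u m p * a x w p l * v l)"
      by (intro sum.cong) (auto simp: matrix_rep_def sum_distrib_left mult.assoc)
    also have "\<dots> = (\<Sum>l<n x. (\<Sum>p<n x. a x u m p * a x w p l) * v l)"
      by (subst sum.swap) (simp add: sum_distrib_right)
    finally show ?thesis .
  qed
  show ?thesis
    unfolding lie_rep_def
  proof (intro conjI ballI allI)
    fix u w assume u: "u \<in> G x" and w: "w \<in> G x"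
    fix v :: "nat \<Rightarrow> 'k"
    show "matrix_rep n a x (u + w) v = matrix_rep n a x u v + matrix_rep n a x w v"
      using u w by (auto simp: matrix_rep_def fun_eq_iff a_add distrib_right sum.distrib)
    show "matrix_rep n a x (bracket u w) v =
        matrix_rep n a x u (matrix_rep n a x w v) - matrix_rep n a x w (matrix_rep n a x u v)"
    proof
      fix m
      show "matrix_rep n a x (bracket u w) v m =
        (matrix_rep n a x u (matrix_rep n a x w v) - matrix_rep n a x w (matrix_rep n a x u v)) m"
      proof (cases "m < n x")
        case True
        have "matrix_rep n a x (bracket u w) v m = (\<Sum>l<n x. a x (bracket u w) m l * v l)"
          using True by (simp add: matrix_rep_def)
        also have "\<dots> = (\<Sum>l<n x. (\<Sum>p<n x. a x u m p * a x w p l) * v l) - (\<Sum>l<n x. (\<Sum>p<n x. a x w m p * a x u p l) * v l)"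
          using True u w by (simp add: a_bracket left_diff_distrib sum_subtractf)
        also have "\<dots> = (\<Sum>l<n x. a x u m l * matrix_rep n a x w v l) - (\<Sum>l<n x. a x w m l * matrix_rep n a x u v l)"
          by (simp only: mm)
        also have "\<dots> = (matrix_rep n a x u (matrix_rep n a x w v) - matrix_rep n a x w (matrix_rep n a x u v)) m"
          using True by (simp add: matrix_rep_def[of n a x u "matrix_rep n a x w v"] matrix_rep_def[of n a x w "matrix_rep n a x u v"])
        finally show ?thesis .
      qed (simp add: matrix_rep_def)
    qed
  next
    fix c u v assume u: "u \<in> G x"
    show "matrix_rep n a x (scale c u) v = coord_scale c (matrix_rep n a x u v)"
      using u by (auto simp: matrix_rep_def coord_scale_def fun_eq_iff a_scale sum_distrib_left mult.assoc)
  next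
    fix u
    show "linear_on {..<n x} {..<n x} (matrix_rep n a x u)"
      unfolding linear_on_def
    proof (intro conjI ballI allI ext)
      show "matrix_rep n a x u v \<in> coord_space {..<n x}" for v
        by (simp add: coord_space_def matrix_rep_def)
      show "matrix_rep n a x u (v + w) m = (matrix_rep n a x u v + matrix_rep n a x u w) m" for v w m
        by (simp add: matrix_rep_def distrib_left sum.distrib)
      show "matrix_rep n a x u (coord_scale c v) m = coord_scale c (matrix_rep n a x u v) m" for c v m
        by (simp add: matrix_rep_def coord_scale_def sum_distrib_left mult.left_commute)
    qed
  qed
qed

lemma tensor_basis_isomorphic:
  fixes S :: "'x set" and G :: "'x \<Rightarrow> 'l set" and \<rho> :: "'m \<Rightarrow> (nat \<Rightarrow> 'k) \<Rightarrow> nat \<Rightarrow> 'k::{alg_closed_field, field_char_0}"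
  assumes tb: "coord.tensor_basis S G \<sigma> (coord_space {..<N}) n e a" and S: "finite S"
    and lin: "\<And>x u. x \<in> S \<Longrightarrow> u \<in> G x \<Longrightarrow> coord.linear_op (\<sigma> x u)"
    and ev: "\<And>\<alpha> x. \<alpha> \<in> L \<Longrightarrow> x \<in> S \<Longrightarrow> ev \<alpha> x \<in> G x"
    and \<rho>: "\<And>\<alpha> v. \<alpha> \<in> L \<Longrightarrow> v \<in> coord_space {..<N} \<Longrightarrow> \<rho> \<alpha> v = (\<Sum>x\<in>S. \<sigma> x (ev \<alpha> x) v)"
  shows "isomorphic_reps L {..<N} \<rho> (PiE S (\<lambda>x. {..<n x}))
    (\<lambda>\<alpha>. tensor_rep S (\<lambda>x. {..<n x}) (matrix_rep n a) (ev \<alpha>))"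
proof -
  let ?J = "PiE S (\<lambda>x. {..<n x})"
  let ?V = "coord_space {..<N} :: (nat \<Rightarrow> 'k) set"
  have finJ: "finite ?J" using S by (intro finite_PiE) auto
  define \<Phi> where "\<Phi> c = (\<Sum>i\<in>?J. coord_scale (c i) (e i))" for c
  have eV: "e i \<in> ?V" if "i \<in> ?J" for i using tb that unfolding coord.tensor_basis_def by blast
  have \<Phi>V: "\<Phi> c \<in> ?V" for c
    unfolding \<Phi>_def by (intro coord.subspace_sum coord_space_subspace coord.subspace_scale eV)
  have \<Phi>_add: "\<Phi> (c + d) = \<Phi> c + \<Phi> d" for c d
    by (simp add: \<Phi>_def coord.scale_left_distrib sum.distrib)
  have \<Phi>_scale: "\<Phi> (coord_scale k c) = coord_scale k (\<Phi> c)" for k c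
    by (simp add: \<Phi>_def coord.scale_sum_right) (simp add: coord_scale_def)
  have inj: "inj_on \<Phi> (coord_space ?J)"
  proof (rule inj_onI)
    fix c d assume cd: "c \<in> coord_space ?J" "d \<in> coord_space ?J" "\<Phi> c = \<Phi> d"
    have "(\<Sum>i\<in>?J. coord_scale (c i - d i) (e i)) = 0"
      using cd(3) by (simp add: \<Phi>_def coord.scale_left_diff_distrib sum_subtractf)
    then have "c i - d i = 0" if "i \<in> ?J" for i
      using tb[unfolded coord.tensor_basis_def, THEN conjunct2, THEN conjunct1, rule_format,
          of "\<lambda>i. c i - d i"] that by simp
    then have "c i = d i" for i
      using cd(1,2) by (cases "i \<in> ?J") (auto simp: coord_space_def)
    then show "c = d" by blast
  qed
  have img: "\<Phi> ` coord_space ?J = ?V"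
  proof (intro equalityI subsetI)
    fix v assume "v \<in> ?V"
    then have "v \<in> coord.span (e ` ?J)" using tb unfolding coord.tensor_basis_def by blast
    then obtain c where c: "v = (\<Sum>i\<in>?J. coord_scale (c i) (e i))"
      using coord.in_span_imageE[OF finJ] by blast
    define d where "d i = (if i \<in> ?J then c i else 0)" for i
    have "v = \<Phi> d" unfolding c \<Phi>_def by (intro sum.cong) (auto simp: d_def)
    moreover have "d \<in> coord_space ?J" by (auto simp: d_def coord_space_def)
    ultimately show "v \<in> \<Phi> ` coord_space ?J" by blast
  qed (use \<Phi>V in auto)
  have bij: "bij_betw \<Phi> (coord_space ?J) ?V" using inj img by (simp add: bij_betw_def)
  define \<Psi> where "\<Psi> = the_inv_into (coord_space ?J) \<Phi>"
  have \<Psi>bij: "bij_betw \<Psi> ?V (coord_space ?J)"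
    unfolding \<Psi>_def by (rule bij_betw_the_inv_into[OF bij])
  have \<Psi>: "\<Psi> v \<in> coord_space ?J" "\<Phi> (\<Psi> v) = v" if "v \<in> ?V" for v
    using \<Psi>bij that f_the_inv_into_f[OF inj, of v] img by (auto simp: bij_betw_def \<Psi>_def)
  have \<Psi>\<Phi>: "\<Psi> (\<Phi> c) = c" if "c \<in> coord_space ?J" for c
    unfolding \<Psi>_def by (rule the_inv_into_f_f[OF inj that])
  have act: "\<rho> \<alpha> (\<Phi> c) = \<Phi> (tensor_rep S (\<lambda>x. {..<n x}) (matrix_rep n a) (ev \<alpha>) c)" if \<alpha>: "\<alpha> \<in> L" for \<alpha> c
  proof -
    have one: "\<sigma> x (ev \<alpha> x) (\<Phi> c) =
        (\<Sum>i\<in>?J. coord_scale (\<Sum>l<n x. a x (ev \<alpha> x) (i x) l * c (i(x := l))) (e i))" if x: "x \<in> S" for x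
    proof -
      let ?u = "ev \<alpha> x"
      have u: "?u \<in> G x" using ev \<alpha> x by blast
      have "\<sigma> x ?u (\<Phi> c) = (\<Sum>i\<in>?J. coord_scale (c i) (\<sigma> x ?u (e i)))"
        unfolding \<Phi>_def by (simp add: coord.linear_op_simps[OF lin[OF x u]])
      also have "\<dots> = (\<Sum>i\<in>?J. \<Sum>m<n x. coord_scale (c i * a x ?u m (i x)) (e (i(x := m))))"
        using tb x u unfolding coord.tensor_basis_def
        by (intro sum.cong refl) (simp add: coord.scale_sum_right)
      also have "\<dots> = (\<Sum>i\<in>?J. \<Sum>m<n x. coord_scale (c (i(x := m)) * a x ?u (i x) m) (e i))"
        by (subst sum_update_swap[OF x S]) simp
      also have "\<dots> = (\<Sum>i\<in>?J. coord_scale (\<Sum>l<n x. a x ?u (i x) l * c (i(x := l))) (e i))"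
        by (simp add: coord.scale_sum_left mult.commute)
      finally show ?thesis .
    qed
    have "\<rho> \<alpha> (\<Phi> c) = (\<Sum>x\<in>S. \<Sum>i\<in>?J. coord_scale (\<Sum>l<n x. a x (ev \<alpha> x) (i x) l * c (i(x := l))) (e i))"
      using \<rho>[OF \<alpha> \<Phi>V] one by simp
    also have "\<dots> = (\<Sum>i\<in>?J. coord_scale (\<Sum>x\<in>S. \<Sum>l<n x. a x (ev \<alpha> x) (i x) l * c (i(x := l))) (e i))"
      by (subst sum.swap) (simp add: coord.scale_sum_left)
    also have "\<dots> = \<Phi> (tensor_rep S (\<lambda>x. {..<n x}) (matrix_rep n a) (ev \<alpha>) c)"
    proof -
      have "(\<Sum>l<n x. a x (ev \<alpha> x) (i x) l * c (i(x := l))) = matrix_rep n a x (ev \<alpha> x) (\<lambda>m. c (i(x := m))) (i x)"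
        if "i \<in> ?J" "x \<in> S" for i x
        using PiE_mem[OF that] by (simp add: matrix_rep_def)
      then show ?thesis unfolding \<Phi>_def tensor_rep_def by (intro sum.cong refl) simp
    qed
    finally show ?thesis .
  qed
  show ?thesis
    unfolding isomorphic_reps_def
  proof (intro exI[of _ \<Psi>] conjI ballI)
    show "bij_betw \<Psi> ?V (coord_space ?J)" by (rule \<Psi>bij)
    show "linear_on {..<N} ?J \<Psi>"
      unfolding linear_on_def
    proof (intro conjI ballI allI)
      fix v w c assume v: "v \<in> ?V"
      show "\<Psi> v \<in> coord_space ?J" using \<Psi>(1)[OF v] .
      have "coord_scale c (\<Psi> v) \<in> coord_space ?J"
        using \<Psi>(1)[OF v] by (auto simp: coord_space_def coord_scale_def)
      then show "\<Psi> (coord_scale c v) = coord_scale c (\<Psi> v)"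
        using \<Psi>\<Phi>[of "coord_scale c (\<Psi> v)"] \<Psi>(2)[OF v] by (simp add: \<Phi>_scale)
    next
      fix v w assume v: "v \<in> ?V" and w: "w \<in> ?V"
      have "\<Psi> v + \<Psi> w \<in> coord_space ?J"
        using \<Psi>(1)[OF v] \<Psi>(1)[OF w] by (auto simp: coord_space_def)
      then show "\<Psi> (v + w) = \<Psi> v + \<Psi> w"
        using \<Psi>\<Phi>[of "\<Psi> v + \<Psi> w"] \<Psi>(2)[OF v] \<Psi>(2)[OF w] by (simp add: \<Phi>_add)
    qed
    fix \<alpha> v assume \<alpha>: "\<alpha> \<in> L" and v: "v \<in> ?V"
    let ?t = "tensor_rep S (\<lambda>x. {..<n x}) (matrix_rep n a) (ev \<alpha>) (\<Psi> v)"
    have "?t \<in> coord_space ?J" by (auto simp: coord_space_def tensor_rep_def)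
    then show "\<Psi> (\<rho> \<alpha> v) = ?t"
      using act[OF \<alpha>, of "\<Psi> v"] \<Psi>(2)[OF v] \<Psi>\<Phi> by simp
  qed
qed

section \<open>Irreducible representations as evaluation representations\<close>

text \<open>The projection of all sequences onto \<open>k\<^sup>n\<close>.  Composed with it, the operators of a representation become linear on the
  whole type and their values outside \<open>k\<^sup>n\<close> become determined.\<close>

definition truncate :: "nat \<Rightarrow> (nat \<Rightarrow> 'k::zero) \<Rightarrow> nat \<Rightarrow> 'k"
  where "truncate n v = (\<lambda>i. if i < n then v i else 0)"

lemma truncate_simps:
  fixes v w :: "nat \<Rightarrow> 'k::field"
  shows "truncate n v \<in> coord_space {..<n}" "v \<in> coord_space {..<n} \<Longrightarrow> truncate n v = v"
    "truncate n (v + w) = truncate n v + truncate n w"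
    "truncate n (coord_scale c v) = coord_scale c (truncate n v)"
  by (auto simp: truncate_def coord_space_def coord_scale_def fun_eq_iff)

definition operator_trace :: "nat \<Rightarrow> ((nat \<Rightarrow> 'k::field) \<Rightarrow> nat \<Rightarrow> 'k) \<Rightarrow> 'k"
  where "operator_trace n T = (\<Sum>i<n. T (unit_vec i) i)"

lemma operator_trace_commute:
  fixes S T :: "(nat \<Rightarrow> 'k::{alg_closed_field, field_char_0}) \<Rightarrow> nat \<Rightarrow> 'k"
  assumes "coord.linear_op S" "coord.linear_op T"
    and "\<And>v. S v \<in> coord_space {..<n}" "\<And>v. T v \<in> coord_space {..<n}"
  shows "operator_trace n (\<lambda>v. S (T v)) = operator_trace n (\<lambda>v. T (S v))"
proof -
  have *: "S (T v) i = (\<Sum>j<n. T v j * S (unit_vec j) i)"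
    if "coord.linear_op S" "\<And>v. T v \<in> coord_space {..<n}" for S T :: "(nat \<Rightarrow> 'k) \<Rightarrow> nat \<Rightarrow> 'k" and v i
  proof -
    have "S (T v) = S (\<Sum>j<n. coord_scale (T v j) (unit_vec j))"
      using coord_eq_sum_unit_vec[of "{..<n}" "T v"] that(2) by simp
    then show ?thesis
      by (simp add: coord.linear_op_simps[OF that(1)] fun_sum_apply) (simp add: coord_scale_def)
  qed
  have "operator_trace n (\<lambda>v. S (T v)) = (\<Sum>i<n. \<Sum>j<n. T (unit_vec i) j * S (unit_vec j) i)"
    unfolding operator_trace_def by (simp add: *[OF assms(1), of T] assms(4))
  also have "\<dots> = (\<Sum>j<n. \<Sum>i<n. S (unit_vec j) i * T (unit_vec i) j)"
    by (subst sum.swap) (simp add: mult.commute)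
  also have "\<dots> = operator_trace n (\<lambda>v. T (S v))"
    unfolding operator_trace_def by (simp add: *[OF assms(2), of S] assms(3))
  finally show ?thesis .
qed

context char_0_equivariant_map_algebra
begin

lemma point_fixed_closed:
  "u \<in> point_fixed x \<Longrightarrow> w \<in> point_fixed x \<Longrightarrow> u + w \<in> point_fixed x"
  "u \<in> point_fixed x \<Longrightarrow> gscale c u \<in> point_fixed x"
  "u \<in> point_fixed x \<Longrightarrow> w \<in> point_fixed x \<Longrightarrow> gbracket u w \<in> point_fixed x"
  by (auto simp: point_fixed_def stabilizer_def gact_simps gact_bracket)

context
  fixes n :: nat and \<rho> :: "('g \<Rightarrow> 'a) \<Rightarrow> (nat \<Rightarrow> 'k) \<Rightarrow> nat \<Rightarrow> 'k"
  assumes irr: "irreducible_rep map_scale map_bracket \<MM> {..<n} \<rho>"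
begin

abbreviation (input) rep_space :: "(nat \<Rightarrow> 'k) set" where "rep_space \<equiv> coord_space {..<n}"

definition rep_op :: "('g \<Rightarrow> 'a) \<Rightarrow> (nat \<Rightarrow> 'k) \<Rightarrow> nat \<Rightarrow> 'k"
  where "rep_op \<alpha> v = \<rho> \<alpha> (truncate n v)"

lemma is_lie_rep: "lie_rep map_scale map_bracket \<MM> {..<n} \<rho>"
  using irr by (simp add: irreducible_rep_def)

lemma rep_op_simps:
  assumes "\<alpha> \<in> \<MM>"
  shows "rep_op \<alpha> v \<in> rep_space" "rep_op \<alpha> (v + w) = rep_op \<alpha> v + rep_op \<alpha> w" "rep_op \<alpha> (coord_scale c v) = coord_scale c (rep_op \<alpha> v)"
    "rep_op (map_scale c \<alpha>) v = coord_scale c (rep_op \<alpha> v)"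
    "\<beta> \<in> \<MM> \<Longrightarrow> rep_op (\<alpha> + \<beta>) v = rep_op \<alpha> v + rep_op \<beta> v"
    "\<beta> \<in> \<MM> \<Longrightarrow> rep_op (map_bracket \<alpha> \<beta>) v = rep_op \<alpha> (rep_op \<beta> v) - rep_op \<beta> (rep_op \<alpha> v)"
    "coord.linear_op (rep_op \<alpha>)"
proof -
  have T: "truncate n v \<in> rep_space" "truncate n w \<in> rep_space" for v w :: "nat \<Rightarrow> 'k" by (simp_all add: truncate_simps)
  have lin: "linear_on {..<n} {..<n} (\<rho> \<gamma>)" if "\<gamma> \<in> \<MM>" for \<gamma>
    using is_lie_rep that by (auto simp: lie_rep_def)
  have rep_space: "rep_op \<gamma> v \<in> rep_space" if "\<gamma> \<in> \<MM>" for \<gamma> v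
    using lin[OF that] T by (simp add: rep_op_def linear_on_def)
  show "rep_op \<alpha> v \<in> rep_space" by (rule rep_space[OF assms])
  have add: "rep_op \<alpha> (v + w) = rep_op \<alpha> v + rep_op \<alpha> w" for v w
    using lin[OF assms] T by (simp add: rep_op_def linear_on_def truncate_simps)
  have scale: "rep_op \<alpha> (coord_scale c v) = coord_scale c (rep_op \<alpha> v)" for c v
    using lin[OF assms] T by (simp add: rep_op_def linear_on_def truncate_simps)
  show "rep_op \<alpha> (v + w) = rep_op \<alpha> v + rep_op \<alpha> w" "rep_op \<alpha> (coord_scale c v) = coord_scale c (rep_op \<alpha> v)"
    by (fact add scale)+
  show "coord.linear_op (rep_op \<alpha>)"
    by (simp add: Vector_Spaces.linear_iff coord_vector_space add scale)
  show "rep_op (map_scale c \<alpha>) v = coord_scale c (rep_op \<alpha> v)"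
    using is_lie_rep assms T by (simp add: lie_rep_def rep_op_def)
  show "rep_op (\<alpha> + \<beta>) v = rep_op \<alpha> v + rep_op \<beta> v" if "\<beta> \<in> \<MM>"
    using is_lie_rep assms that T by (simp add: lie_rep_def rep_op_def)
  show "rep_op (map_bracket \<alpha> \<beta>) v = rep_op \<alpha> (rep_op \<beta> v) - rep_op \<beta> (rep_op \<alpha> v)" if "\<beta> \<in> \<MM>"
    using is_lie_rep assms that T truncate_simps(2)[OF rep_space[OF assms, unfolded rep_op_def]]
      truncate_simps(2)[OF rep_space[OF that, unfolded rep_op_def]]
    by (simp add: lie_rep_def rep_op_def)
qed

lemma rep_op_sum:
  assumes "\<And>i. i \<in> X \<Longrightarrow> f i \<in> \<MM>"
  shows "rep_op (\<Sum>i\<in>X. f i) v = (\<Sum>i\<in>X. rep_op (f i) v)"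
proof -
  have z: "0 \<in> \<MM>" using maps.subspace_0[OF equivariant_maps_subspace] .
  have "rep_op 0 v = 0" using rep_op_simps(4)[OF z, of 0 v] by simp
  then show ?thesis using assms
    by (induction X rule: infinite_finite_induct)
      (auto simp: rep_op_simps(5) maps.subspace_sum[OF equivariant_maps_subspace])
qed

lemma rep_op_eq_rep: "v \<in> rep_space \<Longrightarrow> rep_op \<alpha> v = \<rho> \<alpha> v"
  by (simp add: rep_op_def truncate_simps)

lemma rep_space_in_span: "rep_space \<subseteq> coord.span (unit_vec ` {..<n})"
  by (rule coord_space_in_span) simp

lemma n_pos: "0 < n"
proof (rule ccontr)
  assume "\<not> 0 < n"
  then have "rep_space = {0}" by (auto simp: coord_space_def fun_eq_iff)
  then show False using irr by (simp add: irreducible_rep_def)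
qed

lemma rep_op_irreducible: "coord.irreducible_under (rep_op ` \<MM>) rep_space"
  unfolding coord.irreducible_under_def
proof (intro conjI allI impI)
  show "coord.subspace rep_space" by (rule coord_space_subspace)
  show "rep_space \<noteq> {0}" using irr by (simp add: irreducible_rep_def)
  show "coord.invariant_under (rep_op ` \<MM>) rep_space"
    using rep_op_simps(1) by (auto simp: coord.invariant_under_def)
  fix W assume W: "coord.subspace W" "W \<subseteq> rep_space" "coord.invariant_under (rep_op ` \<MM>) W"
  have "\<rho> \<alpha> w \<in> W" if "\<alpha> \<in> \<MM>" "w \<in> W" for \<alpha> w
  proof -
    have "rep_op \<alpha> w \<in> W" using W(3) that by (auto simp: coord.invariant_under_def)
    moreover have "w \<in> rep_space" using W(2) that by blast
    ultimately show ?thesis by (simp add: rep_op_eq_rep)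
  qed
  then show "W = {0} \<or> W = rep_space"
    using irr W(1,2) unfolding irreducible_rep_def by blast
qed

definition acts_by_scalar :: "('g \<Rightarrow> 'a) set"
  where "acts_by_scalar = {\<alpha> \<in> \<MM>. \<exists>c. \<forall>v\<in>rep_space. rep_op \<alpha> v = coord_scale c v}"

lemma unit_vec_in_rep_space: "i < n \<Longrightarrow> unit_vec i \<in> rep_space"
  by (simp add: unit_vec_def coord_space_def)

lemma trace_scalar:
  assumes "\<And>v. v \<in> rep_space \<Longrightarrow> rep_op \<alpha> v = coord_scale c v"
  shows "operator_trace n (rep_op \<alpha>) = of_nat n * c"
proof -
  have "operator_trace n (rep_op \<alpha>) = (\<Sum>i<n. c)"
    unfolding operator_trace_def using assms[OF unit_vec_in_rep_space]
    by (intro sum.cong) (auto simp: coord_scale_def unit_vec_def)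
  then show ?thesis by simp
qed

lemma trace_derived:
  assumes "\<alpha> \<in> lie_derived map_scale map_bracket \<MM>"
  shows "operator_trace n (rep_op \<alpha>) = 0"
proof -
  let ?Z = "{\<alpha> \<in> \<MM>. operator_trace n (rep_op \<alpha>) = 0}"
  have "maps.subspace ?Z"
  proof (rule maps.subspaceI)
    have z: "0 \<in> \<MM>" using maps.subspace_0[OF equivariant_maps_subspace] .
    then show "0 \<in> ?Z" using rep_op_sum[of "{}" "\<lambda>_. 0"] by (simp add: operator_trace_def)
  qed (auto simp: operator_trace_def rep_op_simps sum.distrib coord_scale_def sum_distrib_left[symmetric]
      maps.subspace_add[OF equivariant_maps_subspace] maps.subspace_scale[OF equivariant_maps_subspace])
  moreover have "map_bracket \<alpha> \<beta> \<in> ?Z" if "\<alpha> \<in> \<MM>" "\<beta> \<in> \<MM>" for \<alpha> \<beta>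
  proof -
    have "operator_trace n (rep_op (map_bracket \<alpha> \<beta>)) =
        operator_trace n (\<lambda>v. rep_op \<alpha> (rep_op \<beta> v)) - operator_trace n (\<lambda>v. rep_op \<beta> (rep_op \<alpha> v))"
      using that by (simp add: operator_trace_def rep_op_simps sum_subtractf)
    also have "\<dots> = 0"
      using operator_trace_commute[of "rep_op \<alpha>" "rep_op \<beta>" n] that rep_op_simps(1,7) by simp
    finally show ?thesis using equivariant_bracket that by simp
  qed
  ultimately have "maps.span {map_bracket \<alpha> \<beta> | \<alpha> \<beta>. \<alpha> \<in> \<MM> \<and> \<beta> \<in> \<MM>} \<subseteq> ?Z"
    by (intro maps.span_minimal) auto
  then show ?thesis using assms by (auto simp: lie_derived_def)
qed

lemma scalar_derived_is_zero:
  assumes "\<alpha> \<in> acts_by_scalar" "\<alpha> \<in> lie_derived map_scale map_bracket \<MM>"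
  shows "rep_op \<alpha> v = 0"
proof -
  obtain c where c: "\<And>v. v \<in> rep_space \<Longrightarrow> rep_op \<alpha> v = coord_scale c v"
    using assms(1) by (auto simp: acts_by_scalar_def)
  have "of_nat n * c = 0" using trace_scalar[OF c] trace_derived[OF assms(2)] by simp
  then have "c = 0" using n_pos by simp
  moreover have "rep_op \<alpha> v = rep_op \<alpha> (truncate n v)"
    by (simp add: rep_op_def truncate_simps(2)[OF truncate_simps(1)])
  ultimately show ?thesis using c[of "truncate n v"] by (simp add: truncate_simps)
qed

text \<open>For \<open>\<beta> \<in> M\<close> the bracket \<open>[r \<alpha>, \<beta>] = [\<alpha>, r \<beta>]\<close> acts by the commutator of a scalar, hence by zero.  So \<open>r \<alpha>\<close>
  commutes with the irreducible action of \<open>M\<close>.\<close>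

lemma acts_by_scalar_amul:
  assumes r: "r \<in> invariant_functions" and \<alpha>: "\<alpha> \<in> acts_by_scalar"
  shows "amul r \<alpha> \<in> acts_by_scalar"
proof -
  have \<alpha>M: "\<alpha> \<in> \<MM>" using \<alpha> by (simp add: acts_by_scalar_def)
  obtain c where c: "\<And>v. v \<in> rep_space \<Longrightarrow> rep_op \<alpha> v = coord_scale c v"
    using \<alpha> by (auto simp: acts_by_scalar_def)
  have r\<alpha>: "amul r \<alpha> \<in> \<MM>" by (rule amul_equivariant[OF r \<alpha>M])
  have comm: "rep_op (amul r \<alpha>) (rep_op \<beta> v) = rep_op \<beta> (rep_op (amul r \<alpha>) v)" if "\<beta> \<in> \<MM>" "v \<in> rep_space" for \<beta> v
  proof -
    have r\<beta>: "amul r \<beta> \<in> \<MM>" by (rule amul_equivariant[OF r that(1)])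
    have "rep_op (amul r \<alpha>) (rep_op \<beta> v) - rep_op \<beta> (rep_op (amul r \<alpha>) v) = rep_op (map_bracket (amul r \<alpha>) \<beta>) v"
      using that r\<alpha> by (simp add: rep_op_simps)
    also have "map_bracket (amul r \<alpha>) \<beta> = map_bracket \<alpha> (amul r \<beta>)"
      by (simp add: amul_bracket)
    also have "rep_op \<dots> v = rep_op \<alpha> (rep_op (amul r \<beta>) v) - rep_op (amul r \<beta>) (rep_op \<alpha> v)"
      using \<alpha>M r\<beta> by (simp add: rep_op_simps)
    also have "\<dots> = 0" using c rep_op_simps(1)[OF r\<beta>] that by (simp add: rep_op_simps(3)[OF r\<beta>])
    finally show ?thesis by (simp only: right_minus_eq)
  qed
  have "\<exists>c. \<forall>v\<in>rep_space. rep_op (amul r \<alpha>) v = coord_scale c v"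
  proof (rule coord.schur[OF rep_op_irreducible _ rep_space_in_span])
    show "coord.linear_within rep_space (rep_op (amul r \<alpha>))"
      using rep_op_simps(1,7)[OF r\<alpha>] coord_space_subspace by (intro coord.linear_op_within) auto
  qed (use comm rep_op_simps(7) in auto)
  then show ?thesis using r\<alpha> by (simp add: acts_by_scalar_def)
qed

text \<open>A bracket of elements of \<open>N\<close> acts by a scalar and has trace zero, so \<open>N\<close> acts by commuting operators.\<close>

lemma acts_by_scalar_radical:
  assumes N: "maps.subspace N" "N \<subseteq> \<MM>"
    and ideal: "\<And>\<alpha> \<beta>. \<beta> \<in> \<MM> \<Longrightarrow> \<alpha> \<in> N \<Longrightarrow> map_bracket \<beta> \<alpha> \<in> N"
    and comm: "\<And>\<alpha> \<beta>. \<alpha> \<in> N \<Longrightarrow> \<beta> \<in> N \<Longrightarrow> map_bracket \<alpha> \<beta> \<in> acts_by_scalar"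
  shows "N \<subseteq> acts_by_scalar"
proof
  fix \<alpha> assume \<alpha>: "\<alpha> \<in> N"
  have "\<exists>c. \<forall>v\<in>rep_space. rep_op \<alpha> v = coord_scale c v"
  proof (rule coord.commuting_ideal_acts_by_scalars[OF rep_op_irreducible _ rep_space_in_span, of "rep_op ` N"])
    show "(\<lambda>v. X (T v) - T (X v)) \<in> rep_op ` N" if XT: "X \<in> rep_op ` \<MM>" "T \<in> rep_op ` N" for X T
    proof -
      obtain \<beta> \<gamma> where bg: "\<beta> \<in> \<MM>" "\<gamma> \<in> N" "X = rep_op \<beta>" "T = rep_op \<gamma>" using XT by blast
      then have "(\<lambda>v. X (T v) - T (X v)) = rep_op (map_bracket \<beta> \<gamma>)"
        using N(2) by (intro ext) (simp add: rep_op_simps subsetD)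
      then show ?thesis using ideal bg by blast
    qed
    show "T (T' v) = T' (T v)" if TT: "T \<in> rep_op ` N" "T' \<in> rep_op ` N" for T T' v
    proof -
      obtain \<beta> \<gamma> where bg: "\<beta> \<in> N" "\<gamma> \<in> N" "T = rep_op \<beta>" "T' = rep_op \<gamma>" using TT by blast
      have M: "\<beta> \<in> \<MM>" "\<gamma> \<in> \<MM>" using bg N(2) by auto
      have "map_bracket \<beta> \<gamma> \<in> lie_derived map_scale map_bracket \<MM>"
        unfolding lie_derived_def using M by (auto intro: maps.span_base)
      then have "rep_op (map_bracket \<beta> \<gamma>) v = 0"
        using scalar_derived_is_zero comm bg by blast
      then show ?thesis using M bg by (simp add: rep_op_simps)
    qed
  qed (use N(2) \<alpha> rep_op_simps(1,7) in auto)
  then show "\<alpha> \<in> acts_by_scalar" using \<alpha> N(2) by (auto simp: acts_by_scalar_def)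
qed

text \<open>A linear map into a finite-dimensional space whose kernel is \<open>acts_by_scalar\<close>: the off-diagonal matrix entries, and the
  differences of the diagonal entries to the first one.\<close>

definition scalar_defect :: "('g \<Rightarrow> 'a) \<Rightarrow> nat \<times> nat \<Rightarrow> 'k"
  where "scalar_defect \<alpha> = (\<lambda>(p, q). if p < n \<and> q < n
     then rep_op \<alpha> (unit_vec p) q - (if p = q then rep_op \<alpha> (unit_vec 0) 0 else 0) else 0)"

lemma acts_by_scalar_iff: "acts_by_scalar = {\<alpha> \<in> \<MM>. scalar_defect \<alpha> = 0}"
proof -
  have "(\<exists>c. \<forall>v\<in>rep_space. rep_op \<alpha> v = coord_scale c v) \<longleftrightarrow> scalar_defect \<alpha> = 0" if \<alpha>: "\<alpha> \<in> \<MM>" for \<alpha>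
  proof
    assume "\<exists>c. \<forall>v\<in>rep_space. rep_op \<alpha> v = coord_scale c v"
    then obtain c where "\<And>v. v \<in> rep_space \<Longrightarrow> rep_op \<alpha> v = coord_scale c v" by blast
    then have "rep_op \<alpha> (unit_vec p) = coord_scale c (unit_vec p)" if "p < n" for p
      using unit_vec_in_rep_space that by blast
    then show "scalar_defect \<alpha> = 0"
      using n_pos by (auto simp: scalar_defect_def fun_eq_iff coord_scale_def unit_vec_def)
  next
    assume z: "scalar_defect \<alpha> = 0"
    define c where "c = rep_op \<alpha> (unit_vec 0) 0"
    have "rep_op \<alpha> (unit_vec p) = coord_scale c (unit_vec p)" if p: "p < n" for p
    proof
      fix q
      have "rep_op \<alpha> (unit_vec p) q - (if p = q then c else 0) = 0" if "q < n"
        using fun_cong[OF z, of "(p, q)"] p that by (simp add: scalar_defect_def c_def)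
      moreover have "rep_op \<alpha> (unit_vec p) q = 0" if "\<not> q < n"
        using rep_op_simps(1)[OF \<alpha>] that by (simp add: coord_space_def)
      ultimately show "rep_op \<alpha> (unit_vec p) q = coord_scale c (unit_vec p) q"
        using p by (cases "q < n") (auto simp: coord_scale_def unit_vec_def)
    qed
    then have "rep_op \<alpha> v = coord_scale c v" if "v \<in> rep_space" for v
    proof -
      have "rep_op \<alpha> v = (\<Sum>p<n. coord_scale (v p) (rep_op \<alpha> (unit_vec p)))"
        using coord_eq_sum_unit_vec[of "{..<n}" v] that
        by (metis (no_types, lifting) coord.linear_op_simps(2,5)[OF rep_op_simps(7)[OF \<alpha>]] finite_lessThan sum.cong)
      also have "\<dots> = coord_scale c (\<Sum>p<n. coord_scale (v p) (unit_vec p))"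
        using \<open>\<And>p. p < n \<Longrightarrow> _ p\<close> by (simp add: coord.scale_sum_right mult.commute)
      also have "\<dots> = coord_scale c v"
        using coord_eq_sum_unit_vec[of "{..<n}" v] that by simp
      finally show ?thesis .
    qed
    then show "\<exists>c. \<forall>v\<in>rep_space. rep_op \<alpha> v = coord_scale c v" by blast
  qed
  then show ?thesis by (auto simp: acts_by_scalar_def)
qed

lemma finitely_many_points_detect_scalars:
  obtains S where "finite S" "S \<subseteq> rat_points"
    "\<And>\<alpha>. \<alpha> \<in> \<MM> \<Longrightarrow> (\<And>x. x \<in> S \<Longrightarrow> eval_at x \<alpha> = 0) \<Longrightarrow> \<alpha> \<in> acts_by_scalar"
proof (rule finitely_many_points_detect_K[of acts_by_scalar scalar_defect "{..<n} \<times> {..<n}"])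
  show "acts_by_scalar = {\<alpha> \<in> \<MM>. scalar_defect \<alpha> = 0}" by (rule acts_by_scalar_iff)
  show "scalar_defect \<alpha> \<in> coord_space ({..<n} \<times> {..<n})" for \<alpha>
    by (auto simp: scalar_defect_def coord_space_def)
  show "scalar_defect (\<alpha> + \<beta>) = scalar_defect \<alpha> + scalar_defect \<beta>"
    if "\<alpha> \<in> \<MM>" "\<beta> \<in> \<MM>" for \<alpha> \<beta>
    using that by (auto simp: scalar_defect_def fun_eq_iff rep_op_simps)
  show "scalar_defect (map_scale c \<alpha>) = coord_scale c (scalar_defect \<alpha>)" if "\<alpha> \<in> \<MM>" for c \<alpha>
    using that by (auto simp: scalar_defect_def fun_eq_iff rep_op_simps coord_scale_def right_diff_distrib)
qed (use acts_by_scalar_amul acts_by_scalar_radical in auto)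

text \<open>Where \<open>g\<^sup>x\<close> is perfect, the condition on \<open>\<alpha>(x)\<close> in the definition of \<open>M\<^sup>d\<close> is automatic; so a map that vanishes at the
  remaining points lies in \<open>M\<^sup>d\<close>.\<close>

lemma factors_through_evaluation:
  assumes fin: "finite tilde_points"
    and der: "lie_derived map_scale map_bracket \<MM> = maps_d"
  obtains S where "finite S" "S \<subseteq> rat_points" "orbit_distinct S"
    "\<And>\<alpha> v. \<alpha> \<in> \<MM> \<Longrightarrow> (\<And>x. x \<in> S \<Longrightarrow> eval_at x \<alpha> = 0) \<Longrightarrow> rep_op \<alpha> v = 0"
proof -
  obtain S0 where S0: "finite S0" "S0 \<subseteq> rat_points"
    "\<And>\<alpha>. \<alpha> \<in> \<MM> \<Longrightarrow> (\<And>x. x \<in> S0 \<Longrightarrow> eval_at x \<alpha> = 0) \<Longrightarrow> \<alpha> \<in> acts_by_scalar"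
    using finitely_many_points_detect_scalars by blast
  \<comment> \<open>Equivariant maps that vanish at one point of each orbit vanish on \<open>S0\<close> and \<open>tilde_points\<close>.\<close>
  have f: "finite (S0 \<union> tilde_points)" using S0 fin by simp
  obtain S where S: "S \<subseteq> S0 \<union> tilde_points" "orbit_distinct S"
    "\<And>x. x \<in> S0 \<union> tilde_points \<Longrightarrow> \<exists>y\<in>S. \<exists>s\<in>carrier \<Gamma>. x = point_act s y"
    using orbit_representatives[OF f] by metis
  have Srat: "S \<subseteq> rat_points" using S(1) S0(2) by (auto simp: tilde_points_def)
  show ?thesis
  proof (rule that)
    show "finite S" using S(1) f finite_subset by blast
    show "S \<subseteq> rat_points" "orbit_distinct S" by fact+
    fix \<alpha> v assume \<alpha>: "\<alpha> \<in> \<MM>" and z: "\<And>x. x \<in> S \<Longrightarrow> eval_at x \<alpha> = 0"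
    have zero: "eval_at x \<alpha> = 0" if "x \<in> S0 \<union> tilde_points" for x
    proof -
      obtain y s where y: "y \<in> S" "s \<in> carrier \<Gamma>" "x = point_act s y"
        using S(3) \<open>x \<in> S0 \<union> tilde_points\<close> by blast
      then have "eval_at x \<alpha> = gact s (eval_at y \<alpha>)"
        using eval_at_point_act[OF y(2) _ \<alpha>, of y] Srat by auto
      then show ?thesis using z[OF y(1)] y(2) by (simp add: gact_simps)
    qed
    have "\<alpha> \<in> acts_by_scalar" using S0(3)[OF \<alpha>] zero by blast
    moreover have "eval_at x \<alpha> \<in> lie_derived gscale gbracket (point_fixed x)" if x: "x \<in> rat_points" for x
    proof (cases "x \<in> tilde_points")
      case True
      then show ?thesis using zero by (simp add: lie_derived_def span_zero)
    next
      case False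
      then show ?thesis using x eval_at_point_fixed[OF x \<alpha>] by (simp add: tilde_points_def)
    qed
    then have "\<alpha> \<in> lie_derived map_scale map_bracket \<MM>"
      unfolding der using \<alpha> by (simp add: maps_d_def)
    ultimately show "rep_op \<alpha> v = 0" by (rule scalar_derived_is_zero)
  qed
qed

text \<open>Lift \<open>u \<in> g\<^sup>x\<close> to an element of \<open>M\<close> with value \<open>u\<close> at \<open>x\<close> and \<open>0\<close> at the other points of \<open>S\<close>.  How it acts does not depend
  on the lift, which defines the action \<open>\<sigma> x\<close> of \<open>g\<^sup>x\<close> on \<open>V\<close>.\<close>

theorem irreducible_rep_is_evaluation:
  assumes fin: "finite tilde_points"
    and der: "lie_derived map_scale map_bracket \<MM> = maps_d"
  shows "evaluation_rep {..<n} \<rho>"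
proof -
  obtain S where S: "finite S" "S \<subseteq> rat_points" "orbit_distinct S"
    and factor: "\<And>\<alpha> v. \<alpha> \<in> \<MM> \<Longrightarrow> (\<And>x. x \<in> S \<Longrightarrow> eval_at x \<alpha> = 0) \<Longrightarrow> rep_op \<alpha> v = 0"
    using factors_through_evaluation[OF fin der] by metis
  have ev_simps: "eval_at x (\<alpha> + \<beta>) = eval_at x \<alpha> + eval_at x \<beta>" "eval_at x (\<alpha> - \<beta>) = eval_at x \<alpha> - eval_at x \<beta>"
    "eval_at x (map_scale c \<alpha>) = gscale c (eval_at x \<alpha>)"
    "eval_at x (map_bracket \<alpha> \<beta>) = gbracket (eval_at x \<alpha>) (eval_at x \<beta>)" if "x \<in> S" for x \<alpha> \<beta> c
    using that S(2) by (auto simp: eval_at_add eval_at_diff eval_at_scale eval_at_bracket)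
  \<comment> \<open>The action of \<open>\<alpha>\<close> depends only on the values of \<open>\<alpha>\<close> on \<open>S\<close>.\<close>
  have same: "rep_op \<alpha> v = rep_op \<beta> v"
    if "\<alpha> \<in> \<MM>" "\<beta> \<in> \<MM>" "\<And>x. x \<in> S \<Longrightarrow> eval_at x \<alpha> = eval_at x \<beta>" for \<alpha> \<beta> v
  proof -
    have d: "\<alpha> - \<beta> \<in> \<MM>" using that maps.subspace_diff[OF equivariant_maps_subspace] by blast
    have "rep_op (\<alpha> - \<beta>) v = 0" by (rule factor[OF d]) (simp add: ev_simps that)
    then show ?thesis using rep_op_simps(5)[OF d that(2), of v] by simp
  qed
  define lift where "lift x u = (SOME \<alpha>. \<alpha> \<in> \<MM> \<and> eval_at x \<alpha> = u \<and> (\<forall>y\<in>S - {x}. eval_at y \<alpha> = 0))" for x u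
  have lift: "lift x u \<in> \<MM>" "eval_at x (lift x u) = u" "\<And>y. y \<in> S \<Longrightarrow> y \<noteq> x \<Longrightarrow> eval_at y (lift x u) = 0"
    if "x \<in> S" "u \<in> point_fixed x" for x u
  proof -
    have "\<exists>\<alpha>. \<alpha> \<in> \<MM> \<and> eval_at x \<alpha> = u \<and> (\<forall>y\<in>S - {x}. eval_at y \<alpha> = 0)"
      using evaluation_surjective[OF S that] by metis
    from someI_ex[OF this]
    show "lift x u \<in> \<MM>" "eval_at x (lift x u) = u" "\<And>y. y \<in> S \<Longrightarrow> y \<noteq> x \<Longrightarrow> eval_at y (lift x u) = 0"
      unfolding lift_def by auto
  qed
  define \<sigma> where "\<sigma> x u = rep_op (lift x u)" for x u
  have gb0: "gbracket 0 u = 0" "gbracket u 0 = 0" for u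
    using gbracket_simps(3)[of 0 0 u] gbracket_simps(4)[of u 0 0] by simp_all
  have \<sigma>eq: "\<sigma> x u v = rep_op \<alpha> v"
    if "x \<in> S" "u \<in> point_fixed x" "\<alpha> \<in> \<MM>" "eval_at x \<alpha> = u" "\<And>y. y \<in> S \<Longrightarrow> y \<noteq> x \<Longrightarrow> eval_at y \<alpha> = 0"
    for x u \<alpha> v
    unfolding \<sigma>_def
  proof (rule same[OF lift(1)[OF that(1,2)] that(3)])
    show "eval_at y (lift x u) = eval_at y \<alpha>" if "y \<in> S" for y
      using lift[OF \<open>x \<in> S\<close> \<open>u \<in> point_fixed x\<close>] that \<open>eval_at x \<alpha> = u\<close> \<open>\<And>y. y \<in> S \<Longrightarrow> y \<noteq> x \<Longrightarrow> eval_at y \<alpha> = 0\<close>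
      by (cases "y = x") auto
  qed
  have \<sigma>lin: "coord.linear_op (\<sigma> x u)" if "x \<in> S" "u \<in> point_fixed x" for x u
    unfolding \<sigma>_def using lift(1)[OF that] rep_op_simps(7) by blast
  have \<sigma>comm: "\<sigma> x u (\<sigma> y w v) = \<sigma> y w (\<sigma> x u v)"
    if "x \<in> S" "y \<in> S" "x \<noteq> y" "u \<in> point_fixed x" "w \<in> point_fixed y" for x y u w v
  proof -
    note l = lift[OF that(1,4)] and l' = lift[OF that(2,5)]
    have "rep_op (map_bracket (lift x u) (lift y w)) v = 0"
    proof (rule factor[OF equivariant_bracket[OF l(1) l'(1)]])
      show "eval_at z (map_bracket (lift x u) (lift y w)) = 0" if "z \<in> S" for z
        using l(3)[of z] l'(3)[of z] that \<open>x \<noteq> y\<close> by (cases "z = x") (auto simp: ev_simps gb0)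
    qed
    then show ?thesis using rep_op_simps(6)[OF l(1) l'(1), of v] by (simp add: \<sigma>_def)
  qed
  have \<rho>sum: "rep_op \<alpha> v = (\<Sum>x\<in>S. \<sigma> x (eval_at x \<alpha>) v)" if \<alpha>: "\<alpha> \<in> \<MM>" for \<alpha> v
  proof -
    have pf: "eval_at x \<alpha> \<in> point_fixed x" if "x \<in> S" for x
      using eval_at_point_fixed \<alpha> S(2) that by blast
    have lM: "lift x (eval_at x \<alpha>) \<in> \<MM>" if "x \<in> S" for x using lift(1) pf that by blast
    have "rep_op \<alpha> v = rep_op (\<Sum>x\<in>S. lift x (eval_at x \<alpha>)) v"
    proof (rule same[OF \<alpha>])
      show "(\<Sum>x\<in>S. lift x (eval_at x \<alpha>)) \<in> \<MM>"
        using lM by (intro maps.subspace_sum equivariant_maps_subspace)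
      fix y assume y: "y \<in> S"
      have "eval_at y (\<Sum>x\<in>S. lift x (eval_at x \<alpha>)) = (\<Sum>x\<in>S. eval_at y (lift x (eval_at x \<alpha>)))"
        using y S(2) by (intro eval_at_sum) auto
      also have "\<dots> = (\<Sum>x\<in>S. if x = y then eval_at y \<alpha> else 0)"
        using lift(2,3) pf y by (intro sum.cong) auto
      finally show "eval_at y \<alpha> = eval_at y (\<Sum>x\<in>S. lift x (eval_at x \<alpha>))"
        using y S(1) by simp
    qed
    also have "\<dots> = (\<Sum>x\<in>S. \<sigma> x (eval_at x \<alpha>) v)"
      unfolding \<sigma>_def by (rule rep_op_sum) (rule lM)
    finally show ?thesis .
  qed
  have \<sigma>irr: "coord.irreducible_under (\<Union>x\<in>S. \<sigma> x ` point_fixed x) rep_space"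
    unfolding coord.irreducible_under_def
  proof (intro conjI allI impI)
    show "coord.subspace rep_space" "rep_space \<noteq> {0}" using coord.irreducible_underD[OF rep_op_irreducible] by blast+
    show "coord.invariant_under (\<Union>x\<in>S. \<sigma> x ` point_fixed x) rep_space"
      unfolding coord.invariant_under_def \<sigma>_def using lift(1) rep_op_simps(1) by blast
    fix W assume W: "coord.subspace W" "W \<subseteq> rep_space" "coord.invariant_under (\<Union>x\<in>S. \<sigma> x ` point_fixed x) W"
    have "rep_op \<alpha> w \<in> W" if "\<alpha> \<in> \<MM>" "w \<in> W" for \<alpha> w
      unfolding \<rho>sum[OF that(1)]
    proof (rule coord.subspace_sum[OF W(1)])
      fix x assume x: "x \<in> S"
      then have "eval_at x \<alpha> \<in> point_fixed x" using eval_at_point_fixed that S(2) by blast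
      then show "\<sigma> x (eval_at x \<alpha>) w \<in> W"
        using W(3) x that(2) unfolding coord.invariant_under_def by blast
    qed
    then have "coord.invariant_under (rep_op ` \<MM>) W" by (auto simp: coord.invariant_under_def)
    then show "W = {0} \<or> W = rep_space"
      using rep_op_irreducible W unfolding coord.irreducible_under_def by blast
  qed
  have "\<exists>d e a. coord.tensor_basis S point_fixed \<sigma> rep_space d e a"
  proof (rule coord.tensor_basis_exists[OF S(1) _ _ _ _ rep_space_in_span])
    show "coord.linear_op (\<sigma> x u)" if "x \<in> S" "u \<in> point_fixed x" for x u by (rule \<sigma>lin[OF that])
    show "\<sigma> x u (\<sigma> y w v) = \<sigma> y w (\<sigma> x u v)"
      if "x \<in> S" "y \<in> S" "x \<noteq> y" "u \<in> point_fixed x" "w \<in> point_fixed y" for x y u w v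
      by (rule \<sigma>comm[OF that])
  qed (simp_all add: \<sigma>irr)
  then obtain d e a where tb: "coord.tensor_basis S point_fixed \<sigma> rep_space d e a" by blast
  have J: "PiE S (\<lambda>x. {..<d x}) \<noteq> {}"
  proof
    assume "PiE S (\<lambda>x. {..<d x}) = {}"
    then have "rep_space \<subseteq> {0}" using tb by (simp add: coord.tensor_basis_def)
    then show False using coord.irreducible_underD(2,4)[OF rep_op_irreducible] by blast
  qed
  have "lie_rep gscale gbracket (point_fixed x) {..<d x} (matrix_rep d a x)" if x: "x \<in> S" for x
  proof (rule matrix_rep_lie_rep[OF tb S(1) x J])
    fix u w v c assume u: "u \<in> point_fixed x" and w: "w \<in> point_fixed x"
    note lu = lift[OF x u] and lw = lift[OF x w]
    have pf: "u + w \<in> point_fixed x" "gbracket u w \<in> point_fixed x"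
      using point_fixed_closed u w by blast+
    show "u + w \<in> point_fixed x" "gbracket u w \<in> point_fixed x" by fact+
    have "\<sigma> x (u + w) v = rep_op (lift x u + lift x w) v"
      using lu lw x by (intro \<sigma>eq[OF x pf(1)])
        (auto simp: ev_simps intro: maps.subspace_add[OF equivariant_maps_subspace])
    then show "\<sigma> x (u + w) v = \<sigma> x u v + \<sigma> x w v"
      using rep_op_simps(5)[OF lu(1) lw(1)] by (simp add: \<sigma>_def)
    have "\<sigma> x (gbracket u w) v = rep_op (map_bracket (lift x u) (lift x w)) v"
      using lu lw x by (intro \<sigma>eq[OF x pf(2)]) (auto simp: ev_simps gb0 intro: equivariant_bracket)
    then show "\<sigma> x (gbracket u w) v = \<sigma> x u (\<sigma> x w v) - \<sigma> x w (\<sigma> x u v)"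
      using rep_op_simps(6)[OF lu(1) lw(1)] by (simp add: \<sigma>_def)
  next
    fix u c v assume u: "u \<in> point_fixed x"
    note lu = lift[OF x u]
    show pf: "gscale c u \<in> point_fixed x" using point_fixed_closed u by blast
    have "\<sigma> x (gscale c u) v = rep_op (map_scale c (lift x u)) v"
      using lu x by (intro \<sigma>eq[OF x pf])
        (auto simp: ev_simps intro: maps.subspace_scale[OF equivariant_maps_subspace])
    then show "\<sigma> x (gscale c u) v = coord_scale c (\<sigma> x u v)"
      using rep_op_simps(4)[OF lu(1)] by (simp add: \<sigma>_def)
  qed (rule \<sigma>lin[OF x])
  moreover have "isomorphic_reps \<MM> {..<n} \<rho> (PiE S (\<lambda>x. {..<d x}))
    (\<lambda>\<alpha>. tensor_rep S (\<lambda>x. {..<d x}) (matrix_rep d a) (\<lambda>x. eval_at x \<alpha>))"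
  proof (rule tensor_basis_isomorphic[OF tb S(1) \<sigma>lin])
    show "eval_at x \<alpha> \<in> point_fixed x" if "\<alpha> \<in> \<MM>" "x \<in> S" for \<alpha> x
      using eval_at_point_fixed that S(2) by blast
    show "\<rho> \<alpha> v = (\<Sum>x\<in>S. \<sigma> x (eval_at x \<alpha>) v)" if "\<alpha> \<in> \<MM>" "v \<in> rep_space" for \<alpha> v
      unfolding rep_op_eq_rep[OF that(2), symmetric] by (rule \<rho>sum[OF that(1)])
  qed auto
  ultimately show ?thesis unfolding evaluation_rep_def using S(1,2) by blast
qed

end

end

section \<open>One-dimensional evaluation representations\<close>

text \<open>Operators on a line commute.\<close>

lemma one_dimensional_rep_kills_derived:
  fixes scale :: "'k::field \<Rightarrow> 'l::ab_group_add \<Rightarrow> 'l"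
  assumes vs: "vector_space scale" and rep: "lie_rep scale bracket L {..<1::nat} r"
    and L: "module.subspace scale L" "\<And>u w. u \<in> L \<Longrightarrow> w \<in> L \<Longrightarrow> bracket u w \<in> L"
    and u: "u \<in> lie_derived scale bracket L" and v: "v \<in> coord_space {..<1}"
  shows "r u v = 0"
proof -
  interpret vector_space scale by (rule vs)
  define \<mu> where "\<mu> u = r u (unit_vec 0) 0" for u
  have e: "unit_vec 0 \<in> coord_space {..<1::nat}" by (simp add: coord_space_def unit_vec_def)
  have line: "w = coord_scale (w 0) (unit_vec 0)" if "w \<in> coord_space {..<1::nat}" for w :: "nat \<Rightarrow> 'k"
    using that by (auto simp: coord_space_def coord_scale_def unit_vec_def fun_eq_iff)
  have r: "r u w = coord_scale (\<mu> u) w" if u: "u \<in> L" and w: "w \<in> coord_space {..<1}" for u w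
  proof -
    have lin: "linear_on {..<1} {..<1} (r u)" using rep u by (simp add: lie_rep_def)
    have "r u (unit_vec 0) = coord_scale (\<mu> u) (unit_vec 0)"
      unfolding \<mu>_def by (rule line) (use lin e in \<open>unfold linear_on_def, blast\<close>)
    moreover have "r u (coord_scale (w 0) (unit_vec 0)) = coord_scale (w 0) (r u (unit_vec 0))"
      using lin e unfolding linear_on_def by blast
    then have "r u w = coord_scale (w 0) (r u (unit_vec 0))"
      by (simp only: line[OF w, symmetric])
    ultimately have "r u w = coord_scale (\<mu> u) (coord_scale (w 0) (unit_vec 0))"
      by (simp add: coord_scale_def mult.left_commute)
    then show ?thesis by (simp only: line[OF w, symmetric])
  qed
  let ?Z = "{u \<in> L. \<forall>w\<in>coord_space {..<1}. r u w = 0}"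
  have "subspace ?Z"
  proof (rule subspaceI)
    have "r (scale 0 0) w = coord_scale 0 (r 0 w)" if "w \<in> coord_space {..<1}" for w
      using rep subspace_0[OF L(1)] that unfolding lie_rep_def by blast
    then show "0 \<in> ?Z" using subspace_0[OF L(1)] by (simp add: coord_scale_def zero_fun_def)
  qed (use rep L(1) in \<open>auto simp: lie_rep_def subspace_add subspace_scale coord_scale_def\<close>)
  moreover have "bracket u w \<in> ?Z" if "u \<in> L" "w \<in> L" for u w
  proof -
    have "r (bracket u w) v = 0" if v: "v \<in> coord_space {..<1}" for v
    proof -
      have "r (bracket u w) v = r u (r w v) - r w (r u v)"
        using rep \<open>u \<in> L\<close> \<open>w \<in> L\<close> v by (simp add: lie_rep_def)
      moreover have "coord_scale c v \<in> coord_space {..<1}" for c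
        using v by (simp add: coord_space_def coord_scale_def)
      ultimately show ?thesis
        using r \<open>u \<in> L\<close> \<open>w \<in> L\<close> v by (simp add: coord_scale_def mult.left_commute)
    qed
    then show ?thesis using that L(2) by simp
  qed
  ultimately have "span {bracket u w | u w. u \<in> L \<and> w \<in> L} \<subseteq> ?Z"
    by (intro span_minimal) auto
  then show ?thesis using u v by (auto simp: lie_derived_def)
qed

context char_0_equivariant_map_algebra
begin

lemma point_fixed_subspace: "subspace (point_fixed x)"
proof (rule subspaceI)
  show "0 \<in> point_fixed x" by (auto simp: point_fixed_def stabilizer_def gact_simps)
qed (use point_fixed_closed in auto)

lemma lie_derived_subset_maps_d: "lie_derived map_scale map_bracket \<MM> \<subseteq> maps_d"
  unfolding lie_derived_def[of map_scale]
proof (rule maps.span_minimal)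
  have sub: "subspace (lie_derived gscale gbracket (point_fixed x))" for x
    by (simp add: lie_derived_def)
  show "maps.subspace maps_d"
    by (rule maps.subspaceI)
      (auto simp: maps_d_def eval_at_zero eval_at_add eval_at_scale
        intro: subspace_0[OF sub] subspace_add[OF sub] subspace_scale[OF sub]
          maps.subspace_0[OF equivariant_maps_subspace] maps.subspace_add[OF equivariant_maps_subspace]
          maps.subspace_scale[OF equivariant_maps_subspace])
  show "{map_bracket \<alpha> \<beta> | \<alpha> \<beta>. \<alpha> \<in> \<MM> \<and> \<beta> \<in> \<MM>} \<subseteq> maps_d"
  proof clarify
    fix \<alpha> \<beta> assume M: "\<alpha> \<in> \<MM>" "\<beta> \<in> \<MM>"
    have "gbracket (eval_at x \<alpha>) (eval_at x \<beta>) \<in> lie_derived gscale gbracket (point_fixed x)"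
      if "x \<in> rat_points" for x
      unfolding lie_derived_def using M eval_at_point_fixed[OF that] by (intro span_base) blast
    then show "map_bracket \<alpha> \<beta> \<in> maps_d"
      using M by (simp add: maps_d_def equivariant_bracket eval_at_bracket)
  qed
qed

lemma functional_vanishing_on_derived:
  assumes "\<alpha> \<notin> lie_derived map_scale map_bracket \<MM>"
  obtains \<theta> where "Vector_Spaces.linear map_scale (*) \<theta>"
    "\<And>\<beta>. \<beta> \<in> lie_derived map_scale map_bracket \<MM> \<Longrightarrow> \<theta> \<beta> = 0" "\<theta> \<alpha> = 1"
proof -
  interpret mp: vector_space_pair map_scale "(*) :: 'k \<Rightarrow> 'k \<Rightarrow> 'k"
    by unfold_locales (auto simp: algebra_simps)
  let ?L = "lie_derived map_scale map_bracket \<MM>"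
  have L: "maps.subspace ?L" by (simp add: lie_derived_def)
  obtain D where D: "D \<subseteq> ?L" "maps.independent D" "?L \<subseteq> maps.span D"
    using maps.maximal_independent_subset[of ?L] by blast
  have sp: "maps.span D = ?L" by (rule maps.span_subspace[OF D(1,3) L])
  have "maps.independent (insert \<alpha> D)"
    using assms D(2) sp by (intro maps.independent_insertI) auto
  then obtain \<theta> where \<theta>: "Vector_Spaces.linear map_scale (*) \<theta>"
    "\<forall>\<beta>\<in>insert \<alpha> D. \<theta> \<beta> = (if \<beta> = \<alpha> then 1 else 0)"
    using mp.linear_independent_extend[of "insert \<alpha> D" "\<lambda>\<beta>. if \<beta> = \<alpha> then 1 else 0"] by blast
  have "\<theta> \<beta> = 0" if "\<beta> \<in> D" for \<beta>
    using \<theta>(2) that assms D(1) by auto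
  then have "\<theta> \<beta> = 0" if "\<beta> \<in> ?L" for \<beta>
    using mp.linear_eq_0_on_span[OF \<theta>(1), of D \<beta>] that sp by blast
  then show ?thesis using that \<theta> by simp
qed

text \<open>A tensor product can be one-dimensional only if there is exactly one multi-index, that is, if every factor is
  one-dimensional.\<close>

theorem maps_d_if_evaluation:
  assumes all: "\<And>n \<rho>. irreducible_rep map_scale map_bracket \<MM> {..<n::nat} \<rho> \<Longrightarrow>
    evaluation_rep {..<n} \<rho>"
  shows "lie_derived map_scale map_bracket \<MM> = maps_d"
proof (rule antisym[OF lie_derived_subset_maps_d], rule subsetI, rule ccontr)
  fix \<alpha> assume \<alpha>: "\<alpha> \<in> maps_d" and n\<alpha>: "\<alpha> \<notin> lie_derived map_scale map_bracket \<MM>"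
  have \<alpha>M: "\<alpha> \<in> \<MM>" using \<alpha> by (simp add: maps_d_def)
  obtain \<theta> where \<theta>: "Vector_Spaces.linear map_scale (*) \<theta>"
    "\<And>\<beta>. \<beta> \<in> lie_derived map_scale map_bracket \<MM> \<Longrightarrow> \<theta> \<beta> = 0" "\<theta> \<alpha> = 1"
    using functional_vanishing_on_derived[OF n\<alpha>] by metis
  define \<rho> where "\<rho> \<beta> = (coord_scale (\<theta> \<beta>) :: (nat \<Rightarrow> 'k) \<Rightarrow> nat \<Rightarrow> 'k)" for \<beta>
  let ?V = "coord_space {..<1::nat} :: (nat \<Rightarrow> 'k) set"
  let ?e = "unit_vec 0 :: nat \<Rightarrow> 'k"
  have eV: "?e \<in> ?V" by (simp add: coord_space_def unit_vec_def)
  have e0: "?e \<noteq> 0" by (auto simp: unit_vec_def fun_eq_iff)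
  have line: "v = coord_scale (v 0) ?e" if "v \<in> ?V" for v
    using that by (auto simp: coord_space_def coord_scale_def unit_vec_def fun_eq_iff)
  have \<theta>0: "\<theta> (map_bracket \<beta> \<gamma>) = 0" if "\<beta> \<in> \<MM>" "\<gamma> \<in> \<MM>" for \<beta> \<gamma>
    by (rule \<theta>(2)) (use that in \<open>auto simp: lie_derived_def intro!: maps.span_base\<close>)
  have "irreducible_rep map_scale map_bracket \<MM> {..<1} \<rho>"
    unfolding irreducible_rep_def
  proof (intro conjI allI impI)
    show "lie_rep map_scale map_bracket \<MM> {..<1} \<rho>"
      using \<theta>(1) \<theta>0 unfolding Vector_Spaces.linear_iff
      by (auto simp: lie_rep_def linear_on_def \<rho>_def coord_scale_def coord_space_def fun_eq_iff algebra_simps)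
    show "?V \<noteq> {0}" using eV e0 by blast
    fix W assume W: "coord.subspace W \<and> W \<subseteq> ?V \<and> (\<forall>a\<in>\<MM>. \<forall>w\<in>W. \<rho> a w \<in> W)"
    show "W = {0} \<or> W = ?V"
    proof (cases "W = {0}")
      case False
      then obtain w where w: "w \<in> W" "w \<noteq> 0" using W coord.subspace_0 by blast
      then have "w 0 \<noteq> 0" using W line[of w] by (auto simp: coord_scale_def fun_eq_iff)
      have "v \<in> W" if "v \<in> ?V" for v
      proof -
        have "v = coord_scale (v 0 / w 0) w"
          using line[OF that] line[of w] w W \<open>w 0 \<noteq> 0\<close>
          by (metis coord.scale_scale nonzero_eq_divide_eq subsetD)
        then show ?thesis using W w coord.subspace_scale by metis
      qed
      then show ?thesis using W by blast
    qed simp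
  qed
  then have "evaluation_rep {..<1} \<rho>" by (rule all)
  then obtain S d r where S: "finite S" "S \<subseteq> rat_points"
    and r: "\<And>x. x \<in> S \<Longrightarrow> lie_rep gscale gbracket (point_fixed x) {..<d x :: nat} (r x)"
    and iso: "isomorphic_reps \<MM> {..<1} \<rho> (PiE S (\<lambda>x. {..<d x}))
        (\<lambda>\<alpha>. tensor_rep S (\<lambda>x. {..<d x}) r (\<lambda>x. eval_at x \<alpha>))"
    unfolding evaluation_rep_def by blast
  let ?J = "PiE S (\<lambda>x. {..<d x})"
  obtain T where T: "linear_on {..<1} ?J T" "bij_betw T ?V (coord_space ?J)"
    "\<And>\<beta> v. \<beta> \<in> \<MM> \<Longrightarrow> v \<in> ?V \<Longrightarrow>
      T (\<rho> \<beta> v) = tensor_rep S (\<lambda>x. {..<d x}) r (\<lambda>x. eval_at x \<beta>) (T v)"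
    using iso unfolding isomorphic_reps_def by blast
  define t where "t = T ?e"
  have tJ: "t \<in> coord_space ?J" using T(1) eV by (simp add: linear_on_def t_def)
  have "0 \<in> ?V" by (simp add: coord_space_def)
  then have "T (coord_scale 0 0) = coord_scale 0 (T 0)"
    using T(1) unfolding linear_on_def by blast
  then have "T 0 = 0" by (simp add: coord_scale_def zero_fun_def)
  then have t0: "t \<noteq> 0"
    using T(2) eV e0 \<open>0 \<in> ?V\<close> unfolding t_def bij_betw_def inj_on_def by metis
  have mult: "\<exists>a. c = coord_scale a t" if "c \<in> coord_space ?J" for c
  proof -
    have "c \<in> T ` ?V" using T(2) that by (simp add: bij_betw_def)
    then obtain v where v: "v \<in> ?V" "c = T v" by blast
    have "T (coord_scale (v 0) ?e) = coord_scale (v 0) t"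
      using T(1) eV unfolding t_def linear_on_def by blast
    then have "c = coord_scale (v 0) t" by (simp only: v(2) line[OF v(1), symmetric])
    then show ?thesis by blast
  qed
  \<comment> \<open>Two multi-indices would give two independent vectors in the image of a line.\<close>
  have single: "i = j" if "i \<in> ?J" "j \<in> ?J" for i j
  proof (rule ccontr)
    assume ne: "i \<noteq> j"
    have "(unit_vec i :: _ \<Rightarrow> 'k) \<in> coord_space ?J" "(unit_vec j :: _ \<Rightarrow> 'k) \<in> coord_space ?J"
      using that unfolding coord_space_def unit_vec_def by auto
    then obtain a b where a: "unit_vec i = coord_scale a t" and b: "unit_vec j = coord_scale b t"
      using mult by meson
    have "a * t i = 1" "a * t j = 0" "b * t j = 1"
      using fun_cong[OF a, of i] fun_cong[OF a, of j] fun_cong[OF b, of j] ne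
      by (auto simp: unit_vec_def coord_scale_def)
    then show False by auto
  qed
  have d1: "d x = 1" if x: "x \<in> S" and i: "i \<in> ?J" for x i
  proof -
    have up: "i(x := m) \<in> ?J" if "m < d x" for m using i x that by (auto simp: PiE_iff extensional_def)
    have "m = i x" if "m < d x" for m using single[OF up[OF that] i] by (metis fun_upd_same)
    moreover have "i x < d x" using PiE_mem[OF i x] by simp
    ultimately show ?thesis by (metis less_one linorder_neqE_nat not_less_zero zero_less_one)
  qed
  have "T (\<rho> \<alpha> ?e) = t" using \<theta>(3) by (simp add: \<rho>_def t_def coord_scale_def)
  then have "t = tensor_rep S (\<lambda>x. {..<d x}) r (\<lambda>x. eval_at x \<alpha>) t"
    using T(3)[OF \<alpha>M eV] by (simp add: t_def)
  also have "\<dots> = 0"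
  proof
    fix i
    have "r x (eval_at x \<alpha>) (\<lambda>m. t (i(x := m))) = 0" if x: "x \<in> S" and i: "i \<in> ?J" for x
    proof (rule one_dimensional_rep_kills_derived[OF vector_space_axioms _ point_fixed_subspace,
          where r = "r x" and bracket = gbracket])
      show "lie_rep gscale gbracket (point_fixed x) {..<1} (r x)" using r[OF x] d1[OF x i] by simp
      show "eval_at x \<alpha> \<in> lie_derived gscale gbracket (point_fixed x)"
        using \<alpha> x S(2) by (auto simp: maps_d_def)
      have "t (i(x := m)) = 0" if "\<not> m < d x" for m
      proof -
        have "i(x := m) \<notin> ?J" using PiE_mem[OF _ x, of "i(x := m)"] that by auto
        then show ?thesis using tJ by (simp add: coord_space_def)
      qed
      then show "(\<lambda>m. t (i(x := m))) \<in> coord_space {..<1}"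
        using d1[OF x i] by (simp add: coord_space_def)
    qed (rule point_fixed_closed)
    then show "tensor_rep S (\<lambda>x. {..<d x}) r (\<lambda>x. eval_at x \<alpha>) t i = 0 i"
      by (simp add: tensor_rep_def)
  qed
  finally show False using t0 by simp
qed

end

theorem corollary5p16:
  fixes gscale :: "'k::{alg_closed_field, field_char_0} \<Rightarrow> 'g::ab_group_add \<Rightarrow> 'g"
    and gbracket :: "'g \<Rightarrow> 'g \<Rightarrow> 'g"
    and B :: "'g set"
    and ascale :: "'k \<Rightarrow> 'a::comm_ring \<Rightarrow> 'a"
    and aunit :: 'a
    and \<Gamma> :: "('c, 'd) monoid_scheme"
    and aact :: "'c \<Rightarrow> 'a \<Rightarrow> 'a"
    and gact :: "'c \<Rightarrow> 'g \<Rightarrow> 'g"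
  assumes "equivariant_map_algebra gscale gbracket B ascale aunit \<Gamma> aact gact"
    and "finite (equivariant_map_algebra.tilde_points gscale gbracket ascale aunit \<Gamma> aact gact)"
  shows "lie_derived
      (equivariant_map_algebra.map_scale ascale)
      (equivariant_map_algebra.map_bracket gscale gbracket B ascale)
      (equivariant_map_algebra.equivariant_maps gscale B ascale \<Gamma> aact gact)
    = equivariant_map_algebra.maps_d gscale gbracket B ascale aunit \<Gamma> aact gact
    \<longleftrightarrow>
    (\<forall>(n :: nat) \<rho>.
      irreducible_rep
        (equivariant_map_algebra.map_scale ascale)
        (equivariant_map_algebra.map_bracket gscale gbracket B ascale)
        (equivariant_map_algebra.equivariant_maps gscale B ascale \<Gamma> aact gact)
        {..<n} \<rho>
      \<longrightarrow> equivariant_map_algebra.evaluation_rep gscale gbracket B ascale aunit \<Gamma> aact gact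
        {..<n} \<rho>)"
proof -
  interpret char_0_equivariant_map_algebra gscale gbracket B ascale aunit \<Gamma> aact gact
    unfolding char_0_equivariant_map_algebra_def by (rule assms(1))
  show ?thesis
    using irreducible_rep_is_evaluation[OF _ assms(2)] maps_d_if_evaluation by blast
qed

end
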